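(* Let $R$ be a ring, let $n\geqslant 0$, and let $G$ be a group with an epimorphism $\phi\colon G\to\mathbb{Z}$. If $K=\ker\phi$ is of type $\mathtt{FP}_n(R)$, then $$H^{i+1}(G;RG)\cong H^i(K;RK)$$ as $RK$-modules for all $i<n$, and $H^n(K;RK)$ is isomorphic as an $RK$-module to a submodule of $H^{n+1}(G;RG)$.
   Context: Rings are associative, unital and non-zero (not necessarily commutative). A group $K$ is of type $\mathtt{FP}_n(R)$ if the trivial $RK$-module $R$ admits a resolution $\cdots\to P_1\to P_0\to R\to 0$ by projective left $RK$-modules with $P_i$ finitely generated for all $i\leqslant n$. The module structure on cohomology: $H^i(G;RG)$ is computed using the left module structure of the bimodule $RG$; the remaining right module structure, turned into a left one via $g\mapsto g^{-1}$, makes $H^i(G;RG)$ an $RG$-module, and hence an $RK$-module by restriction; similarly $H^i(K;RK)$ is an $RK$-module. *)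

theory Defs
  imports "HOL-Algebra.Module" "HOL-Algebra.AbelCoset" "HOL-Algebra.Elementary_Groups"
begin

section \<open>Left modules over a not necessarily commutative ring\<close>

text \<open>The record type is the one of \<^theory>\<open>HOL-Algebra.Module\<close>, whose locale
  \<open>module\<close> is restricted to commutative base rings. As there, the fields \<open>mult\<close> and \<open>one\<close>
  of a module record carry no information.\<close>

locale left_module = R?: ring R + M?: abelian_group M
  for R :: "('a, 'u) ring_scheme" (structure) and M :: "('a, 'b, 'v) module_scheme" (structure) +
  assumes smult_closed:
      "\<lbrakk>a \<in> carrier R; x \<in> carrier M\<rbrakk> \<Longrightarrow> a \<odot>\<^bsub>M\<^esub> x \<in> carrier M"
    and smult_l_distr:
      "\<lbrakk>a \<in> carrier R; b \<in> carrier R; x \<in> carrier M\<rbrakk> \<Longrightarrow>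
        (a \<oplus> b) \<odot>\<^bsub>M\<^esub> x = a \<odot>\<^bsub>M\<^esub> x \<oplus>\<^bsub>M\<^esub> b \<odot>\<^bsub>M\<^esub> x"
    and smult_r_distr:
      "\<lbrakk>a \<in> carrier R; x \<in> carrier M; y \<in> carrier M\<rbrakk> \<Longrightarrow>
        a \<odot>\<^bsub>M\<^esub> (x \<oplus>\<^bsub>M\<^esub> y) = a \<odot>\<^bsub>M\<^esub> x \<oplus>\<^bsub>M\<^esub> a \<odot>\<^bsub>M\<^esub> y"
    and smult_assoc1:
      "\<lbrakk>a \<in> carrier R; b \<in> carrier R; x \<in> carrier M\<rbrakk> \<Longrightarrow>
        (a \<otimes> b) \<odot>\<^bsub>M\<^esub> x = a \<odot>\<^bsub>M\<^esub> (b \<odot>\<^bsub>M\<^esub> x)"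
    and smult_one: "x \<in> carrier M \<Longrightarrow> \<one> \<odot>\<^bsub>M\<^esub> x = x"

definition module_hom ::
    "('s, 'u) ring_scheme \<Rightarrow> ('s, 'a, 'v) module_scheme \<Rightarrow> ('s, 'b, 'w) module_scheme \<Rightarrow> ('a \<Rightarrow> 'b) set"
  where "module_hom S M N =
    {f \<in> carrier M \<rightarrow> carrier N.
      (\<forall>x\<in>carrier M. \<forall>y\<in>carrier M. f (x \<oplus>\<^bsub>M\<^esub> y) = f x \<oplus>\<^bsub>N\<^esub> f y) \<and>
      (\<forall>a\<in>carrier S. \<forall>x\<in>carrier M. f (a \<odot>\<^bsub>M\<^esub> x) = a \<odot>\<^bsub>N\<^esub> f x)}"

definition module_isomorphic ::
    "('s, 'u) ring_scheme \<Rightarrow> ('s, 'a, 'v) module_scheme \<Rightarrow> ('s, 'b, 'w) module_scheme \<Rightarrow> bool"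
  where "module_isomorphic S M N \<longleftrightarrow>
    (\<exists>f \<in> module_hom S M N. bij_betw f (carrier M) (carrier N))"

definition finitely_generated_module ::
    "('s, 'u) ring_scheme \<Rightarrow> ('s, 'a, 'v) module_scheme \<Rightarrow> bool"
  where "finitely_generated_module S M \<longleftrightarrow>
    (\<exists>X. finite X \<and> X \<subseteq> carrier M \<and>
      (\<forall>N. submodule N S M \<and> X \<subseteq> N \<longrightarrow> N = carrier M))"

text \<open>Projectivity is the lifting property against surjections \<open>M \<rightarrow> N\<close>. A definition cannot
  quantify over types, so \<open>M\<close> and \<open>N\<close> range over modules of two fixed types. This is no
  restriction: these types accommodate the canonical surjection onto \<open>P\<close> from the free module of
  finitely supported functions \<open>carrier P \<rightarrow> S\<close>, and a splitting of that surjection makes \<open>P\<close> a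
  direct summand of a free module.\<close>

definition projective_module :: "('s, 'u) ring_scheme \<Rightarrow> ('s, 'p) module \<Rightarrow> bool"
  where "projective_module S P \<longleftrightarrow> left_module S P \<and>
    (\<forall>(M :: ('s, 'p \<Rightarrow> 's) module) (N :: ('s, 'p) module).
      left_module S M \<and> left_module S N \<longrightarrow>
      (\<forall>f \<in> module_hom S M N. f ` carrier M = carrier N \<longrightarrow>
        (\<forall>g \<in> module_hom S P N. \<exists>h \<in> module_hom S P M. \<forall>x\<in>carrier P. f (h x) = g x)))"

definition quotient_module :: "('s, 'a, 'v) module_scheme \<Rightarrow> 'a set \<Rightarrow> ('s, 'a set) module"
  where "quotient_module M N =
    \<lparr>carrier = a_rcosets\<^bsub>M\<^esub> N, mult = undefined, one = undefined,
     zero = N, add = (\<lambda>X Y. X <+>\<^bsub>M\<^esub> Y),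
     smult = (\<lambda>a X. \<Union>x\<in>X. N +>\<^bsub>M\<^esub> (a \<odot>\<^bsub>M\<^esub> x))\<rparr>"

definition regular_module :: "('s, 'u) ring_scheme \<Rightarrow> ('s, 's) module"
  where "regular_module S =
    \<lparr>carrier = carrier S, mult = mult S, one = one S, zero = zero S, add = add S,
     smult = mult S\<rparr>"


section \<open>Group rings\<close>

text \<open>An element \<open>\<Sum> r\<^sub>g g\<close> is the finitely supported function \<open>g \<mapsto> r\<^sub>g\<close>, extended by zero
  outside the carrier of the group. In particular, for a subgroup \<open>K\<close> of \<open>G\<close> the carrier of
  \<open>RK\<close> is literally a subset of the carrier of \<open>RG\<close>, and restriction of scalars needs no
  notation.\<close>

definition group_ring ::
    "('r, 'u) ring_scheme \<Rightarrow> ('g, 'v) monoid_scheme \<Rightarrow> ('g \<Rightarrow> 'r) ring"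
  where "group_ring R G =
    \<lparr>carrier = {a. (\<forall>g\<in>carrier G. a g \<in> carrier R) \<and> (\<forall>g. g \<notin> carrier G \<longrightarrow> a g = \<zero>\<^bsub>R\<^esub>) \<and>
                   finite {g. a g \<noteq> \<zero>\<^bsub>R\<^esub>}},
     mult = (\<lambda>a b x. if x \<in> carrier G
                     then \<Oplus>\<^bsub>R\<^esub>g\<in>{g \<in> carrier G. a g \<noteq> \<zero>\<^bsub>R\<^esub>}. a g \<otimes>\<^bsub>R\<^esub> b (inv\<^bsub>G\<^esub> g \<otimes>\<^bsub>G\<^esub> x)
                     else \<zero>\<^bsub>R\<^esub>),
     one = (\<lambda>x. if x = \<one>\<^bsub>G\<^esub> then \<one>\<^bsub>R\<^esub> else \<zero>\<^bsub>R\<^esub>),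
     zero = (\<lambda>x. \<zero>\<^bsub>R\<^esub>),
     add = (\<lambda>a b x. a x \<oplus>\<^bsub>R\<^esub> b x)\<rparr>"

definition trivial_module ::
    "('r, 'u) ring_scheme \<Rightarrow> ('g, 'v) monoid_scheme \<Rightarrow> ('g \<Rightarrow> 'r, 'r) module"
  where "trivial_module R G =
    \<lparr>carrier = carrier R, mult = mult R, one = one R, zero = zero R, add = add R,
     smult = (\<lambda>a x. \<Oplus>\<^bsub>R\<^esub>g\<in>{g \<in> carrier G. a g \<noteq> \<zero>\<^bsub>R\<^esub>}. a g \<otimes>\<^bsub>R\<^esub> x)\<rparr>"

definition opposite_ring :: "('r, 'u) ring_scheme \<Rightarrow> ('r, 'u) ring_scheme"
  where "opposite_ring R = R\<lparr>mult := (\<lambda>x y. y \<otimes>\<^bsub>R\<^esub> x)\<rparr>"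

text \<open>The map \<open>\<Sum> r\<^sub>g g \<mapsto> \<Sum> r\<^sub>g g\<^sup>-\<^sup>1\<close>.\<close>

definition group_ring_inversion ::
    "('r, 'u) ring_scheme \<Rightarrow> ('g, 'v) monoid_scheme \<Rightarrow> ('g \<Rightarrow> 'r) \<Rightarrow> 'g \<Rightarrow> 'r"
  where "group_ring_inversion R G a =
    (\<lambda>g. if g \<in> carrier G then a (inv\<^bsub>G\<^esub> g) else \<zero>\<^bsub>R\<^esub>)"


section \<open>Projective resolutions, finiteness properties and cohomology\<close>

definition projective_resolution ::
    "('s, 'u) ring_scheme \<Rightarrow> ('s, 'a, 'v) module_scheme \<Rightarrow>
     (nat \<Rightarrow> ('s, 'p) module) \<Rightarrow> (nat \<Rightarrow> 'p \<Rightarrow> 'p) \<Rightarrow> ('p \<Rightarrow> 'a) \<Rightarrow> bool"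
  where "projective_resolution S M P d \<epsilon> \<longleftrightarrow>
    (\<forall>i. projective_module S (P i)) \<and>
    (\<forall>i. d i \<in> module_hom S (P (Suc i)) (P i)) \<and>
    \<epsilon> \<in> module_hom S (P 0) M \<and>
    \<epsilon> ` carrier (P 0) = carrier M \<and>
    d 0 ` carrier (P (Suc 0)) = {x \<in> carrier (P 0). \<epsilon> x = \<zero>\<^bsub>M\<^esub>} \<and>
    (\<forall>i. d (Suc i) ` carrier (P (Suc (Suc i))) =
         {x \<in> carrier (P (Suc i)). d i x = \<zero>\<^bsub>P i\<^esub>})"

text \<open>The group is of type \<open>FP\<^sub>n(R)\<close>, witnessed by a resolution with modules on the type \<open>'p\<close>.
  A hypothesis of this form with \<open>'p\<close> a type variable not occurring in the conclusion says that
  there is such a resolution on some type.\<close>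

definition type_FP ::
    "'p itself \<Rightarrow> ('r, 'u) ring_scheme \<Rightarrow> ('g, 'v) monoid_scheme \<Rightarrow> nat \<Rightarrow> bool"
  where "type_FP (_ :: 'p itself) R G n \<longleftrightarrow>
    (\<exists>(P :: nat \<Rightarrow> ('g \<Rightarrow> 'r, 'p) module) d \<epsilon>.
      projective_resolution (group_ring R G) (trivial_module R G) P d \<epsilon> \<and>
      (\<forall>i\<le>n. finitely_generated_module (group_ring R G) (P i)))"

text \<open>The abelian group \<open>Hom\<^bsub>RG\<^esub>(P, RG)\<close>, formed with the left module structure of \<open>RG\<close>, so
  that it inherits a right \<open>RG\<close>-module structure. Since \<open>a \<mapsto> group_ring_inversion R G a\<close> is an
  isomorphism from \<open>R\<^sup>o\<^sup>pG\<close> onto the opposite ring of \<open>RG\<close>, letting \<open>a\<close> act as right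
  multiplication by \<open>group_ring_inversion R G a\<close> turns this into a left module over \<open>R\<^sup>o\<^sup>pG\<close>,
  which is \<open>RG\<close> when \<open>R\<close> is commutative. A group element \<open>g\<close> acts as right multiplication by
  \<open>g\<^sup>-\<^sup>1\<close>.\<close>

definition cochains ::
    "('r, 'u) ring_scheme \<Rightarrow> ('g, 'v) monoid_scheme \<Rightarrow> ('g \<Rightarrow> 'r, 'p) module \<Rightarrow>
     ('g \<Rightarrow> 'r, 'p \<Rightarrow> 'g \<Rightarrow> 'r) module"
  where "cochains R G P =
    \<lparr>carrier = module_hom (group_ring R G) P (regular_module (group_ring R G))
                 \<inter> extensional (carrier P),
     mult = undefined, one = undefined,
     zero = (\<lambda>x\<in>carrier P. \<zero>\<^bsub>group_ring R G\<^esub>),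
     add = (\<lambda>f h. \<lambda>x\<in>carrier P. f x \<oplus>\<^bsub>group_ring R G\<^esub> h x),
     smult = (\<lambda>a f. \<lambda>x\<in>carrier P. f x \<otimes>\<^bsub>group_ring R G\<^esub> group_ring_inversion R G a)\<rparr>"

definition cocycles ::
    "('r, 'u) ring_scheme \<Rightarrow> ('g, 'v) monoid_scheme \<Rightarrow>
     (nat \<Rightarrow> ('g \<Rightarrow> 'r, 'p) module) \<Rightarrow> (nat \<Rightarrow> 'p \<Rightarrow> 'p) \<Rightarrow> nat \<Rightarrow> ('p \<Rightarrow> 'g \<Rightarrow> 'r) set"
  where "cocycles R G P d i =
    {f \<in> carrier (cochains R G (P i)). \<forall>x\<in>carrier (P (Suc i)). f (d i x) = \<zero>\<^bsub>group_ring R G\<^esub>}"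

fun coboundaries ::
    "('r, 'u) ring_scheme \<Rightarrow> ('g, 'v) monoid_scheme \<Rightarrow>
     (nat \<Rightarrow> ('g \<Rightarrow> 'r, 'p) module) \<Rightarrow> (nat \<Rightarrow> 'p \<Rightarrow> 'p) \<Rightarrow> nat \<Rightarrow> ('p \<Rightarrow> 'g \<Rightarrow> 'r) set"
  where
    "coboundaries R G P d 0 = {\<zero>\<^bsub>cochains R G (P 0)\<^esub>}"
  | "coboundaries R G P d (Suc i) =
      (\<lambda>f. \<lambda>x\<in>carrier (P (Suc i)). f (d i x)) ` carrier (cochains R G (P i))"

text \<open>\<open>H\<^sup>i(G; RG)\<close>, computed from the projective resolution \<open>(P, d)\<close> of the trivial module.\<close>

definition cohomology ::
    "('r, 'u) ring_scheme \<Rightarrow> ('g, 'v) monoid_scheme \<Rightarrow>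
     (nat \<Rightarrow> ('g \<Rightarrow> 'r, 'p) module) \<Rightarrow> (nat \<Rightarrow> 'p \<Rightarrow> 'p) \<Rightarrow> nat \<Rightarrow>
     ('g \<Rightarrow> 'r, ('p \<Rightarrow> 'g \<Rightarrow> 'r) set) module"
  where "cohomology R G P d i =
    quotient_module ((cochains R G (P i))\<lparr>carrier := cocycles R G P d i\<rparr>)
      (coboundaries R G P d i)"

end

theory Submission
  imports Defs
begin

text \<open>Pick \<open>t\<close> with \<open>\<phi>(t) = 1\<close>. An \<open>RG\<close>-linear map \<open>P\<^sub>i \<rightarrow> RG\<close> is determined by its component in \<open>RK\<close>,
  and the components that occur are the \<open>RK\<close>-linear maps \<open>f: P\<^sub>i \<rightarrow> RK\<close> such that, for every \<open>x\<close>, both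
  \<open>f(t\<^sup>jx)\<close> and \<open>f(t\<^sup>-\<^sup>jx)\<close> vanish for large \<open>j\<close>. Dropping one of the two conditions gives complexes
  \<open>C\<^sub>+\<close> and \<open>C\<^sub>-\<close> inside \<open>C = Hom\<^bsub>RK\<^esub>(P, RK)\<close>, which computes \<open>H\<^sup>*(K; RK)\<close>, while \<open>C\<^sub>+ \<inter> C\<^sub>-\<close> computes
  \<open>H\<^sup>*(G; RG)\<close>. As \<open>P\<close> is projective over \<open>RG\<close>, \<open>C = C\<^sub>+ + C\<^sub>-\<close>, and a Mayer-Vietoris argument reduces the
  theorem to the vanishing of \<open>H\<^sup>i(C\<^sub>+)\<close> and \<open>H\<^sup>i(C\<^sub>-)\<close> for \<open>i \<le> n\<close>. There the finiteness property enters: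
  over \<open>RK\<close>, \<open>P\<close> is homotopy equivalent to a resolution that is finitely generated up to degree \<open>n\<close>,
  and on a finitely generated module the conditions at one end hold uniformly in \<open>x\<close>.\<close>

section \<open>Homomorphisms and linear combinations\<close>

text \<open>The comparison maps and homotopies between \<open>P\<close> and a finitely generated
  resolution are only \<open>RK\<close>-linear. They do not commute with \<open>t\<close>, so
  composing a cochain in \<open>C\<^sub>+\<close> with them may leave \<open>C\<^sub>+\<close>, and
  the homotopy cannot be used as it stands. It is therefore conjugated by powers \<open>t^m\<close>.
  Each conjugate is again a homotopy, but at a point \<open>t^j y\<close> the conjugate with index
  \<open>m\<close> behaves like the one with index \<open>m - j\<close> at \<open>y\<close>, so no
  single conjugate need give a primitive in \<open>C\<^sub>+\<close>: the primitive has to pass from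
  one conjugate to the next as its argument moves along the powers of \<open>t\<close>.

  With \<open>p + q\<close> the identity of \<open>P\<close> realising the decomposition of
  \<open>C\<close>, the connecting map sends a cocycle \<open>c\<close> to the coboundary of its
  half \<open>c \<circ> p\<close>. Injectivity in degree \<open>i\<close> rests on the vanishing of
  the cohomology of both \<open>C\<^sub>+\<close> and \<open>C\<^sub>-\<close> in degree
  \<open>i\<close>, surjectivity on that in degree \<open>i + 1\<close>. Vanishing up to
  \<open>n\<close> thus gives isomorphisms for \<open>i < n\<close> and an embedding for
  \<open>i = n\<close>.\<close>

lemmas (in abelian_group) group_simps =
  minus_eq a_assoc a_comm a_lcomm l_zero r_zero l_neg r_neg r_neg1 r_neg2 minus_add minus_minus
  add.inv_one

text \<open>Rewriting with \<open>group_simps\<close> can leave \<open>x\<close> and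
  \<open>\<ominus> x\<close> several summands apart. These patterns cancel the pair at the distances
  that occur below.\<close>

lemma (in abelian_group) group_cancel:
  assumes "x \<in> carrier G" "y \<in> carrier G"
  shows "x \<oplus> (y \<oplus> \<ominus> x) = y"
    and "z \<in> carrier G \<Longrightarrow> x \<oplus> (y \<oplus> (z \<oplus> \<ominus> x)) = y \<oplus> z"
    and "z \<in> carrier G \<Longrightarrow> x \<oplus> (y \<oplus> (\<ominus> x \<oplus> z)) = y \<oplus> z"
  using assms by (simp_all add: a_lcomm[of x y] a_lcomm[of x z] r_neg r_neg2)

lemma (in abelian_group) diff_eq_zero_iff:
  "x \<in> carrier G \<Longrightarrow> y \<in> carrier G \<Longrightarrow> x \<ominus> y = \<zero> \<longleftrightarrow> x = y"
  by (metis a_minus_def add.inv_solve_right l_zero zero_closed)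

lemma (in abelian_monoid) finsum_Times:
  assumes "finite A" "finite B" "\<And>a b. a \<in> A \<Longrightarrow> b \<in> B \<Longrightarrow> f (a, b) \<in> carrier G"
  shows "(\<Oplus>p\<in>A \<times> B. f p) = (\<Oplus>a\<in>A. \<Oplus>b\<in>B. f (a, b))"
  using assms(1,3)
proof (induct set: finite)
  case empty
  then show ?case by simp
next
  case (insert a A)
  have B: "(\<Oplus>p\<in>Pair a ` B. f p) = (\<Oplus>b\<in>B. f (a, b))"
    using insert.prems by (subst finsum_reindex) (auto simp: inj_on_def)
  have "(\<Oplus>p\<in>insert a A \<times> B. f p) = (\<Oplus>p\<in>Pair a ` B \<union> A \<times> B. f p)"
    by (rule arg_cong2[where f = "finsum G"]) auto
  also have "\<dots> = (\<Oplus>p\<in>Pair a ` B. f p) \<oplus> (\<Oplus>p\<in>A \<times> B. f p)"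
    using insert assms(2) by (intro finsum_Un_disjoint) auto
  also have "(\<Oplus>p\<in>A \<times> B. f p) = (\<Oplus>a\<in>A. \<Oplus>b\<in>B. f (a, b))"
    using insert by blast
  finally show ?case
    using insert B by (simp add: Pi_def)
qed

text \<open>Sums in free modules and group rings run over supports, which change with every
  operation; passing to a common finite superset makes them comparable.\<close>

lemma (in abelian_group) finsum_remove_zeros:
  assumes "finite A" "f \<in> A \<rightarrow> carrier G" "{i \<in> A. f i \<noteq> \<zero>} \<subseteq> B" "B \<subseteq> A"
  shows "finsum G f B = finsum G f A"
  using assms by (intro add.finprod_mono_neutral_cong_left) auto

context left_module
begin

lemma smult_l_null: "x \<in> carrier M \<Longrightarrow> \<zero>\<^bsub>R\<^esub> \<odot>\<^bsub>M\<^esub> x = \<zero>\<^bsub>M\<^esub>"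
  using smult_l_distr[of "\<zero>\<^bsub>R\<^esub>" "\<zero>\<^bsub>R\<^esub>" x] smult_closed[of "\<zero>\<^bsub>R\<^esub>" x]
  by (simp add: M.add.r_cancel_one')

lemma smult_r_null: "a \<in> carrier R \<Longrightarrow> a \<odot>\<^bsub>M\<^esub> \<zero>\<^bsub>M\<^esub> = \<zero>\<^bsub>M\<^esub>"
  using smult_r_distr[of a "\<zero>\<^bsub>M\<^esub>" "\<zero>\<^bsub>M\<^esub>"] smult_closed[of a "\<zero>\<^bsub>M\<^esub>"]
  by (simp add: M.add.r_cancel_one')

lemma smult_r_minus:
  assumes "a \<in> carrier R" "x \<in> carrier M"
  shows "a \<odot>\<^bsub>M\<^esub> (\<ominus>\<^bsub>M\<^esub> x) = \<ominus>\<^bsub>M\<^esub> (a \<odot>\<^bsub>M\<^esub> x)"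
proof -
  have "a \<odot>\<^bsub>M\<^esub> (\<ominus>\<^bsub>M\<^esub> x) \<oplus>\<^bsub>M\<^esub> a \<odot>\<^bsub>M\<^esub> x = \<zero>\<^bsub>M\<^esub>"
    using assms smult_r_distr[of a "\<ominus>\<^bsub>M\<^esub> x" x] by (simp add: M.l_neg smult_r_null)
  then show ?thesis
    using assms by (metis M.minus_equality M.a_inv_closed smult_closed)
qed

lemma smult_r_diff:
  assumes "a \<in> carrier R" "x \<in> carrier M" "y \<in> carrier M"
  shows "a \<odot>\<^bsub>M\<^esub> (x \<ominus>\<^bsub>M\<^esub> y) = a \<odot>\<^bsub>M\<^esub> x \<ominus>\<^bsub>M\<^esub> a \<odot>\<^bsub>M\<^esub> y"
  using assms by (simp add: M.minus_eq smult_r_distr smult_r_minus)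

lemma finsum_smult_rdistr:
  assumes "finite A" "a \<in> carrier R" "f \<in> A \<rightarrow> carrier M"
  shows "a \<odot>\<^bsub>M\<^esub> (\<Oplus>\<^bsub>M\<^esub>i\<in>A. f i) = (\<Oplus>\<^bsub>M\<^esub>i\<in>A. a \<odot>\<^bsub>M\<^esub> f i)"
  using assms by (induct set: finite) (simp_all add: smult_r_null smult_r_distr smult_closed Pi_def)

lemma finsum_smult_ldistr:
  assumes "finite A" "f \<in> A \<rightarrow> carrier R" "x \<in> carrier M"
  shows "(\<Oplus>\<^bsub>R\<^esub>i\<in>A. f i) \<odot>\<^bsub>M\<^esub> x = (\<Oplus>\<^bsub>M\<^esub>i\<in>A. f i \<odot>\<^bsub>M\<^esub> x)"
  using assms by (induct set: finite) (simp_all add: smult_l_null smult_l_distr smult_closed Pi_def)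

end

lemma (in ring) regular_left_module: "left_module R (regular_module R)"
proof -
  have "abelian_group (regular_module R)"
    by (rule abelian_groupI) (auto simp: regular_module_def a_ac intro: add.l_inv_ex)
  then show ?thesis
    by (intro left_module.intro left_module_axioms.intro ring_axioms)
      (auto simp: regular_module_def l_distr r_distr m_assoc)
qed

lemma module_homI:
  assumes "\<And>x. x \<in> carrier M \<Longrightarrow> f x \<in> carrier N"
    and "\<And>x y. \<lbrakk>x \<in> carrier M; y \<in> carrier M\<rbrakk> \<Longrightarrow> f (x \<oplus>\<^bsub>M\<^esub> y) = f x \<oplus>\<^bsub>N\<^esub> f y"
    and "\<And>a x. \<lbrakk>a \<in> carrier S; x \<in> carrier M\<rbrakk> \<Longrightarrow> f (a \<odot>\<^bsub>M\<^esub> x) = a \<odot>\<^bsub>N\<^esub> f x"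
  shows "f \<in> module_hom S M N"
  using assms by (auto simp: module_hom_def)

lemma module_homD:
  assumes "f \<in> module_hom S M N"
  shows "\<And>x. x \<in> carrier M \<Longrightarrow> f x \<in> carrier N"
    and "\<And>x y. \<lbrakk>x \<in> carrier M; y \<in> carrier M\<rbrakk> \<Longrightarrow> f (x \<oplus>\<^bsub>M\<^esub> y) = f x \<oplus>\<^bsub>N\<^esub> f y"
    and "\<And>a x. \<lbrakk>a \<in> carrier S; x \<in> carrier M\<rbrakk> \<Longrightarrow> f (a \<odot>\<^bsub>M\<^esub> x) = a \<odot>\<^bsub>N\<^esub> f x"
  using assms by (auto simp: module_hom_def)

lemma module_hom_compose:
  "f \<in> module_hom S M N \<Longrightarrow> g \<in> module_hom S N L \<Longrightarrow> (\<lambda>x. g (f x)) \<in> module_hom S M L"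
  by (auto simp: module_hom_def Pi_iff)

lemma module_hom_id: "(\<lambda>x. x) \<in> module_hom S M M"
  by (auto simp: module_hom_def)

lemma module_hom_restrict:
  assumes "left_module S M"
  shows "restrict f (carrier M) \<in> module_hom S M N \<longleftrightarrow> f \<in> module_hom S M N"
proof -
  interpret left_module S M by fact
  show ?thesis by (auto simp: module_hom_def smult_closed Pi_iff)
qed

lemma module_hom_zero:
  assumes "left_module S N"
  shows "(\<lambda>x. \<zero>\<^bsub>N\<^esub>) \<in> module_hom S M N"
proof -
  interpret left_module S N by fact
  show ?thesis by (auto simp: module_hom_def smult_r_null)
qed

lemma module_hom_add:
  assumes "left_module S N" "f \<in> module_hom S M N" "g \<in> module_hom S M N"
  shows "(\<lambda>x. f x \<oplus>\<^bsub>N\<^esub> g x) \<in> module_hom S M N"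
proof -
  interpret left_module S N by fact
  show ?thesis using assms(2,3)
    by (intro module_homI) (auto simp: module_homD smult_r_distr M.a_ac)
qed

lemma module_hom_diff:
  assumes "left_module S N" "f \<in> module_hom S M N" "g \<in> module_hom S M N"
  shows "(\<lambda>x. f x \<ominus>\<^bsub>N\<^esub> g x) \<in> module_hom S M N"
proof -
  interpret left_module S N by fact
  show ?thesis using assms(2,3)
    by (intro module_homI) (auto simp: module_homD smult_r_distr smult_r_minus M.minus_eq M.a_ac M.minus_add)
qed

lemma module_hom_abelian_group_hom:
  assumes "f \<in> module_hom S M N" "abelian_group M" "abelian_group N"
  shows "abelian_group_hom M N f"
  using assms(1)
  by (intro abelian_group_homI[OF assms(2,3)] group_hom.intro group_hom_axioms.intro
        abelian_group.a_group assms(2,3)) (auto simp: module_hom_def hom_def)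

lemma (in abelian_group_hom) hom_minus:
  "x \<in> carrier G \<Longrightarrow> y \<in> carrier G \<Longrightarrow> h (x \<ominus>\<^bsub>G\<^esub> y) = h x \<ominus>\<^bsub>H\<^esub> h y"
  by (simp add: G.minus_eq H.minus_eq)

lemma (in abelian_group_hom) hom_finsum:
  assumes "finite A" "f \<in> A \<rightarrow> carrier G"
  shows "h (\<Oplus>\<^bsub>G\<^esub>i\<in>A. f i) = (\<Oplus>\<^bsub>H\<^esub>i\<in>A. h (f i))"
  using assms by (induct set: finite) (simp_all add: Pi_def)

section \<open>Free modules, coordinates and lifting\<close>

definition free_module :: "('s, 'u) ring_scheme \<Rightarrow> 'i set \<Rightarrow> ('s, 'i \<Rightarrow> 's) module"
  where "free_module S I =
    \<lparr>carrier = {c. (\<forall>i\<in>I. c i \<in> carrier S) \<and> (\<forall>i. i \<notin> I \<longrightarrow> c i = \<zero>\<^bsub>S\<^esub>) \<and>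
                   finite {i. c i \<noteq> \<zero>\<^bsub>S\<^esub>}},
     mult = undefined, one = undefined, zero = (\<lambda>i. \<zero>\<^bsub>S\<^esub>),
     add = (\<lambda>c c' i. c i \<oplus>\<^bsub>S\<^esub> c' i), smult = (\<lambda>s c i. s \<otimes>\<^bsub>S\<^esub> c i)\<rparr>"

definition linear_combination ::
    "('s, 'u) ring_scheme \<Rightarrow> ('s, 'a, 'v) module_scheme \<Rightarrow> ('i \<Rightarrow> 'a) \<Rightarrow> ('i \<Rightarrow> 's) \<Rightarrow> 'a"
  where "linear_combination S M b c = (\<Oplus>\<^bsub>M\<^esub>i\<in>{i. c i \<noteq> \<zero>\<^bsub>S\<^esub>}. c i \<odot>\<^bsub>M\<^esub> b i)"

text \<open>The pair of the dual basis lemma: generators together with linear coordinate functions.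
  It exists exactly for projective modules, and unlike the lifting property in
  \<open>projective_module\<close> it mentions no test modules, so lifting against modules of any
  type can be derived from it.\<close>

definition dual_basis ::
    "('s, 'u) ring_scheme \<Rightarrow> ('s, 'a, 'v) module_scheme \<Rightarrow> 'i set \<Rightarrow> ('i \<Rightarrow> 'a) \<Rightarrow> ('a \<Rightarrow> 'i \<Rightarrow> 's) \<Rightarrow> bool"
  where "dual_basis S P I b c \<longleftrightarrow>
    b \<in> I \<rightarrow> carrier P \<and> c \<in> module_hom S P (free_module S I) \<and>
    (\<forall>x\<in>carrier P. linear_combination S P b (c x) = x)"

text \<open>Containment of images replaces surjectivity of \<open>f\<close>, so a map can be lifted
  through a differential without forming its image, or a kernel, as a module. The modules
  \<open>B\<close> and \<open>C\<close> are parameters because a definition cannot range over all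
  types.\<close>

definition lifts ::
    "('s, 'u) ring_scheme \<Rightarrow> ('s, 'a, 'v) module_scheme \<Rightarrow> ('s, 'b, 'w) module_scheme \<Rightarrow>
     ('s, 'c, 'x) module_scheme \<Rightarrow> bool"
  where "lifts S A B C \<longleftrightarrow>
    (\<forall>f\<in>module_hom S B C. \<forall>g\<in>module_hom S A C. g ` carrier A \<subseteq> f ` carrier B \<longrightarrow>
      (\<exists>h\<in>module_hom S A B. \<forall>x\<in>carrier A. f (h x) = g x))"

lemma free_module_carrierD:
  assumes "c \<in> carrier (free_module S I)"
  shows "\<And>i. i \<in> I \<Longrightarrow> c i \<in> carrier S" "\<And>i. i \<notin> I \<Longrightarrow> c i = \<zero>\<^bsub>S\<^esub>" "finite {i. c i \<noteq> \<zero>\<^bsub>S\<^esub>}"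
    "{i. c i \<noteq> \<zero>\<^bsub>S\<^esub>} \<subseteq> I"
  using assms by (auto simp: free_module_def)

lemma (in ring) free_module_carrierD':
  "c \<in> carrier (free_module R I) \<Longrightarrow> c i \<in> carrier R"
  by (cases "i \<in> I") (auto simp: free_module_def)

lemma (in ring) free_left_module: "left_module R (free_module R I)"
proof -
  have fin: "finite {i. c i \<oplus> c' i \<noteq> \<zero>}" if "finite {i. c i \<noteq> \<zero>}" "finite {i. c' i \<noteq> \<zero>}" for c c' :: "'c \<Rightarrow> 'a"
    by (rule finite_subset[OF _ finite_UnI[OF that]]) auto
  have fin': "finite {i. s \<otimes> c i \<noteq> \<zero>}" if "finite {i. c i \<noteq> \<zero>}" "s \<in> carrier R" for c :: "'c \<Rightarrow> 'a" and s
    by (rule finite_subset[OF _ that(1)]) (use that in auto)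
  have "abelian_group (free_module R I)"
  proof (rule abelian_groupI)
    fix x assume x: "x \<in> carrier (free_module R I)"
    have "\<ominus> a \<noteq> \<zero> \<longleftrightarrow> a \<noteq> \<zero>" if "a \<in> carrier R" for a
      using that by (metis minus_minus minus_zero)
    then have "{i. \<ominus> x i \<noteq> \<zero>} = {i. x i \<noteq> \<zero>}"
      using free_module_carrierD'[OF x] by auto
    then show "\<exists>y\<in>carrier (free_module R I). y \<oplus>\<^bsub>free_module R I\<^esub> x = \<zero>\<^bsub>free_module R I\<^esub>"
      using x free_module_carrierD'[OF x]
      by (intro bexI[of _ "\<lambda>i. \<ominus> x i"]) (auto simp: free_module_def l_neg)
  next
    fix x y z assume *: "x \<in> carrier (free_module R I)" "y \<in> carrier (free_module R I)"
      "z \<in> carrier (free_module R I)"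
    show "x \<oplus>\<^bsub>free_module R I\<^esub> y \<oplus>\<^bsub>free_module R I\<^esub> z =
       x \<oplus>\<^bsub>free_module R I\<^esub> (y \<oplus>\<^bsub>free_module R I\<^esub> z)"
      using *[THEN free_module_carrierD'] by (auto simp: free_module_def a_assoc)
  next
    fix x y assume *: "x \<in> carrier (free_module R I)" "y \<in> carrier (free_module R I)"
    show "x \<oplus>\<^bsub>free_module R I\<^esub> y = y \<oplus>\<^bsub>free_module R I\<^esub> x"
      using *[THEN free_module_carrierD'] by (auto simp: free_module_def a_comm)
  next
    fix x assume *: "x \<in> carrier (free_module R I)"
    show "\<zero>\<^bsub>free_module R I\<^esub> \<oplus>\<^bsub>free_module R I\<^esub> x = x"
      using *[THEN free_module_carrierD'] by (auto simp: free_module_def)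
  qed (auto simp: free_module_def fin)
  note ab = this
  show ?thesis
  proof (intro left_module.intro left_module_axioms.intro ring_axioms ab, goal_cases)
    case (1 a x)
    then show ?case by (auto simp: free_module_def fin')
  next
    case (2 a b x)
    then show ?case using free_module_carrierD'[OF 2(3)] by (auto simp: free_module_def l_distr)
  next
    case (3 a x y)
    then show ?case using free_module_carrierD'[OF 3(2)] free_module_carrierD'[OF 3(3)]
      by (auto simp: free_module_def r_distr)
  next
    case (4 a b x)
    then show ?case using free_module_carrierD'[OF 4(3)] by (auto simp: free_module_def m_assoc)
  next
    case (5 x)
    then show ?case using free_module_carrierD'[OF 5(1)] by (auto simp: free_module_def)
  qed
qed

lemma linear_combination_superset:
  assumes "left_module S M" "b \<in> I \<rightarrow> carrier M" "c \<in> carrier (free_module S I)"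
    and "finite A" "A \<subseteq> I" "{i. c i \<noteq> \<zero>\<^bsub>S\<^esub>} \<subseteq> A"
  shows "linear_combination S M b c = (\<Oplus>\<^bsub>M\<^esub>i\<in>A. c i \<odot>\<^bsub>M\<^esub> b i)"
proof -
  interpret left_module S M by fact
  show ?thesis unfolding linear_combination_def
    using assms free_module_carrierD[OF assms(3)]
    by (intro M.finsum_remove_zeros) (auto simp: smult_l_null Pi_iff subset_iff intro!: smult_closed)
qed

lemma linear_combination_hom:
  assumes "left_module S M" and b: "b \<in> I \<rightarrow> carrier M"
  shows "linear_combination S M b \<in> module_hom S (free_module S I) M"
proof -
  interpret left_module S M by fact
  interpret F: left_module S "free_module S I" by (rule R.free_left_module)
  note D = free_module_carrierD
  show ?thesis
  proof (rule module_homI)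
    fix c assume c: "c \<in> carrier (free_module S I)"
    show "linear_combination S M b c \<in> carrier M"
      unfolding linear_combination_def using D[OF c] b
      by (intro M.finsum_closed) (auto simp: Pi_iff subset_iff intro!: smult_closed)
  next
    fix c c' assume c: "c \<in> carrier (free_module S I)" and c': "c' \<in> carrier (free_module S I)"
    let ?A = "{i. c i \<noteq> \<zero>\<^bsub>S\<^esub>} \<union> {i. c' i \<noteq> \<zero>\<^bsub>S\<^esub>}"
    have A: "finite ?A" "?A \<subseteq> I" using D[OF c] D[OF c'] by auto
    have s: "c \<oplus>\<^bsub>free_module S I\<^esub> c' = (\<lambda>i. c i \<oplus>\<^bsub>S\<^esub> c' i)" by (simp add: free_module_def)
    have cc: "c \<oplus>\<^bsub>free_module S I\<^esub> c' \<in> carrier (free_module S I)" using c c' by simp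
    have sub: "{i. (c \<oplus>\<^bsub>free_module S I\<^esub> c') i \<noteq> \<zero>\<^bsub>S\<^esub>} \<subseteq> ?A" unfolding s by auto
    have cl: "i \<in> ?A \<Longrightarrow> b i \<in> carrier M" for i using A(2) b by auto
    have "linear_combination S M b (c \<oplus>\<^bsub>free_module S I\<^esub> c') =
        (\<Oplus>\<^bsub>M\<^esub>i\<in>?A. (c i \<oplus>\<^bsub>S\<^esub> c' i) \<odot>\<^bsub>M\<^esub> b i)"
      using linear_combination_superset[OF assms cc A sub] by (simp add: s)
    also have "\<dots> = (\<Oplus>\<^bsub>M\<^esub>i\<in>?A. c i \<odot>\<^bsub>M\<^esub> b i \<oplus>\<^bsub>M\<^esub> c' i \<odot>\<^bsub>M\<^esub> b i)"
      using R.free_module_carrierD'[OF c] R.free_module_carrierD'[OF c'] cl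
      by (intro M.finsum_cong') (auto simp: smult_l_distr smult_closed)
    also have "\<dots> = (\<Oplus>\<^bsub>M\<^esub>i\<in>?A. c i \<odot>\<^bsub>M\<^esub> b i) \<oplus>\<^bsub>M\<^esub> (\<Oplus>\<^bsub>M\<^esub>i\<in>?A. c' i \<odot>\<^bsub>M\<^esub> b i)"
      using R.free_module_carrierD'[OF c] R.free_module_carrierD'[OF c'] cl
      by (intro M.finsum_addf) (auto simp: smult_closed)
    also have "\<dots> = linear_combination S M b c \<oplus>\<^bsub>M\<^esub> linear_combination S M b c'"
      using linear_combination_superset[OF assms c A] linear_combination_superset[OF assms c' A]
      by auto
    finally show "linear_combination S M b (c \<oplus>\<^bsub>free_module S I\<^esub> c') =
        linear_combination S M b c \<oplus>\<^bsub>M\<^esub> linear_combination S M b c'" .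
  next
    fix s c assume s: "s \<in> carrier S" and c: "c \<in> carrier (free_module S I)"
    let ?A = "{i. c i \<noteq> \<zero>\<^bsub>S\<^esub>}"
    have cl: "i \<in> ?A \<Longrightarrow> b i \<in> carrier M" for i using D(4)[OF c] b by auto
    have sub: "{i. (s \<odot>\<^bsub>free_module S I\<^esub> c) i \<noteq> \<zero>\<^bsub>S\<^esub>} \<subseteq> ?A"
      using s by (auto simp: free_module_def)
    have "linear_combination S M b (s \<odot>\<^bsub>free_module S I\<^esub> c) =
        (\<Oplus>\<^bsub>M\<^esub>i\<in>?A. (s \<otimes>\<^bsub>S\<^esub> c i) \<odot>\<^bsub>M\<^esub> b i)"
      using linear_combination_superset[OF assms F.smult_closed[OF s c] D(3)[OF c] D(4)[OF c] sub]
      by (simp add: free_module_def)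
    also have "\<dots> = (\<Oplus>\<^bsub>M\<^esub>i\<in>?A. s \<odot>\<^bsub>M\<^esub> (c i \<odot>\<^bsub>M\<^esub> b i))"
      using R.free_module_carrierD'[OF c] cl s
      by (intro M.finsum_cong') (auto simp: smult_assoc1 smult_closed)
    also have "\<dots> = s \<odot>\<^bsub>M\<^esub> linear_combination S M b c"
      unfolding linear_combination_def
      using R.free_module_carrierD'[OF c] cl s D[OF c]
      by (intro finsum_smult_rdistr[symmetric]) (auto intro!: smult_closed)
    finally show "linear_combination S M b (s \<odot>\<^bsub>free_module S I\<^esub> c) =
        s \<odot>\<^bsub>M\<^esub> linear_combination S M b c" .
  qed
qed

lemma module_hom_linear_combination:
  assumes "left_module S M" "abelian_group N" "f \<in> module_hom S M N"
    and "b \<in> I \<rightarrow> carrier M" "c \<in> carrier (free_module S I)"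
  shows "f (linear_combination S M b c) = linear_combination S N (\<lambda>i. f (b i)) c"
proof -
  interpret left_module S M by fact
  interpret N: abelian_group N by fact
  interpret abelian_group_hom M N f
    by (rule module_hom_abelian_group_hom[OF assms(3)]) unfold_locales
  have cl: "b i \<in> carrier M" "c i \<in> carrier S" if "c i \<noteq> \<zero>\<^bsub>S\<^esub>" for i
    using that free_module_carrierD[OF assms(5)] assms(4) by auto
  have "f (linear_combination S M b c) = (\<Oplus>\<^bsub>N\<^esub>i\<in>{i. c i \<noteq> \<zero>\<^bsub>S\<^esub>}. f (c i \<odot>\<^bsub>M\<^esub> b i))"
    unfolding linear_combination_def
    using cl free_module_carrierD[OF assms(5)] by (intro hom_finsum) (auto intro!: smult_closed)
  also have "\<dots> = linear_combination S N (\<lambda>i. f (b i)) c"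
    unfolding linear_combination_def
    using cl module_homD(1)[OF assms(3)]
    by (intro N.finsum_cong') (auto simp: smult_closed simp flip: module_homD(3)[OF assms(3)])
  finally show ?thesis .
qed

lemma linear_combination_cong:
  assumes "abelian_group M" "\<And>i. c i \<noteq> \<zero>\<^bsub>S\<^esub> \<Longrightarrow> b i = b' i \<and> c i \<odot>\<^bsub>M\<^esub> b' i \<in> carrier M"
  shows "linear_combination S M b c = linear_combination S M b' c"
proof -
  interpret abelian_group M by fact
  show ?thesis unfolding linear_combination_def
    using assms(2) by (intro finsum_cong') auto
qed

text \<open>Choose a preimage \<open>m i\<close> of each \<open>g (b i)\<close> and send
  \<open>x\<close> to the combination of the \<open>m i\<close> with coefficients
  \<open>c x\<close>. Relations among the generators \<open>b i\<close> cause no trouble, because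
  the coordinates are themselves linear in \<open>x\<close>.\<close>

lemma lifts_dual_basis:
  assumes "left_module S A" "left_module S B" "abelian_group C" and d: "dual_basis S A I b c"
  shows "lifts S A B C"
  unfolding lifts_def
proof (intro ballI impI)
  fix f g assume f: "f \<in> module_hom S B C" and g: "g \<in> module_hom S A C"
    and im: "g ` carrier A \<subseteq> f ` carrier B"
  interpret A: left_module S A by fact
  interpret B: left_module S B by fact
  from d have b: "b \<in> I \<rightarrow> carrier A" and c: "c \<in> module_hom S A (free_module S I)"
    and eq: "\<And>x. x \<in> carrier A \<Longrightarrow> linear_combination S A b (c x) = x"
    by (auto simp: dual_basis_def)
  define m where "m i = (SOME y. y \<in> carrier B \<and> f y = g (b i))" for i
  have m: "m i \<in> carrier B" "f (m i) = g (b i)" if "i \<in> I" for i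
  proof -
    have "b i \<in> carrier A" using b that by auto
    then have "g (b i) \<in> f ` carrier B" using im by blast
    then have "\<exists>y. y \<in> carrier B \<and> f y = g (b i)" by (metis imageE)
    then have "m i \<in> carrier B \<and> f (m i) = g (b i)" unfolding m_def by (rule someI_ex)
    then show "m i \<in> carrier B" "f (m i) = g (b i)" by auto
  qed
  have m': "m \<in> I \<rightarrow> carrier B" using m by auto
  show "\<exists>h\<in>module_hom S A B. \<forall>x\<in>carrier A. f (h x) = g x"
  proof (intro bexI ballI)
    show "(\<lambda>x. linear_combination S B m (c x)) \<in> module_hom S A B"
      by (rule module_hom_compose[OF c linear_combination_hom[OF assms(2) m']])
    fix x assume x: "x \<in> carrier A"
    have cx: "c x \<in> carrier (free_module S I)" using c x by (rule module_homD)
    have "f (linear_combination S B m (c x)) = linear_combination S C (\<lambda>i. f (m i)) (c x)"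
      by (rule module_hom_linear_combination[OF assms(2,3) f m' cx])
    also have "\<dots> = linear_combination S C (\<lambda>i. g (b i)) (c x)"
    proof (rule linear_combination_cong[OF assms(3)])
      fix i assume "c x i \<noteq> \<zero>\<^bsub>S\<^esub>"
      then have i: "i \<in> I" and ci: "c x i \<in> carrier S" using free_module_carrierD[OF cx] by auto
      have bi: "b i \<in> carrier A" using b i by auto
      have "c x i \<odot>\<^bsub>C\<^esub> g (b i) = g (c x i \<odot>\<^bsub>A\<^esub> b i)"
        using module_homD(3)[OF g ci bi] by simp
      moreover have "g (c x i \<odot>\<^bsub>A\<^esub> b i) \<in> carrier C"
        using module_homD(1)[OF g] A.smult_closed[OF ci bi] by auto
      ultimately show "f (m i) = g (b i) \<and> c x i \<odot>\<^bsub>C\<^esub> g (b i) \<in> carrier C"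
        using m[OF i] by simp
    qed
    also have "\<dots> = g (linear_combination S A b (c x))"
      by (rule module_hom_linear_combination[OF assms(1,3) g b cx, symmetric])
    also have "\<dots> = g x" using eq[OF x] by simp
    finally show "f (linear_combination S B m (c x)) = g x" .
  qed
qed

lemma projective_dual_basis:
  assumes "projective_module S P"
  obtains c where "dual_basis S P (carrier P) (\<lambda>x. x) c"
proof -
  have P: "left_module S P" using assms by (simp add: projective_module_def)
  interpret left_module S P by (rule P)
  let ?F = "free_module S (carrier P)"
  have F: "left_module S ?F" by (rule R.free_left_module)
  interpret F: left_module S ?F by (rule F)
  let ?l = "linear_combination S P (\<lambda>x. x)"
  have l: "?l \<in> module_hom S ?F P" by (rule linear_combination_hom[OF P]) auto
  have surj: "?l ` carrier ?F = carrier P"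
  proof (intro equalityI subsetI)
    fix x assume "x \<in> ?l ` carrier ?F"
    then show "x \<in> carrier P" using module_homD(1)[OF l] by auto
  next
    fix x assume x: "x \<in> carrier P"
    let ?c = "\<lambda>y. if y = x then \<one>\<^bsub>S\<^esub> else \<zero>\<^bsub>S\<^esub>"
    have c: "?c \<in> carrier ?F" using x by (auto simp: free_module_def)
    have "?l ?c = (\<Oplus>\<^bsub>P\<^esub>i\<in>{x}. ?c i \<odot>\<^bsub>P\<^esub> i)"
      by (rule linear_combination_superset[OF P _ c]) (use x in auto)
    also have "\<dots> = x" using x by (simp add: smult_one)
    finally show "x \<in> ?l ` carrier ?F" using c by (metis image_eqI)
  qed
  have "\<exists>h\<in>module_hom S P ?F. \<forall>x\<in>carrier P. ?l (h x) = x"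
    using assms[unfolded projective_module_def, THEN conjunct2, rule_format, OF conjI[OF F P] l surj
      module_hom_id] .
  then obtain h where "h \<in> module_hom S P ?F" "\<forall>x\<in>carrier P. ?l (h x) = x" by blast
  then show thesis by (intro that[of h]) (auto simp: dual_basis_def)
qed

lemma projective_lifts:
  assumes "projective_module S A" "left_module S B" "abelian_group C"
  shows "lifts S A B C"
proof -
  have A: "left_module S A" using assms(1) unfolding projective_module_def by (rule conjunct1)
  obtain c where "dual_basis S A (carrier A) (\<lambda>x. x) c" using assms(1) by (rule projective_dual_basis)
  then show ?thesis by (rule lifts_dual_basis[OF A assms(2,3)])
qed

lemma module_hom_apply_zero:
  assumes "f \<in> module_hom S M N" "abelian_group M" "abelian_group N"
  shows "f \<zero>\<^bsub>M\<^esub> = \<zero>\<^bsub>N\<^esub>"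
proof -
  interpret abelian_group_hom M N f by (rule module_hom_abelian_group_hom[OF assms])
  show ?thesis by (rule hom_zero)
qed

lemma module_hom_apply_diff:
  assumes "f \<in> module_hom S M N" "abelian_group M" "abelian_group N" "x \<in> carrier M" "y \<in> carrier M"
  shows "f (x \<ominus>\<^bsub>M\<^esub> y) = f x \<ominus>\<^bsub>N\<^esub> f y"
proof -
  interpret abelian_group_hom M N f by (rule module_hom_abelian_group_hom[OF assms(1-3)])
  show ?thesis by (rule hom_minus[OF assms(4,5)])
qed

section \<open>Comparison of resolutions\<close>

lemma projective_resolutionD:
  assumes "projective_resolution S M P d \<epsilon>"
  shows "\<And>i. left_module S (P i)" "\<And>i. d i \<in> module_hom S (P (Suc i)) (P i)"
    "\<epsilon> \<in> module_hom S (P 0) M"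
    "\<epsilon> ` carrier (P 0) = carrier M"
    "\<And>x. x \<in> carrier (P (Suc 0)) \<Longrightarrow> \<epsilon> (d 0 x) = \<zero>\<^bsub>M\<^esub>"
    "\<And>i x. x \<in> carrier (P (Suc (Suc i))) \<Longrightarrow> d i (d (Suc i) x) = \<zero>\<^bsub>P i\<^esub>"
    "\<And>x. x \<in> carrier (P 0) \<Longrightarrow> \<epsilon> x = \<zero>\<^bsub>M\<^esub> \<Longrightarrow> x \<in> d 0 ` carrier (P (Suc 0))"
    "\<And>i x. x \<in> carrier (P (Suc i)) \<Longrightarrow> d i x = \<zero>\<^bsub>P i\<^esub> \<Longrightarrow> x \<in> d (Suc i) ` carrier (P (Suc (Suc i)))"
proof -
  note D = assms[unfolded projective_resolution_def]
  have p: "projective_module S (P i)" for i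
    by (rule D[THEN conjunct1, THEN spec])
  show "left_module S (P i)" for i using p[of i] unfolding projective_module_def by (rule conjunct1)
  note D = D[THEN conjunct2]
  show "d i \<in> module_hom S (P (Suc i)) (P i)" for i by (rule D[THEN conjunct1, THEN spec])
  note D = D[THEN conjunct2]
  show "\<epsilon> \<in> module_hom S (P 0) M" by (rule D[THEN conjunct1])
  note D = D[THEN conjunct2]
  show "\<epsilon> ` carrier (P 0) = carrier M" by (rule D[THEN conjunct1])
  note D = D[THEN conjunct2]
  note D0 = D[THEN conjunct1] and Ds = D[THEN conjunct2, rule_format]
  show "\<epsilon> (d 0 x) = \<zero>\<^bsub>M\<^esub>" if "x \<in> carrier (P (Suc 0))" for x
    using imageI[OF that, of "d 0"] unfolding D0 by simp
  show "d i (d (Suc i) x) = \<zero>\<^bsub>P i\<^esub>" if "x \<in> carrier (P (Suc (Suc i)))" for i x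
    using imageI[OF that, of "d (Suc i)"] unfolding Ds by simp
  show "x \<in> d 0 ` carrier (P (Suc 0))" if "x \<in> carrier (P 0)" "\<epsilon> x = \<zero>\<^bsub>M\<^esub>" for x
    unfolding D0 using that by simp
  show "x \<in> d (Suc i) ` carrier (P (Suc (Suc i)))" if "x \<in> carrier (P (Suc i))" "d i x = \<zero>\<^bsub>P i\<^esub>" for i x
    unfolding Ds using that by simp
qed

text \<open>A resolution whose modules need not be projective: it is used for the restriction of a
  projective \<open>RG\<close>-resolution to \<open>RK\<close>, where projectivity only enters through \<^const>\<open>lifts\<close>.\<close>

locale resolution =
  fixes S :: "('s, 'u) ring_scheme" and M :: "('s, 'a, 'v) module_scheme"
    and P :: "nat \<Rightarrow> ('s, 'p) module" and d :: "nat \<Rightarrow> 'p \<Rightarrow> 'p" and \<epsilon> :: "'p \<Rightarrow> 'a"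
  assumes P: "\<And>i. left_module S (P i)"
    and d: "\<And>i. d i \<in> module_hom S (P (Suc i)) (P i)"
    and eps: "\<epsilon> \<in> module_hom S (P 0) M"
    and eps_onto: "\<epsilon> ` carrier (P 0) = carrier M"
    and eps_d: "\<And>x. x \<in> carrier (P (Suc 0)) \<Longrightarrow> \<epsilon> (d 0 x) = \<zero>\<^bsub>M\<^esub>"
    and d_d: "\<And>i x. x \<in> carrier (P (Suc (Suc i))) \<Longrightarrow> d i (d (Suc i) x) = \<zero>\<^bsub>P i\<^esub>"
    and eps_exact: "\<And>x. x \<in> carrier (P 0) \<Longrightarrow> \<epsilon> x = \<zero>\<^bsub>M\<^esub> \<Longrightarrow> x \<in> d 0 ` carrier (P (Suc 0))"
    and d_exact: "\<And>i x. x \<in> carrier (P (Suc i)) \<Longrightarrow> d i x = \<zero>\<^bsub>P i\<^esub> \<Longrightarrow>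
      x \<in> d (Suc i) ` carrier (P (Suc (Suc i)))"
begin

lemma d_closed: "x \<in> carrier (P (Suc i)) \<Longrightarrow> d i x \<in> carrier (P i)"
  by (rule module_homD(1)[OF d])

lemma P_group: "abelian_group (P i)"
  by (rule left_module.axioms(2)[OF P])

end

lemma projective_resolution_resolution:
  assumes "projective_resolution S M P d \<epsilon>"
  shows "resolution S M P d \<epsilon>"
  by (rule resolution.intro) (fact projective_resolutionD[OF assms])+

definition chain_map ::
    "('s, 'u) ring_scheme \<Rightarrow> (nat \<Rightarrow> ('s, 'p) module) \<Rightarrow> (nat \<Rightarrow> 'p \<Rightarrow> 'p) \<Rightarrow> ('p \<Rightarrow> 'a) \<Rightarrow>
     (nat \<Rightarrow> ('s, 'q) module) \<Rightarrow> (nat \<Rightarrow> 'q \<Rightarrow> 'q) \<Rightarrow> ('q \<Rightarrow> 'a) \<Rightarrow> (nat \<Rightarrow> 'p \<Rightarrow> 'q) \<Rightarrow> bool"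
  where "chain_map S P d \<epsilon> Q e \<eta> u \<longleftrightarrow>
    (\<forall>i. u i \<in> module_hom S (P i) (Q i)) \<and>
    (\<forall>x\<in>carrier (P 0). \<eta> (u 0 x) = \<epsilon> x) \<and>
    (\<forall>i. \<forall>x\<in>carrier (P (Suc i)). e i (u (Suc i) x) = u i (d i x))"

text \<open>A homotopy between \<open>w\<close> and the identity, solved for \<open>x\<close> so
  that it serves as an expansion of elements. Degree zero stands apart because no module precedes
  \<open>P 0\<close>.\<close>

definition homotopy_to_id ::
    "('s, 'u) ring_scheme \<Rightarrow> (nat \<Rightarrow> ('s, 'p) module) \<Rightarrow> (nat \<Rightarrow> 'p \<Rightarrow> 'p) \<Rightarrow>
     (nat \<Rightarrow> 'p \<Rightarrow> 'p) \<Rightarrow> (nat \<Rightarrow> 'p \<Rightarrow> 'p) \<Rightarrow> bool"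
  where "homotopy_to_id S P d w h \<longleftrightarrow>
    (\<forall>i. h i \<in> module_hom S (P i) (P (Suc i))) \<and>
    (\<forall>x\<in>carrier (P 0). x = w 0 x \<oplus>\<^bsub>P 0\<^esub> d 0 (h 0 x)) \<and>
    (\<forall>i. \<forall>x\<in>carrier (P (Suc i)).
       x = w (Suc i) x \<oplus>\<^bsub>P (Suc i)\<^esub> d (Suc i) (h (Suc i) x) \<oplus>\<^bsub>P (Suc i)\<^esub> h i (d i x))"

lemma chain_map_compose:
  assumes "chain_map S P d \<epsilon> Q e \<eta> u" "chain_map S Q e \<eta> L l \<theta> v"
  shows "chain_map S P d \<epsilon> L l \<theta> (\<lambda>i x. v i (u i x))"
  unfolding chain_map_def
proof (intro conjI allI ballI)
  note u = assms(1)[unfolded chain_map_def] and v = assms(2)[unfolded chain_map_def]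
  have uc: "u i x \<in> carrier (Q i)" if "x \<in> carrier (P i)" for i x
    by (rule module_homD(1)[OF u[THEN conjunct1, THEN spec] that])
  show "(\<lambda>x. v i (u i x)) \<in> module_hom S (P i) (L i)" for i
    by (rule module_hom_compose[OF u[THEN conjunct1, THEN spec] v[THEN conjunct1, THEN spec]])
  show "\<theta> (v 0 (u 0 x)) = \<epsilon> x" if "x \<in> carrier (P 0)" for x
    using u v uc[OF that] that by simp
  show "l i (v (Suc i) (u (Suc i) x)) = v i (u i (d i x))" if "x \<in> carrier (P (Suc i))" for i x
    using u v uc[OF that] that by simp
qed

text \<open>The comparison theorem. It is a dependent choice, since the lift in each degree depends
  on the one before; projectivity of \<open>P\<close> is present through the lifting
  assumptions.\<close>

lemma chain_map_exists:
  assumes "resolution S M P d \<epsilon>" "resolution S M Q e \<eta>"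
    and lift0: "lifts S (P 0) (Q 0) M"
    and lift: "\<And>i. lifts S (P (Suc i)) (Q (Suc i)) (Q i)"
    and M: "abelian_group M"
  obtains u where "chain_map S P d \<epsilon> Q e \<eta> u"
proof -
  interpret P: resolution S M P d \<epsilon> by fact
  interpret Q: resolution S M Q e \<eta> by fact
  \<comment> \<open>The second conjunct is what the next lift needs: \<open>u \<circ> d i\<close>
    has to land in the image of \<open>e i\<close>.\<close>
  let ?ok = "\<lambda>i u. u \<in> module_hom S (P i) (Q i) \<and>
    (\<forall>x\<in>carrier (P (Suc i)). u (d i x) \<in> e i ` carrier (Q (Suc i)))"
  have "\<exists>u0\<in>module_hom S (P 0) (Q 0). \<forall>x\<in>carrier (P 0). \<eta> (u0 x) = \<epsilon> x"
    using lift0[unfolded lifts_def, THEN bspec, OF Q.eps, THEN bspec, OF P.eps] P.eps_onto Q.eps_onto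
    by simp
  then obtain u0 where u0: "u0 \<in> module_hom S (P 0) (Q 0)" "\<And>x. x \<in> carrier (P 0) \<Longrightarrow> \<eta> (u0 x) = \<epsilon> x"
    by auto
  have ok0: "?ok 0 u0"
    using u0(2) P.d_closed P.eps_d Q.eps_exact module_homD(1)[OF u0(1)] by (simp add: u0(1))
  have step: "\<exists>u'. ?ok (Suc i) u' \<and> (\<forall>x\<in>carrier (P (Suc i)). e i (u' x) = u (d i x))"
    if u: "?ok i u" for i u
  proof -
    have 1: "(\<lambda>x. u (d i x)) \<in> module_hom S (P (Suc i)) (Q i)"
      by (rule module_hom_compose[OF P.d conjunct1[OF u]])
    have 2: "(\<lambda>x. u (d i x)) ` carrier (P (Suc i)) \<subseteq> e i ` carrier (Q (Suc i))"
      using conjunct2[OF u] by auto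
    obtain u' where u': "u' \<in> module_hom S (P (Suc i)) (Q (Suc i))"
      "\<And>x. x \<in> carrier (P (Suc i)) \<Longrightarrow> e i (u' x) = u (d i x)"
      using lift[of i, unfolded lifts_def, THEN bspec, OF Q.d, THEN bspec, OF 1, rule_format, OF 2]
      by auto
    have "u' (d (Suc i) x) \<in> e (Suc i) ` carrier (Q (Suc (Suc i)))" if x: "x \<in> carrier (P (Suc (Suc i)))" for x
    proof (rule Q.d_exact)
      show "u' (d (Suc i) x) \<in> carrier (Q (Suc i))" using module_homD(1)[OF u'(1)] P.d_closed[OF x] .
      show "e i (u' (d (Suc i) x)) = \<zero>\<^bsub>Q i\<^esub>"
        using u'(2)[OF P.d_closed[OF x]] P.d_d[OF x]
          module_hom_apply_zero[OF conjunct1[OF u] P.P_group Q.P_group] by simp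
    qed
    then show ?thesis using u' by (intro exI[of _ u']) auto
  qed
  \<comment> \<open>The clause for \<open>i = 0\<close> pins the start of the sequence to
    \<open>u0\<close>, the one member that has to respect the augmentations.\<close>
  have "\<exists>u. \<forall>i. (?ok i (u i) \<and> (i = 0 \<longrightarrow> u i = u0)) \<and>
      (\<forall>x\<in>carrier (P (Suc i)). e i (u (Suc i) x) = u i (d i x))"
  proof (rule dependent_nat_choice)
    show "\<exists>u. ?ok 0 u \<and> (0 = (0::nat) \<longrightarrow> u = u0)" using ok0 by blast
    show "\<exists>u'. (?ok (Suc i) u' \<and> (Suc i = 0 \<longrightarrow> u' = u0)) \<and>
        (\<forall>x\<in>carrier (P (Suc i)). e i (u' x) = u (d i x))" if "?ok i u \<and> (i = 0 \<longrightarrow> u = u0)" for i u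
      using step[OF conjunct1[OF that]] by blast
  qed
  then obtain u where u: "\<And>i. u i \<in> module_hom S (P i) (Q i)"
    "\<And>i x. x \<in> carrier (P (Suc i)) \<Longrightarrow> e i (u (Suc i) x) = u i (d i x)" and uu: "u 0 = u0"
    by metis
  then have "chain_map S P d \<epsilon> Q e \<eta> u"
    unfolding chain_map_def using u0(2) by (auto simp: uu)
  then show thesis by (rule that)
qed

text \<open>Both \<open>w\<close> and the identity lie over the identity of \<open>M\<close>, so
  \<open>x - w x\<close> is a boundary in degree zero. In higher degrees
  \<open>x - w x - h (d x)\<close> is a cycle, hence can be lifted through the next
  differential.\<close>

lemma homotopy_exists:
  assumes "resolution S M P d \<epsilon>" and w: "chain_map S P d \<epsilon> P d \<epsilon> w"
    and lift: "\<And>i. lifts S (P i) (P (Suc i)) (P i)"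
    and M: "abelian_group M"
  obtains h where "homotopy_to_id S P d w h"
proof -
  interpret P: resolution S M P d \<epsilon> by fact
  have wh: "w i \<in> module_hom S (P i) (P i)" for i using w by (simp add: chain_map_def)
  have w0: "\<epsilon> (w 0 x) = \<epsilon> x" if "x \<in> carrier (P 0)" for x using w that by (simp add: chain_map_def)
  have wd: "d i (w (Suc i) x) = w i (d i x)" if "x \<in> carrier (P (Suc i))" for i x
    using w that by (simp add: chain_map_def)
  note wc = module_homD(1)[OF wh]
  \<comment> \<open>The equation on boundaries is handed on from one step to the next: with it,
    \<open>d i\<close> maps \<open>x - w x - h (d i x)\<close> to zero.\<close>
  let ?ok = "\<lambda>i h. h \<in> module_hom S (P i) (P (Suc i)) \<and>
    (\<forall>x\<in>carrier (P (Suc i)). d i (h (d i x)) = d i x \<ominus>\<^bsub>P i\<^esub> w i (d i x))"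
  have "\<exists>h\<in>module_hom S (P 0) (P (Suc 0)). \<forall>x\<in>carrier (P 0). d 0 (h x) = x \<ominus>\<^bsub>P 0\<^esub> w 0 x"
  proof -
    have 1: "(\<lambda>x. x \<ominus>\<^bsub>P 0\<^esub> w 0 x) \<in> module_hom S (P 0) (P 0)"
      by (rule module_hom_diff[OF P.P module_hom_id wh])
    have 2: "(\<lambda>x. x \<ominus>\<^bsub>P 0\<^esub> w 0 x) ` carrier (P 0) \<subseteq> d 0 ` carrier (P (Suc 0))"
    proof (clarify)
      fix x assume x: "x \<in> carrier (P 0)"
      interpret A: abelian_group "P 0" by (rule P.P_group)
      interpret M: abelian_group M by (rule M)
      show "x \<ominus>\<^bsub>P 0\<^esub> w 0 x \<in> d 0 ` carrier (P (Suc 0))"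
        using x wc[of x 0] w0[OF x] module_homD(1)[OF P.eps x]
        by (intro P.eps_exact) (auto simp: module_hom_apply_diff[OF P.eps P.P_group M] M.diff_eq_zero_iff)
    qed
    show ?thesis
      by (rule lift[of 0, unfolded lifts_def, THEN bspec, OF P.d, THEN bspec, OF 1, rule_format, OF 2])
  qed
  then obtain h0 where h0: "h0 \<in> module_hom S (P 0) (P (Suc 0))"
    "\<And>x. x \<in> carrier (P 0) \<Longrightarrow> d 0 (h0 x) = x \<ominus>\<^bsub>P 0\<^esub> w 0 x" by auto
  have ok0: "?ok 0 h0" using h0 P.d_closed by simp
  let ?r = "\<lambda>i h x. x \<ominus>\<^bsub>P (Suc i)\<^esub> w (Suc i) x \<ominus>\<^bsub>P (Suc i)\<^esub> h (d i x)"
  have step: "\<exists>h'. ?ok (Suc i) h' \<and> (\<forall>x\<in>carrier (P (Suc i)). d (Suc i) (h' x) = ?r i h x)"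
    if h: "?ok i h" for i h
  proof -
    interpret A: abelian_group "P (Suc i)" by (rule P.P_group)
    interpret B: abelian_group "P i" by (rule P.P_group)
    have hc: "x \<in> carrier (P i) \<Longrightarrow> h x \<in> carrier (P (Suc i))" for x
      by (rule module_homD(1)[OF conjunct1[OF h]])
    have 1: "?r i h \<in> module_hom S (P (Suc i)) (P (Suc i))"
      by (intro module_hom_diff[OF P.P] module_hom_id wh module_hom_compose[OF P.d conjunct1[OF h]])
    have 2: "?r i h ` carrier (P (Suc i)) \<subseteq> d (Suc i) ` carrier (P (Suc (Suc i)))"
    proof (clarify)
      fix x assume x: "x \<in> carrier (P (Suc i))"
      have dx: "d i x \<in> carrier (P i)" by (rule P.d_closed[OF x])
      have "d i (?r i h x) = (d i x \<ominus>\<^bsub>P i\<^esub> w i (d i x)) \<ominus>\<^bsub>P i\<^esub> (d i x \<ominus>\<^bsub>P i\<^esub> w i (d i x))"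
        using x h by (simp add: module_hom_apply_diff[OF P.d P.P_group P.P_group] wc hc dx wd)
      also have "\<dots> = \<zero>\<^bsub>P i\<^esub>"
        using dx wc by (simp add: B.diff_eq_zero_iff)
      finally show "?r i h x \<in> d (Suc i) ` carrier (P (Suc (Suc i)))"
        using x dx hc wc by (intro P.d_exact) auto
    qed
    obtain h' where h': "h' \<in> module_hom S (P (Suc i)) (P (Suc (Suc i)))"
      "\<And>x. x \<in> carrier (P (Suc i)) \<Longrightarrow> d (Suc i) (h' x) = ?r i h x"
      using lift[of "Suc i", unfolded lifts_def, THEN bspec, OF P.d, THEN bspec, OF 1, rule_format, OF 2]
      by auto
    have "d (Suc i) (h' (d (Suc i) x)) = d (Suc i) x \<ominus>\<^bsub>P (Suc i)\<^esub> w (Suc i) (d (Suc i) x)"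
      if x: "x \<in> carrier (P (Suc (Suc i)))" for x
      using h'(2)[OF P.d_closed[OF x]] P.d_d[OF x] P.d_closed[OF x] wc
        module_hom_apply_zero[OF conjunct1[OF h] P.P_group P.P_group]
      by (simp add: A.group_simps)
    then show ?thesis using h' by (intro exI[of _ h']) auto
  qed
  have "\<exists>h. \<forall>i. (?ok i (h i) \<and> (i = 0 \<longrightarrow> h i = h0)) \<and>
      (\<forall>x\<in>carrier (P (Suc i)). d (Suc i) (h (Suc i) x) = ?r i (h i) x)"
  proof (rule dependent_nat_choice)
    show "\<exists>h. ?ok 0 h \<and> (0 = (0::nat) \<longrightarrow> h = h0)" using ok0 by blast
    show "\<exists>h'. (?ok (Suc i) h' \<and> (Suc i = 0 \<longrightarrow> h' = h0)) \<and>
        (\<forall>x\<in>carrier (P (Suc i)). d (Suc i) (h' x) = ?r i h x)" if "?ok i h \<and> (i = 0 \<longrightarrow> h = h0)" for i h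
      using step[OF conjunct1[OF that]] by blast
  qed
  then obtain h where h: "\<And>i. h i \<in> module_hom S (P i) (P (Suc i))"
    "\<And>i x. x \<in> carrier (P (Suc i)) \<Longrightarrow> d (Suc i) (h (Suc i) x) = ?r i (h i) x" and hh: "h 0 = h0"
    by metis
  have hc: "h i x \<in> carrier (P (Suc i))" if "x \<in> carrier (P i)" for x i
    by (rule module_homD(1)[OF h(1) that])
  have "homotopy_to_id S P d w h"
    unfolding homotopy_to_id_def
  proof (intro conjI allI ballI)
    show "h i \<in> module_hom S (P i) (P (Suc i))" for i by (rule h(1))
    interpret B: abelian_group "P 0" by (rule P.P_group)
    show "x = w 0 x \<oplus>\<^bsub>P 0\<^esub> d 0 (h 0 x)" if x: "x \<in> carrier (P 0)" for x
      using h0(2)[OF x] x wc[OF x] by (simp add: hh B.group_simps)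
    fix i x assume x: "x \<in> carrier (P (Suc i))"
    interpret A: abelian_group "P (Suc i)" by (rule P.P_group)
    show "x = w (Suc i) x \<oplus>\<^bsub>P (Suc i)\<^esub> d (Suc i) (h (Suc i) x) \<oplus>\<^bsub>P (Suc i)\<^esub> h i (d i x)"
      using h(2)[OF x] x wc[OF x] hc[OF P.d_closed[OF x]] by (simp add: A.group_simps)
  qed
  then show thesis by (rule that)
qed

section \<open>Modules over group rings\<close>

definition monomial :: "('r, 'u) ring_scheme \<Rightarrow> 'g \<Rightarrow> 'r \<Rightarrow> 'g \<Rightarrow> 'r"
  where "monomial R g r = (\<lambda>x. if x = g then r else \<zero>\<^bsub>R\<^esub>)"

text \<open>That the group ring is a ring is an assumption here. In the theorem it is inherited from
  the given resolutions, since \<open>left_module\<close> contains the ring axioms for its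
  scalars.\<close>

locale group_algebra = R: ring R + H: group H + A: ring "group_ring R H"
  for R :: "('r, 'u) ring_scheme" and H :: "('g, 'v) monoid_scheme"
begin

abbreviation RH where "RH \<equiv> group_ring R H"

lemma carrierD:
  assumes "a \<in> carrier RH"
  shows "a g \<in> carrier R" "g \<notin> carrier H \<Longrightarrow> a g = \<zero>\<^bsub>R\<^esub>" "finite {g. a g \<noteq> \<zero>\<^bsub>R\<^esub>}"
    "{g. a g \<noteq> \<zero>\<^bsub>R\<^esub>} \<subseteq> carrier H"
proof -
  show "a g \<in> carrier R"
    using assms by (cases "g \<in> carrier H") (simp_all add: group_ring_def)
qed (use assms in \<open>auto simp: group_ring_def\<close>)

lemma carrierI:
  assumes "\<And>g. g \<in> carrier H \<Longrightarrow> a g \<in> carrier R" "\<And>g. g \<notin> carrier H \<Longrightarrow> a g = \<zero>\<^bsub>R\<^esub>"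
    and "finite A" "\<And>g. g \<in> carrier H \<Longrightarrow> g \<notin> A \<Longrightarrow> a g = \<zero>\<^bsub>R\<^esub>"
  shows "a \<in> carrier RH"
proof -
  have "{g. a g \<noteq> \<zero>\<^bsub>R\<^esub>} \<subseteq> A" using assms(2,4) by auto
  then have "finite {g. a g \<noteq> \<zero>\<^bsub>R\<^esub>}" using assms(3) by (rule finite_subset)
  then show ?thesis using assms(1,2) by (simp add: group_ring_def)
qed

lemma zero_apply: "\<zero>\<^bsub>RH\<^esub> = (\<lambda>x. \<zero>\<^bsub>R\<^esub>)"
  and one_apply: "\<one>\<^bsub>RH\<^esub> = monomial R \<one>\<^bsub>H\<^esub> \<one>\<^bsub>R\<^esub>"
  and add_apply: "(a \<oplus>\<^bsub>RH\<^esub> b) x = a x \<oplus>\<^bsub>R\<^esub> b x"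
  by (simp_all add: group_ring_def monomial_def)

lemma mult_outside: "x \<notin> carrier H \<Longrightarrow> (a \<otimes>\<^bsub>RH\<^esub> b) x = \<zero>\<^bsub>R\<^esub>"
  by (simp add: group_ring_def)

lemma mult_apply:
  assumes "a \<in> carrier RH" "b \<in> carrier RH" "x \<in> carrier H"
    and "finite B" "B \<subseteq> carrier H" "{g. a g \<noteq> \<zero>\<^bsub>R\<^esub>} \<subseteq> B"
  shows "(a \<otimes>\<^bsub>RH\<^esub> b) x = (\<Oplus>\<^bsub>R\<^esub>g\<in>B. a g \<otimes>\<^bsub>R\<^esub> b (inv\<^bsub>H\<^esub> g \<otimes>\<^bsub>H\<^esub> x))"
proof -
  have "(a \<otimes>\<^bsub>RH\<^esub> b) x =
      (\<Oplus>\<^bsub>R\<^esub>g\<in>{g \<in> carrier H. a g \<noteq> \<zero>\<^bsub>R\<^esub>}. a g \<otimes>\<^bsub>R\<^esub> b (inv\<^bsub>H\<^esub> g \<otimes>\<^bsub>H\<^esub> x))"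
    using assms(3) by (simp add: group_ring_def)
  also have "\<dots> = (\<Oplus>\<^bsub>R\<^esub>g\<in>B. a g \<otimes>\<^bsub>R\<^esub> b (inv\<^bsub>H\<^esub> g \<otimes>\<^bsub>H\<^esub> x))"
    using assms carrierD[OF assms(1)] carrierD[OF assms(2)]
    by (intro R.finsum_remove_zeros) auto
  finally show ?thesis .
qed

lemma finsum_apply:
  assumes "finite B" "f \<in> B \<rightarrow> carrier RH"
  shows "(\<Oplus>\<^bsub>RH\<^esub>i\<in>B. f i) x = (\<Oplus>\<^bsub>R\<^esub>i\<in>B. f i x)"
  using assms
proof (induct set: finite)
  case empty
  then show ?case by (simp add: zero_apply)
next
  case (insert i B)
  have "(\<lambda>i. f i x) \<in> insert i B \<rightarrow> carrier R" using insert.prems carrierD(1) by auto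
  then show ?case using insert by (simp add: add_apply Pi_def)
qed

lemma monomial_closed: "g \<in> carrier H \<Longrightarrow> r \<in> carrier R \<Longrightarrow> monomial R g r \<in> carrier RH"
  by (rule carrierI[of _ "{g}"]) (auto simp: monomial_def)

lemma monomial_mult_apply:
  assumes "g \<in> carrier H" "r \<in> carrier R" "a \<in> carrier RH" "x \<in> carrier H"
  shows "(monomial R g r \<otimes>\<^bsub>RH\<^esub> a) x = r \<otimes>\<^bsub>R\<^esub> a (inv\<^bsub>H\<^esub> g \<otimes>\<^bsub>H\<^esub> x)"
proof -
  have "(monomial R g r \<otimes>\<^bsub>RH\<^esub> a) x =
      (\<Oplus>\<^bsub>R\<^esub>h\<in>{g}. monomial R g r h \<otimes>\<^bsub>R\<^esub> a (inv\<^bsub>H\<^esub> h \<otimes>\<^bsub>H\<^esub> x))"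
    by (rule mult_apply) (use assms monomial_closed in \<open>auto simp: monomial_def\<close>)
  also have "\<dots> = r \<otimes>\<^bsub>R\<^esub> a (inv\<^bsub>H\<^esub> g \<otimes>\<^bsub>H\<^esub> x)"
    using assms carrierD(1)[OF assms(3)] by (simp add: monomial_def)
  finally show ?thesis .
qed

lemma monomial_mult:
  assumes "g \<in> carrier H" "r \<in> carrier R" "h \<in> carrier H" "s \<in> carrier R"
  shows "monomial R g r \<otimes>\<^bsub>RH\<^esub> monomial R h s = monomial R (g \<otimes>\<^bsub>H\<^esub> h) (r \<otimes>\<^bsub>R\<^esub> s)"
proof
  fix x
  show "(monomial R g r \<otimes>\<^bsub>RH\<^esub> monomial R h s) x = monomial R (g \<otimes>\<^bsub>H\<^esub> h) (r \<otimes>\<^bsub>R\<^esub> s) x"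
  proof (cases "x \<in> carrier H")
    case True
    have "inv\<^bsub>H\<^esub> g \<otimes>\<^bsub>H\<^esub> x = h \<longleftrightarrow> x = g \<otimes>\<^bsub>H\<^esub> h"
      using assms True by (metis H.inv_solve_left)
    then show ?thesis
      using assms True monomial_mult_apply[OF assms(1,2) monomial_closed[OF assms(3,4)] True]
      by (simp add: monomial_def)
  next
    case False
    then show ?thesis using assms mult_outside by (auto simp: monomial_def)
  qed
qed

lemma mult_monomial_apply:
  assumes "a \<in> carrier RH" "g \<in> carrier H" "r \<in> carrier R" "x \<in> carrier H"
  shows "(a \<otimes>\<^bsub>RH\<^esub> monomial R g r) x = a (x \<otimes>\<^bsub>H\<^esub> inv\<^bsub>H\<^esub> g) \<otimes>\<^bsub>R\<^esub> r"
proof -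
  let ?y = "x \<otimes>\<^bsub>H\<^esub> inv\<^bsub>H\<^esub> g"
  \<comment> \<open>Only \<open>h = ?y\<close> can contribute to the product, and it is added to the
    index set because \<open>a\<close> may vanish there.\<close>
  let ?B = "insert ?y {g. a g \<noteq> \<zero>\<^bsub>R\<^esub>}"
  have y: "?y \<in> carrier H" using assms by simp
  have eq: "inv\<^bsub>H\<^esub> h \<otimes>\<^bsub>H\<^esub> x = g \<longleftrightarrow> h = ?y" if "h \<in> carrier H" for h
    using that assms by (metis H.inv_solve_left H.inv_solve_right)
  have B: "finite ?B" "?B \<subseteq> carrier H" using carrierD[OF assms(1)] y by auto
  have "(a \<otimes>\<^bsub>RH\<^esub> monomial R g r) x =
      (\<Oplus>\<^bsub>R\<^esub>h\<in>?B. a h \<otimes>\<^bsub>R\<^esub> monomial R g r (inv\<^bsub>H\<^esub> h \<otimes>\<^bsub>H\<^esub> x))"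
    by (rule mult_apply[OF assms(1) monomial_closed[OF assms(2,3)] assms(4) B]) auto
  also have "\<dots> = (\<Oplus>\<^bsub>R\<^esub>h\<in>?B. if ?y = h then a h \<otimes>\<^bsub>R\<^esub> r else \<zero>\<^bsub>R\<^esub>)"
  proof (rule R.finsum_cong')
    fix h assume "h \<in> ?B"
    then have "h \<in> carrier H" using B by blast
    then show "a h \<otimes>\<^bsub>R\<^esub> monomial R g r (inv\<^bsub>H\<^esub> h \<otimes>\<^bsub>H\<^esub> x) = (if ?y = h then a h \<otimes>\<^bsub>R\<^esub> r else \<zero>\<^bsub>R\<^esub>)"
      using eq[of h] carrierD(1)[OF assms(1)] assms(3) by (cases "?y = h") (simp_all add: monomial_def)
  qed (use carrierD(1)[OF assms(1)] assms(3) in auto)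
  also have "\<dots> = a ?y \<otimes>\<^bsub>R\<^esub> r"
    using B carrierD(1)[OF assms(1)] assms(3) by (intro R.finsum_singleton) auto
  finally show ?thesis .
qed

lemma monomial_decomposition:
  assumes "a \<in> carrier RH"
  shows "a = (\<Oplus>\<^bsub>RH\<^esub>g\<in>{g. a g \<noteq> \<zero>\<^bsub>R\<^esub>}. monomial R g (a g))"
proof
  fix x
  let ?B = "{g. a g \<noteq> \<zero>\<^bsub>R\<^esub>}"
  have "(\<Oplus>\<^bsub>RH\<^esub>g\<in>?B. monomial R g (a g)) x = (\<Oplus>\<^bsub>R\<^esub>g\<in>?B. monomial R g (a g) x)"
    using carrierD[OF assms] by (intro finsum_apply) (auto intro!: monomial_closed)
  also have "\<dots> = (\<Oplus>\<^bsub>R\<^esub>g\<in>insert x ?B. if x = g then a g else \<zero>\<^bsub>R\<^esub>)"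
    using carrierD[OF assms] by (intro R.add.finprod_mono_neutral_cong_left) (auto simp: monomial_def)
  also have "\<dots> = a x"
    using carrierD[OF assms] by (intro R.finsum_singleton) auto
  finally show "a x = (\<Oplus>\<^bsub>RH\<^esub>g\<in>?B. monomial R g (a g)) x" by simp
qed

lemma smult_decomposition:
  assumes "left_module RH X" "a \<in> carrier RH" "x \<in> carrier X"
  shows "a \<odot>\<^bsub>X\<^esub> x = (\<Oplus>\<^bsub>X\<^esub>g\<in>{g. a g \<noteq> \<zero>\<^bsub>R\<^esub>}. monomial R g (a g) \<odot>\<^bsub>X\<^esub> x)"
proof -
  interpret X: left_module RH X by fact
  have "a \<odot>\<^bsub>X\<^esub> x = (\<Oplus>\<^bsub>RH\<^esub>g\<in>{g. a g \<noteq> \<zero>\<^bsub>R\<^esub>}. monomial R g (a g)) \<odot>\<^bsub>X\<^esub> x"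
    using monomial_decomposition[OF assms(2)] by simp
  also have "\<dots> = (\<Oplus>\<^bsub>X\<^esub>g\<in>{g. a g \<noteq> \<zero>\<^bsub>R\<^esub>}. monomial R g (a g) \<odot>\<^bsub>X\<^esub> x)"
    using carrierD[OF assms(2)] assms(3)
    by (intro X.finsum_smult_ldistr) (auto intro!: monomial_closed)
  finally show ?thesis .
qed

text \<open>Each element of the group ring is a finite sum of monomials, so an additive map is
  linear once it respects these. This suits maps built by conjugation or truncation, whose effect on
  a single group element is explicit.\<close>

lemma module_hom_monomialI:
  assumes X: "left_module RH X" and Y: "left_module RH Y"
    and cl: "\<And>x. x \<in> carrier X \<Longrightarrow> f x \<in> carrier Y"
    and add: "\<And>x y. \<lbrakk>x \<in> carrier X; y \<in> carrier X\<rbrakk> \<Longrightarrow> f (x \<oplus>\<^bsub>X\<^esub> y) = f x \<oplus>\<^bsub>Y\<^esub> f y"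
    and mon: "\<And>g r x. \<lbrakk>g \<in> carrier H; r \<in> carrier R; x \<in> carrier X\<rbrakk> \<Longrightarrow>
      f (monomial R g r \<odot>\<^bsub>X\<^esub> x) = monomial R g r \<odot>\<^bsub>Y\<^esub> f x"
  shows "f \<in> module_hom RH X Y"
proof (rule module_homI[OF cl add])
  interpret X: left_module RH X by fact
  interpret Y: left_module RH Y by fact
  interpret abelian_group_hom X Y f
    by (intro abelian_group_homI X.M.abelian_group_axioms Y.M.abelian_group_axioms
        group_hom.intro group_hom_axioms.intro X.M.a_group Y.M.a_group) (auto simp: hom_def cl add)
  fix a x assume a: "a \<in> carrier RH" and x: "x \<in> carrier X"
  note D = carrierD[OF a]
  have "f (a \<odot>\<^bsub>X\<^esub> x) = (\<Oplus>\<^bsub>Y\<^esub>g\<in>{g. a g \<noteq> \<zero>\<^bsub>R\<^esub>}. f (monomial R g (a g) \<odot>\<^bsub>X\<^esub> x))"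
    unfolding smult_decomposition[OF X a x] using D x
    by (intro hom_finsum) (auto intro!: X.smult_closed monomial_closed)
  also have "\<dots> = (\<Oplus>\<^bsub>Y\<^esub>g\<in>{g. a g \<noteq> \<zero>\<^bsub>R\<^esub>}. monomial R g (a g) \<odot>\<^bsub>Y\<^esub> f x)"
    using D x cl by (intro Y.finsum_cong') (auto intro!: Y.smult_closed monomial_closed mon)
  also have "\<dots> = a \<odot>\<^bsub>Y\<^esub> f x"
    using smult_decomposition[OF Y a cl[OF x]] by simp
  finally show "f (a \<odot>\<^bsub>X\<^esub> x) = a \<odot>\<^bsub>Y\<^esub> f x" .
qed

lemma submodule_monomialI:
  fixes X :: "('g \<Rightarrow> 'r, 'x, 'w) module_scheme"
  assumes X: "left_module RH X" and sub: "subgroup N (add_monoid X)"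
    and mon: "\<And>g r x. \<lbrakk>g \<in> carrier H; r \<in> carrier R; x \<in> N\<rbrakk> \<Longrightarrow> monomial R g r \<odot>\<^bsub>X\<^esub> x \<in> N"
  shows "submodule N RH X"
proof (intro submodule.intro submodule_axioms.intro sub)
  interpret X: left_module RH X by fact
  fix a x assume a: "a \<in> carrier RH" and x: "x \<in> N"
  note D = carrierD[OF a]
  have sumN: "(\<Oplus>\<^bsub>X\<^esub>i\<in>B. f i) \<in> N" if "finite B" "f \<in> B \<rightarrow> N" for B and f :: "'g \<Rightarrow> 'x"
    using that
  proof (induct set: finite)
    case empty
    then show ?case using subgroup.one_closed[OF sub] by simp
  next
    case (insert i B)
    moreover have "N \<subseteq> carrier X" using subgroup.subset[OF sub] by simp
    ultimately have "f \<in> B \<rightarrow> carrier X" "f i \<in> carrier X" by auto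
    then show ?case using insert subgroup.m_closed[OF sub] by simp
  qed
  have "x \<in> carrier X" using subgroup.subset[OF sub] x by auto
  then show "a \<odot>\<^bsub>X\<^esub> x \<in> N"
    unfolding smult_decomposition[OF X a \<open>x \<in> carrier X\<close>]
    using D x by (intro sumN) (auto intro!: mon)
qed

end

section \<open>Restriction to the kernel\<close>

lemma int_set_bounded:
  assumes "finite (J :: int set)"
  obtains M where "\<And>j. j \<in> J \<Longrightarrow> \<bar>j\<bar> \<le> M"
proof (rule that)
  fix j assume "j \<in> J"
  then show "\<bar>j\<bar> \<le> Max (abs ` J)" using assms by (intro Max_ge) auto
qed

text \<open>The element \<open>t\<close> splits \<open>\<phi>\<close>: every group element is
  uniquely \<open>k t^j\<close> with \<open>k\<close> in the kernel and \<open>j\<close> its value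
  under \<open>\<phi>\<close>. In this form \<open>- \<phi>\<close> and the inverse of
  \<open>t\<close> give another instance, which exchanges the two ends of
  \<open>G/K\<close>.\<close>

locale cyclic_quotient = G: group_algebra R G + K: group_algebra R K
  for R :: "('r, 'u) ring_scheme" and G K :: "('g, 'v) monoid_scheme" +
  fixes \<phi> :: "'g \<Rightarrow> int" and t :: 'g
  assumes phi_hom: "\<phi> \<in> hom G integer_group"
    and K_eq: "K = G\<lparr>carrier := {g \<in> carrier G. \<phi> g = 0}\<rparr>"
    and t: "t \<in> carrier G" and phi_t: "\<phi> t = 1"
begin

sublocale phi: group_hom G integer_group \<phi>
  by (intro group_hom.intro group_hom_axioms.intro G.H.group_axioms group_integer_group phi_hom)

abbreviation RG where "RG \<equiv> group_ring R G"
abbreviation RK where "RK \<equiv> group_ring R K"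

lemma phi_mult: "g \<in> carrier G \<Longrightarrow> h \<in> carrier G \<Longrightarrow> \<phi> (g \<otimes>\<^bsub>G\<^esub> h) = \<phi> g + \<phi> h"
  and phi_inv: "g \<in> carrier G \<Longrightarrow> \<phi> (inv\<^bsub>G\<^esub> g) = - \<phi> g"
  and phi_one: "\<phi> \<one>\<^bsub>G\<^esub> = 0"
  using phi.hom_mult phi.hom_inv phi.hom_one by simp_all

lemma phi_pow: "\<phi> (t [^]\<^bsub>G\<^esub> (j::int)) = j"
  using phi.hom_int_pow[OF t, of j] by (simp add: phi_t)

lemma K_iff: "k \<in> carrier K \<longleftrightarrow> k \<in> carrier G \<and> \<phi> k = 0"
  and K_mult: "mult K = mult G" and K_one: "one K = one G"
  by (simp_all add: K_eq)

lemma K_subgroup: "subgroup (carrier K) G"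
  by (rule G.H.subgroupI) (auto simp: K_iff phi_mult phi_inv phi_one intro!: exI[of _ "\<one>\<^bsub>G\<^esub>"])

lemma K_inv: "k \<in> carrier K \<Longrightarrow> inv\<^bsub>K\<^esub> k = inv\<^bsub>G\<^esub> k"
  using G.H.m_inv_consistent[OF K_subgroup] by (simp add: K_eq)

lemma RK_iff: "a \<in> carrier RK \<longleftrightarrow> a \<in> carrier RG \<and> (\<forall>g. g \<notin> carrier K \<longrightarrow> a g = \<zero>\<^bsub>R\<^esub>)"
proof
  assume a: "a \<in> carrier RK"
  show "a \<in> carrier RG \<and> (\<forall>g. g \<notin> carrier K \<longrightarrow> a g = \<zero>\<^bsub>R\<^esub>)"
    using K.carrierD[OF a] by (auto intro!: G.carrierI[of _ "{g. a g \<noteq> \<zero>\<^bsub>R\<^esub>}"] simp: K_iff)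
next
  assume a: "a \<in> carrier RG \<and> (\<forall>g. g \<notin> carrier K \<longrightarrow> a g = \<zero>\<^bsub>R\<^esub>)"
  then show "a \<in> carrier RK"
    using G.carrierD[of a] by (auto intro!: K.carrierI[of _ "{g. a g \<noteq> \<zero>\<^bsub>R\<^esub>}"])
qed

lemma RK_subset: "a \<in> carrier RK \<Longrightarrow> a \<in> carrier RG"
  by (simp add: RK_iff)

lemma RK_ops: "zero RK = zero RG" "one RK = one RG" "add RK = add RG"
  by (simp_all add: group_ring_def K_one)

text \<open>Convolution with \<open>a\<close> in \<open>RK\<close> stays within a coset
  \<open>K x\<close>, so it can be computed after translating that coset to \<open>K\<close>. With
  \<open>x = x'\<close> this compares the two products on \<open>RK\<close>; with
  \<open>x = x' t^j\<close> it yields linearity of the coordinates in the restricted dual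
  basis.\<close>

lemma RK_mult:
  assumes a: "a \<in> carrier RK" and b: "b \<in> carrier RG"
    and "x \<in> carrier G" "b' \<in> carrier RK" "x' \<in> carrier K"
    and eq: "\<And>k. k \<in> carrier K \<Longrightarrow> b' (k \<otimes>\<^bsub>G\<^esub> x') = b (k \<otimes>\<^bsub>G\<^esub> x)"
  shows "(a \<otimes>\<^bsub>RK\<^esub> b') x' = (a \<otimes>\<^bsub>RG\<^esub> b) x"
proof -
  let ?B = "{g. a g \<noteq> \<zero>\<^bsub>R\<^esub>}"
  note D = K.carrierD[OF a]
  have "(a \<otimes>\<^bsub>RK\<^esub> b') x' = (\<Oplus>\<^bsub>R\<^esub>g\<in>?B. a g \<otimes>\<^bsub>R\<^esub> b' (inv\<^bsub>K\<^esub> g \<otimes>\<^bsub>K\<^esub> x'))"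
    using assms D by (intro K.mult_apply) auto
  also have "\<dots> = (\<Oplus>\<^bsub>R\<^esub>g\<in>?B. a g \<otimes>\<^bsub>R\<^esub> b (inv\<^bsub>G\<^esub> g \<otimes>\<^bsub>G\<^esub> x))"
  proof (rule G.R.finsum_cong')
    fix g assume "g \<in> ?B"
    then have g: "g \<in> carrier K" using D by blast
    then have "inv\<^bsub>G\<^esub> g \<in> carrier K" using K_subgroup by (rule subgroup.m_inv_closed[rotated])
    then show "a g \<otimes>\<^bsub>R\<^esub> b' (inv\<^bsub>K\<^esub> g \<otimes>\<^bsub>K\<^esub> x') = a g \<otimes>\<^bsub>R\<^esub> b (inv\<^bsub>G\<^esub> g \<otimes>\<^bsub>G\<^esub> x)"
      using eq g by (simp add: K_inv K_mult)
  qed (use D G.carrierD(1)[OF b] in auto)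
  also have "\<dots> = (a \<otimes>\<^bsub>RG\<^esub> b) x"
    using assms D RK_subset[OF a] by (intro G.mult_apply[symmetric]) (auto simp: K_iff)
  finally show ?thesis .
qed

lemma RK_mult_eq:
  assumes a: "a \<in> carrier RK" and b: "b \<in> carrier RK"
  shows "a \<otimes>\<^bsub>RK\<^esub> b = a \<otimes>\<^bsub>RG\<^esub> b"
proof
  fix x
  consider "x \<in> carrier K" | "x \<in> carrier G" "x \<notin> carrier K" | "x \<notin> carrier G" by blast
  then show "(a \<otimes>\<^bsub>RK\<^esub> b) x = (a \<otimes>\<^bsub>RG\<^esub> b) x"
  proof cases
    case 1
    then show ?thesis by (intro RK_mult RK_subset a b) (auto simp: K_iff)
  next
    case 2
    let ?B = "{g. a g \<noteq> \<zero>\<^bsub>R\<^esub>}"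
    note D = K.carrierD[OF a] and Db = K.carrierD[OF b]
    have "(a \<otimes>\<^bsub>RG\<^esub> b) x = (\<Oplus>\<^bsub>R\<^esub>g\<in>?B. a g \<otimes>\<^bsub>R\<^esub> b (inv\<^bsub>G\<^esub> g \<otimes>\<^bsub>G\<^esub> x))"
      using 2 D RK_subset[OF a] RK_subset[OF b] by (intro G.mult_apply) (auto simp: K_iff)
    also have "\<dots> = \<zero>\<^bsub>R\<^esub>"
    proof (rule G.R.add.finprod_one_eqI)
      fix g assume "g \<in> ?B"
      then have g: "g \<in> carrier G" "\<phi> g = 0" using D K_iff by blast+
      then have "inv\<^bsub>G\<^esub> g \<otimes>\<^bsub>G\<^esub> x \<notin> carrier K" using 2 by (simp add: K_iff phi_mult phi_inv)
      then show "a g \<otimes>\<^bsub>R\<^esub> b (inv\<^bsub>G\<^esub> g \<otimes>\<^bsub>G\<^esub> x) = \<zero>\<^bsub>R\<^esub>" using Db(2) D(1) by simp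
    qed
    finally show ?thesis using K.mult_outside[OF 2(2)] by simp
  next
    case 3
    then show ?thesis using K.mult_outside[of x] G.mult_outside[of x] K_iff by simp
  qed
qed

lemma restrict_scalars:
  assumes "left_module RG X"
  shows "left_module RK X"
proof -
  interpret X: left_module RG X by fact
  show ?thesis
  proof (intro left_module.intro left_module_axioms.intro K.A.ring_axioms X.M.abelian_group_axioms)
    show "(a \<otimes>\<^bsub>RK\<^esub> b) \<odot>\<^bsub>X\<^esub> x = a \<odot>\<^bsub>X\<^esub> (b \<odot>\<^bsub>X\<^esub> x)"
      if "a \<in> carrier RK" "b \<in> carrier RK" "x \<in> carrier X" for a b x
      using that X.smult_assoc1 RK_subset by (simp add: RK_mult_eq)
  qed (simp_all add: RK_ops RK_subset X.smult_closed X.smult_l_distr X.smult_r_distr X.smult_one)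
qed

lemma module_hom_restrict_scalars: "f \<in> module_hom RG X Y \<Longrightarrow> f \<in> module_hom RK X Y"
  by (auto simp: module_hom_def dest: RK_subset)

lemma monomial_K: "k \<in> carrier K \<Longrightarrow> r \<in> carrier R \<Longrightarrow> monomial R k r \<in> carrier RK"
  by (rule K.monomial_closed)

section \<open>Powers of \<open>t\<close> and conjugation\<close>

definition act :: "('g \<Rightarrow> 'r, 'x, 'w) module_scheme \<Rightarrow> int \<Rightarrow> 'x \<Rightarrow> 'x"
  where "act X j x = monomial R (t [^]\<^bsub>G\<^esub> j) \<one>\<^bsub>R\<^esub> \<odot>\<^bsub>X\<^esub> x"

lemma t_pow: "t [^]\<^bsub>G\<^esub> (j::int) \<in> carrier G"
  using t by simp

lemma act_closed: "left_module RG X \<Longrightarrow> x \<in> carrier X \<Longrightarrow> act X j x \<in> carrier X"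
  unfolding act_def using t_pow
  by (intro left_module.smult_closed[of RG X] G.monomial_closed) auto

lemma act_add: "left_module RG X \<Longrightarrow> x \<in> carrier X \<Longrightarrow> y \<in> carrier X \<Longrightarrow>
    act X j (x \<oplus>\<^bsub>X\<^esub> y) = act X j x \<oplus>\<^bsub>X\<^esub> act X j y"
  unfolding act_def using t_pow
  by (intro left_module.smult_r_distr[of RG X] G.monomial_closed) auto

lemma act_zero: "left_module RG X \<Longrightarrow> act X j \<zero>\<^bsub>X\<^esub> = \<zero>\<^bsub>X\<^esub>"
  unfolding act_def using t_pow
  by (intro left_module.smult_r_null[of RG X] G.monomial_closed) auto

lemma act_diff: "left_module RG X \<Longrightarrow> x \<in> carrier X \<Longrightarrow> y \<in> carrier X \<Longrightarrow>
    act X j (x \<ominus>\<^bsub>X\<^esub> y) = act X j x \<ominus>\<^bsub>X\<^esub> act X j y"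
  unfolding act_def using t_pow
  by (intro left_module.smult_r_diff[of RG X] G.monomial_closed) auto

lemma act_act:
  assumes "left_module RG X" "x \<in> carrier X"
  shows "act X i (act X j x) = act X (i + j) x"
proof -
  interpret X: left_module RG X by fact
  have "act X i (act X j x) =
      (monomial R (t [^]\<^bsub>G\<^esub> i) \<one>\<^bsub>R\<^esub> \<otimes>\<^bsub>RG\<^esub> monomial R (t [^]\<^bsub>G\<^esub> j) \<one>\<^bsub>R\<^esub>) \<odot>\<^bsub>X\<^esub> x"
    unfolding act_def using assms(2) t_pow
    by (intro X.smult_assoc1[symmetric] G.monomial_closed) auto
  then show ?thesis
    using t_pow by (simp add: act_def G.monomial_mult G.H.int_pow_mult t)
qed

lemma act_0: "left_module RG X \<Longrightarrow> x \<in> carrier X \<Longrightarrow> act X 0 x = x"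
  unfolding act_def using left_module.smult_one[of RG X x] by (simp add: G.one_apply)

lemma hom_act:
  assumes "f \<in> module_hom RG X Y" "x \<in> carrier X"
  shows "f (act X j x) = act Y j (f x)"
  unfolding act_def using t_pow by (intro module_homD(3)[OF assms(1)] assms(2) G.monomial_closed) auto

text \<open>Normality of \<open>K\<close>: a group element \<open>k\<close> passes the power
  \<open>t^j\<close> at the price of being conjugated by it.\<close>

lemma monomial_act:
  fixes j :: int
  assumes X: "left_module RG X" and "x \<in> carrier X" "k \<in> carrier K" "r \<in> carrier R"
  defines "k' \<equiv> t [^]\<^bsub>G\<^esub> (- j) \<otimes>\<^bsub>G\<^esub> k \<otimes>\<^bsub>G\<^esub> t [^]\<^bsub>G\<^esub> j"
  shows "k' \<in> carrier K" "monomial R k r \<odot>\<^bsub>X\<^esub> act X j x = act X j (monomial R k' r \<odot>\<^bsub>X\<^esub> x)"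
proof -
  interpret X: left_module RG X by fact
  have k: "k \<in> carrier G" "\<phi> k = 0" using assms(3) by (auto simp: K_iff)
  show k': "k' \<in> carrier K"
    using k t_pow by (auto simp: k'_def K_iff phi_mult phi_pow)
  then have k'G: "k' \<in> carrier G" by (simp add: K_iff)
  have "t [^]\<^bsub>G\<^esub> j \<otimes>\<^bsub>G\<^esub> k' = k \<otimes>\<^bsub>G\<^esub> t [^]\<^bsub>G\<^esub> j"
    using k t_pow t by (simp add: k'_def G.H.m_assoc[symmetric] G.H.int_pow_mult[symmetric])
  then have "monomial R k r \<otimes>\<^bsub>RG\<^esub> monomial R (t [^]\<^bsub>G\<^esub> j) \<one>\<^bsub>R\<^esub> =
      monomial R (t [^]\<^bsub>G\<^esub> j) \<one>\<^bsub>R\<^esub> \<otimes>\<^bsub>RG\<^esub> monomial R k' r"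
    using k k'G t_pow assms(4) by (simp add: G.monomial_mult)
  then show "monomial R k r \<odot>\<^bsub>X\<^esub> act X j x = act X j (monomial R k' r \<odot>\<^bsub>X\<^esub> x)"
    unfolding act_def using k k'G t_pow assms(2,4)
    by (subst (1 2) X.smult_assoc1[symmetric]) (auto intro!: G.monomial_closed)
qed

text \<open>The map \<open>t^j f t^(-j)\<close>. Since \<open>t\<close> normalises \<open>K\<close>
  it is again \<open>RK\<close>-linear, and its dependence on \<open>j\<close> measures how far
  \<open>f\<close> is from commuting with \<open>t\<close>.\<close>

definition conjugate ::
    "('g \<Rightarrow> 'r, 'x, 'w) module_scheme \<Rightarrow> ('g \<Rightarrow> 'r, 'y, 'z) module_scheme \<Rightarrow> int \<Rightarrow> ('x \<Rightarrow> 'y) \<Rightarrow> 'x \<Rightarrow> 'y"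
  where "conjugate X Y j f x = act Y j (f (act X (- j) x))"

lemma conjugate_hom:
  assumes X: "left_module RG X" and Y: "left_module RG Y" and f: "f \<in> module_hom RK X Y"
  shows "conjugate X Y j f \<in> module_hom RK X Y"
proof (rule K.module_hom_monomialI[OF restrict_scalars[OF X] restrict_scalars[OF Y]])
  fix x assume "x \<in> carrier X"
  then show "conjugate X Y j f x \<in> carrier Y"
    unfolding conjugate_def by (intro act_closed X Y module_homD(1)[OF f])
next
  fix x y assume "x \<in> carrier X" "y \<in> carrier X"
  then show "conjugate X Y j f (x \<oplus>\<^bsub>X\<^esub> y) = conjugate X Y j f x \<oplus>\<^bsub>Y\<^esub> conjugate X Y j f y"
    unfolding conjugate_def using act_closed[OF X]
    by (simp add: act_add[OF X] act_add[OF Y] module_homD(1,2)[OF f])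
next
  fix k r x assume k: "k \<in> carrier K" and r: "r \<in> carrier R" and x: "x \<in> carrier X"
  interpret X: left_module RG X by fact
  let ?k = "t [^]\<^bsub>G\<^esub> (- j) \<otimes>\<^bsub>G\<^esub> k \<otimes>\<^bsub>G\<^esub> t [^]\<^bsub>G\<^esub> j"
  have k': "?k \<in> carrier K" by (rule monomial_act(1)[OF X x k r])
  have fx: "f (act X (- j) x) \<in> carrier Y" using x by (intro act_closed X module_homD(1)[OF f])
  have ax: "act X (- j) x \<in> carrier X" by (rule act_closed[OF X x])
  have mx: "monomial R ?k r \<odot>\<^bsub>X\<^esub> act X (- j) x \<in> carrier X"
    using left_module.smult_closed[OF restrict_scalars[OF X] monomial_K[OF k' r] ax] .
  have "monomial R k r \<odot>\<^bsub>X\<^esub> x = monomial R k r \<odot>\<^bsub>X\<^esub> act X j (act X (- j) x)"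
    using x by (simp add: act_act[OF X] act_0[OF X])
  also have "\<dots> = act X j (monomial R ?k r \<odot>\<^bsub>X\<^esub> act X (- j) x)"
    by (rule monomial_act(2)[OF X ax k r])
  finally have "act X (- j) (monomial R k r \<odot>\<^bsub>X\<^esub> x) = monomial R ?k r \<odot>\<^bsub>X\<^esub> act X (- j) x"
    using mx by (simp add: act_act[OF X] act_0[OF X])
  then show "conjugate X Y j f (monomial R k r \<odot>\<^bsub>X\<^esub> x) = monomial R k r \<odot>\<^bsub>Y\<^esub> conjugate X Y j f x"
    unfolding conjugate_def
    using monomial_act(2)[OF Y fx k r, of j] module_homD(3)[OF f monomial_K[OF k' r] ax] by simp
qed

text \<open>One condition for each end of \<open>G/K\<close>. The value \<open>z\<close> is meant to be the zero of the codomain.\<close>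

definition vanishes_up :: "('g \<Rightarrow> 'r, 'x, 'w) module_scheme \<Rightarrow> 'y \<Rightarrow> ('x \<Rightarrow> 'y) \<Rightarrow> bool"
  where "vanishes_up X z f \<longleftrightarrow> (\<forall>x\<in>carrier X. \<exists>N. \<forall>j\<ge>N. f (act X j x) = z)"

definition vanishes_down :: "('g \<Rightarrow> 'r, 'x, 'w) module_scheme \<Rightarrow> 'y \<Rightarrow> ('x \<Rightarrow> 'y) \<Rightarrow> bool"
  where "vanishes_down X z f \<longleftrightarrow> (\<forall>x\<in>carrier X. \<exists>N. \<forall>j\<ge>N. f (act X (- j) x) = z)"

section \<open>Cutting coordinates by the value of \<open>\<phi>\<close>\<close>

definition truncate :: "int set \<Rightarrow> ('g \<Rightarrow> 'r) \<Rightarrow> 'g \<Rightarrow> 'r"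
  where "truncate J a g = (if \<phi> g \<in> J then a g else \<zero>\<^bsub>R\<^esub>)"

lemma truncate_closed:
  assumes a: "a \<in> carrier RG"
  shows "truncate J a \<in> carrier RG"
  using G.carrierD[OF a]
  by (intro G.carrierI[of _ "{g. a g \<noteq> \<zero>\<^bsub>R\<^esub>}"]) (auto simp: truncate_def)

lemma truncate_mult:
  assumes k: "k \<in> carrier K" and r: "r \<in> carrier R" and a: "a \<in> carrier RG"
  shows "truncate J (monomial R k r \<otimes>\<^bsub>RG\<^esub> a) = monomial R k r \<otimes>\<^bsub>RG\<^esub> truncate J a"
proof
  fix x
  have k': "k \<in> carrier G" "\<phi> k = 0" using k by (auto simp: K_iff)
  show "truncate J (monomial R k r \<otimes>\<^bsub>RG\<^esub> a) x = (monomial R k r \<otimes>\<^bsub>RG\<^esub> truncate J a) x"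
  proof (cases "x \<in> carrier G")
    case True
    then show ?thesis
      using k' r by (simp add: G.monomial_mult_apply truncate_closed a)
        (simp add: truncate_def G.monomial_mult_apply a phi_mult phi_inv)
  qed (simp add: truncate_def G.mult_outside)
qed

text \<open>Left multiplication by \<open>K\<close> leaves the values of \<open>\<phi>\<close> on a
  support unchanged, which makes truncation \<open>RK\<close>-linear. Multiplication by
  \<open>t^j\<close> shifts them by \<open>j\<close>. The coordinates of \<open>x\<close> involve
  finitely many values, all of absolute value at most some \<open>N\<close>, so those of
  \<open>t^j x\<close> avoid \<open>J\<close> as soon as the shifted interval does.\<close>

lemma truncation_hom:
  assumes X: "left_module RG P" and db: "dual_basis RG P (carrier P) (\<lambda>x. x) h"
  defines "p \<equiv> \<lambda>J x. linear_combination RG P (\<lambda>x. x) (\<lambda>y. truncate J (h x y))"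
  shows "p J \<in> module_hom RK P P"
    and "x \<in> carrier P \<Longrightarrow> p J x \<oplus>\<^bsub>P\<^esub> p (- J) x = x"
    and "x \<in> carrier P \<Longrightarrow> \<exists>N. \<forall>j. (\<forall>i. \<bar>i\<bar> \<le> N \<longrightarrow> i + j \<notin> J) \<longrightarrow> p J (act P j x) = \<zero>\<^bsub>P\<^esub>"
proof -
  interpret X: left_module RG P by fact
  let ?F = "free_module RG (carrier P)"
  interpret F: left_module RG ?F by (rule G.A.free_left_module)
  have h: "h \<in> module_hom RG P ?F" and rec: "\<And>x. x \<in> carrier P \<Longrightarrow> linear_combination RG P (\<lambda>x. x) (h x) = x"
    using db by (auto simp: dual_basis_def)
  have hF: "h x \<in> carrier ?F" if "x \<in> carrier P" for x by (rule module_homD(1)[OF h that])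
  have hc: "h x y \<in> carrier RG" if "x \<in> carrier P" for x y
    by (rule G.A.free_module_carrierD'[OF hF[OF that]])
  let ?t = "\<lambda>J x y. truncate J (h x y)"
  have tz: "truncate J \<zero>\<^bsub>RG\<^esub> = \<zero>\<^bsub>RG\<^esub>" for J by (simp add: truncate_def G.zero_apply fun_eq_iff)
  have tF: "?t J x \<in> carrier ?F" if x: "x \<in> carrier P" for J x
  proof -
    have "{y. ?t J x y \<noteq> \<zero>\<^bsub>RG\<^esub>} \<subseteq> {y. h x y \<noteq> \<zero>\<^bsub>RG\<^esub>}" using tz by auto
    then have "finite {y. ?t J x y \<noteq> \<zero>\<^bsub>RG\<^esub>}"
      using free_module_carrierD(3)[OF hF[OF x]] by (rule finite_subset)
    then show ?thesis
      using free_module_carrierD(2)[OF hF[OF x]] hc[OF x] tz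
      by (auto simp: free_module_def truncate_closed)
  qed
  have lc: "linear_combination RG P (\<lambda>x. x) \<in> module_hom RG ?F P"
    by (rule linear_combination_hom[OF X]) auto
  show "p J \<in> module_hom RK P P"
  proof (rule K.module_hom_monomialI[OF restrict_scalars[OF X] restrict_scalars[OF X]])
    fix x assume "x \<in> carrier P"
    then show "p J x \<in> carrier P" unfolding p_def by (intro module_homD(1)[OF lc] tF)
  next
    fix x y assume x: "x \<in> carrier P" and y: "y \<in> carrier P"
    have "?t J (x \<oplus>\<^bsub>P\<^esub> y) = ?t J x \<oplus>\<^bsub>?F\<^esub> ?t J y"
      unfolding module_homD(2)[OF h x y]
      by (auto simp: free_module_def truncate_def G.add_apply fun_eq_iff)
    then show "p J (x \<oplus>\<^bsub>P\<^esub> y) = p J x \<oplus>\<^bsub>P\<^esub> p J y"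
      unfolding p_def by (simp add: module_homD(2)[OF lc tF[OF x] tF[OF y]])
  next
    fix k r x assume k: "k \<in> carrier K" and r: "r \<in> carrier R" and x: "x \<in> carrier P"
    have m: "monomial R k r \<in> carrier RG" by (rule RK_subset[OF monomial_K[OF k r]])
    have "?t J (monomial R k r \<odot>\<^bsub>P\<^esub> x) = monomial R k r \<odot>\<^bsub>?F\<^esub> ?t J x"
      unfolding module_homD(3)[OF h m x]
      by (simp add: free_module_def truncate_mult[OF k r hc[OF x]])
    then show "p J (monomial R k r \<odot>\<^bsub>P\<^esub> x) = monomial R k r \<odot>\<^bsub>P\<^esub> p J x"
      unfolding p_def by (simp add: module_homD(3)[OF lc m tF[OF x]])
  qed
  show "p J x \<oplus>\<^bsub>P\<^esub> p (- J) x = x" if x: "x \<in> carrier P"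
  proof -
    have "?t J x \<oplus>\<^bsub>?F\<^esub> ?t (- J) x = h x"
      using G.carrierD(1)[OF hc[OF x]]
      by (auto simp: free_module_def truncate_def G.add_apply fun_eq_iff)
    then show ?thesis
      unfolding p_def using module_homD(2)[OF lc tF[OF x] tF[OF x], of J "- J"] rec[OF x] by simp
  qed
  show "\<exists>N. \<forall>j. (\<forall>i. \<bar>i\<bar> \<le> N \<longrightarrow> i + j \<notin> J) \<longrightarrow> p J (act P j x) = \<zero>\<^bsub>P\<^esub>" if x: "x \<in> carrier P"
  proof -
    let ?I = "\<Union>y\<in>{y. h x y \<noteq> \<zero>\<^bsub>RG\<^esub>}. \<phi> ` {g. h x y g \<noteq> \<zero>\<^bsub>R\<^esub>}"
    have "finite ?I" using free_module_carrierD(3)[OF hF[OF x]] G.carrierD(3)[OF hc[OF x]] by auto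
    from int_set_bounded[OF this] obtain N where N: "\<And>i. i \<in> ?I \<Longrightarrow> \<bar>i\<bar> \<le> N" by metis
    have "p J (act P j x) = \<zero>\<^bsub>P\<^esub>" if j: "\<And>i. \<bar>i\<bar> \<le> N \<Longrightarrow> i + j \<notin> J" for j
    proof -
      have m: "monomial R (t [^]\<^bsub>G\<^esub> j) \<one>\<^bsub>R\<^esub> \<in> carrier RG" by (rule G.monomial_closed[OF t_pow]) simp
      have "?t J (act P j x) y g = \<zero>\<^bsub>R\<^esub>" for y g
      proof (cases "g \<in> carrier G")
        case True
        let ?g = "inv\<^bsub>G\<^esub> (t [^]\<^bsub>G\<^esub> j) \<otimes>\<^bsub>G\<^esub> g"
        have eq: "h (act P j x) y g = h x y ?g"
          unfolding act_def module_homD(3)[OF h m x]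
          using G.monomial_mult_apply[OF t_pow _ hc[OF x] True] G.carrierD(1)[OF hc[OF x]]
          by (simp add: free_module_def)
        have "\<phi> g = \<phi> ?g + j" using True t_pow by (simp add: phi_mult phi_inv phi_pow)
        moreover have "\<bar>\<phi> ?g\<bar> \<le> N" if "h x y ?g \<noteq> \<zero>\<^bsub>R\<^esub>"
        proof (rule N[OF UN_I[of y]])
          show "y \<in> {y. h x y \<noteq> \<zero>\<^bsub>RG\<^esub>}" using that by (auto simp: G.zero_apply)
          show "\<phi> ?g \<in> \<phi> ` {g. h x y g \<noteq> \<zero>\<^bsub>R\<^esub>}" using that by simp
        qed
        ultimately show ?thesis using j eq by (auto simp: truncate_def)
      next
        case False
        then show ?thesis using G.carrierD(2)[OF hc[OF act_closed[OF X x]]] by (simp add: truncate_def)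
      qed
      then have "?t J (act P j x) = \<zero>\<^bsub>?F\<^esub>"
        by (simp add: free_module_def G.zero_apply fun_eq_iff)
      then show ?thesis
        unfolding p_def using module_hom_apply_zero[OF lc F.M.abelian_group_axioms X.M.abelian_group_axioms] by simp
    qed
    then show ?thesis by blast
  qed
qed

text \<open>The coordinates of an element with respect to a dual basis are truncated according to the sign of
  \<open>\<phi>\<close>.\<close>

lemma projective_halves:
  assumes "projective_module RG P"
  obtains p q where "p \<in> module_hom RK P P" "q \<in> module_hom RK P P"
    "\<And>x. x \<in> carrier P \<Longrightarrow> p x \<oplus>\<^bsub>P\<^esub> q x = x"
    "vanishes_up P \<zero>\<^bsub>P\<^esub> p" "vanishes_down P \<zero>\<^bsub>P\<^esub> q"
proof -
  have P: "left_module RG P" using assms unfolding projective_module_def by (rule conjunct1)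
  obtain h where h: "dual_basis RG P (carrier P) (\<lambda>x. x) h" using assms by (rule projective_dual_basis)
  let ?p = "\<lambda>J x. linear_combination RG P (\<lambda>x. x) (\<lambda>y. truncate J (h x y))"
  show thesis
  proof (rule that)
    show "?p {..<0} \<in> module_hom RK P P" "?p (- {..<0}) \<in> module_hom RK P P"
      by (rule truncation_hom(1)[OF P h])+
    show "?p {..<0} x \<oplus>\<^bsub>P\<^esub> ?p (- {..<0}) x = x" if "x \<in> carrier P" for x
      by (rule truncation_hom(2)[OF P h that])
    show "vanishes_up P \<zero>\<^bsub>P\<^esub> (?p {..<0})"
      unfolding vanishes_up_def
    proof
      fix x assume "x \<in> carrier P"
      from truncation_hom(3)[OF P h this, of "{..<0}"] obtain N where
        N: "\<And>j. (\<And>i. \<bar>i\<bar> \<le> N \<Longrightarrow> i + j \<notin> {..<0}) \<Longrightarrow> ?p {..<0} (act P j x) = \<zero>\<^bsub>P\<^esub>" by blast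
      show "\<exists>N. \<forall>j\<ge>N. ?p {..<0} (act P j x) = \<zero>\<^bsub>P\<^esub>"
        by (intro exI[of _ N] allI impI N) auto
    qed
    show "vanishes_down P \<zero>\<^bsub>P\<^esub> (?p (- {..<0}))"
      unfolding vanishes_down_def
    proof
      fix x assume "x \<in> carrier P"
      from truncation_hom(3)[OF P h this, of "- {..<0}"] obtain N where
        N: "\<And>j. (\<And>i. \<bar>i\<bar> \<le> N \<Longrightarrow> i + j \<notin> - {..<0}) \<Longrightarrow> ?p (- {..<0}) (act P j x) = \<zero>\<^bsub>P\<^esub>" by blast
      \<comment> \<open>The complement contains zero, so a value that may equal \<open>N\<close> has
        to be lowered by \<open>N + 1\<close> to leave it.\<close>
      show "\<exists>N. \<forall>j\<ge>N. ?p (- {..<0}) (act P (- j) x) = \<zero>\<^bsub>P\<^esub>"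
        by (intro exI[of _ "N + 1"] allI impI N) auto
    qed
  qed
qed


text \<open>\<open>RG\<close> is free over \<open>RK\<close> on the powers of \<open>t\<close>: an
  element splits into its parts on the cosets \<open>K t^j\<close>, and translating such a part back
  to \<open>K\<close> gives a coefficient in \<open>RK\<close>. Doing so with every coordinate turns
  generators \<open>y\<close> over \<open>RG\<close> into generators \<open>t^j y\<close> over
  \<open>RK\<close>.\<close>

lemma restricted_dual_basis:
  assumes "projective_module RG P"
  obtains c where "dual_basis RK P (carrier P \<times> UNIV) (\<lambda>(y, j). act P j y) c"
proof -
  have X: "left_module RG P" using assms unfolding projective_module_def by (rule conjunct1)
  obtain h where db: "dual_basis RG P (carrier P) (\<lambda>x. x) h" using assms by (rule projective_dual_basis)
  interpret X: left_module RG P by fact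
  interpret XK: left_module RK P by (rule restrict_scalars[OF X])
  let ?F = "free_module RG (carrier P)" and ?I = "carrier P \<times> (UNIV :: int set)"
  let ?FK = "free_module RK ?I"
  have h: "h \<in> module_hom RG P ?F" and rec: "\<And>x. x \<in> carrier P \<Longrightarrow> linear_combination RG P (\<lambda>x. x) (h x) = x"
    using db by (auto simp: dual_basis_def)
  have hF: "h x \<in> carrier ?F" if "x \<in> carrier P" for x by (rule module_homD(1)[OF h that])
  have hc: "h x y \<in> carrier RG" if "x \<in> carrier P" for x y
    by (rule G.A.free_module_carrierD'[OF hF[OF that]])
  \<comment> \<open>The coordinate at \<open>t^j y\<close>: the part of the
    \<open>RG\<close>-coordinate at \<open>y\<close> on the coset \<open>K t^j\<close>, translated
    on the right by \<open>t^(-j)\<close>.\<close>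
  define c where "c x = (\<lambda>(y, j :: int). \<lambda>k. if k \<in> carrier K then h x y (k \<otimes>\<^bsub>G\<^esub> t [^]\<^bsub>G\<^esub> j) else \<zero>\<^bsub>R\<^esub>)"
    for x
  have c_apply: "c x (y, j) k = (if k \<in> carrier K then h x y (k \<otimes>\<^bsub>G\<^esub> t [^]\<^bsub>G\<^esub> j) else \<zero>\<^bsub>R\<^esub>)" for x y j k
    by (simp add: c_def)
  have shift: "k \<otimes>\<^bsub>G\<^esub> t [^]\<^bsub>G\<^esub> j \<otimes>\<^bsub>G\<^esub> inv\<^bsub>G\<^esub> (t [^]\<^bsub>G\<^esub> j) = k" if "k \<in> carrier G" for k and j :: int
    using that t_pow by (simp add: G.H.m_assoc)
  have cK: "c x (y, j) \<in> carrier RK" if x: "x \<in> carrier P" for x y j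
  proof (rule K.carrierI)
    show "finite ((\<lambda>g. g \<otimes>\<^bsub>G\<^esub> inv\<^bsub>G\<^esub> (t [^]\<^bsub>G\<^esub> j)) ` {g. h x y g \<noteq> \<zero>\<^bsub>R\<^esub>})"
      using G.carrierD(3)[OF hc[OF x]] by simp
    fix k assume k: "k \<in> carrier K"
      and n: "k \<notin> (\<lambda>g. g \<otimes>\<^bsub>G\<^esub> inv\<^bsub>G\<^esub> (t [^]\<^bsub>G\<^esub> j)) ` {g. h x y g \<noteq> \<zero>\<^bsub>R\<^esub>}"
    show "c x (y, j) k = \<zero>\<^bsub>R\<^esub>"
    proof (rule ccontr)
      assume "c x (y, j) k \<noteq> \<zero>\<^bsub>R\<^esub>"
      then have "k \<otimes>\<^bsub>G\<^esub> t [^]\<^bsub>G\<^esub> j \<in> {g. h x y g \<noteq> \<zero>\<^bsub>R\<^esub>}" using k by (simp add: c_apply)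
      from imageI[OF this, of "\<lambda>g. g \<otimes>\<^bsub>G\<^esub> inv\<^bsub>G\<^esub> (t [^]\<^bsub>G\<^esub> j)"] show False
        using n k shift by (simp add: K_iff)
    qed
  qed (simp_all add: c_apply G.carrierD(1)[OF hc[OF x]])
  have range: "c x (y, j) = \<zero>\<^bsub>RK\<^esub>" if "x \<in> carrier P" "j \<notin> \<phi> ` {g. h x y g \<noteq> \<zero>\<^bsub>R\<^esub>}" for x y j
  proof -
    have "h x y (k \<otimes>\<^bsub>G\<^esub> t [^]\<^bsub>G\<^esub> j) = \<zero>\<^bsub>R\<^esub>" if k: "k \<in> carrier K" for k
    proof (rule ccontr)
      assume "h x y (k \<otimes>\<^bsub>G\<^esub> t [^]\<^bsub>G\<^esub> j) \<noteq> \<zero>\<^bsub>R\<^esub>"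
      then have "\<phi> (k \<otimes>\<^bsub>G\<^esub> t [^]\<^bsub>G\<^esub> j) \<in> \<phi> ` {g. h x y g \<noteq> \<zero>\<^bsub>R\<^esub>}" by blast
      then show False using k \<open>j \<notin> _\<close> t_pow by (simp add: phi_mult phi_pow K_iff)
    qed
    then show ?thesis by (auto simp: c_apply K.zero_apply fun_eq_iff)
  qed
  let ?Y = "\<lambda>x. {y. h x y \<noteq> \<zero>\<^bsub>RG\<^esub>}"
  \<comment> \<open>One index set for all coordinates of \<open>x\<close> encloses the support in a
    rectangle, over which the sum can be iterated.\<close>
  let ?J = "\<lambda>x. \<Union>y\<in>?Y x. \<phi> ` {g. h x y g \<noteq> \<zero>\<^bsub>R\<^esub>}"
  have Y: "finite (?Y x)" "?Y x \<subseteq> carrier P" if "x \<in> carrier P" for x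
    using free_module_carrierD(3,4)[OF hF[OF that]] by auto
  have J: "finite (?J x)" if "x \<in> carrier P" for x
    using Y[OF that] G.carrierD(3)[OF hc[OF that]] by auto
  have supp: "{p. c x p \<noteq> \<zero>\<^bsub>RK\<^esub>} \<subseteq> ?Y x \<times> ?J x" if x: "x \<in> carrier P" for x
  proof
    fix p assume "p \<in> {p. c x p \<noteq> \<zero>\<^bsub>RK\<^esub>}"
    then obtain y j where p: "p = (y, j)" and ne: "c x (y, j) \<noteq> \<zero>\<^bsub>RK\<^esub>" by (cases p) auto
    then have j: "j \<in> \<phi> ` {g. h x y g \<noteq> \<zero>\<^bsub>R\<^esub>}" using range[OF x] by blast
    then have "h x y \<noteq> \<zero>\<^bsub>RG\<^esub>" by (auto simp: G.zero_apply)
    with j show "p \<in> ?Y x \<times> ?J x" unfolding p by blast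
  qed
  have cF: "c x \<in> carrier ?FK" if x: "x \<in> carrier P" for x
  proof -
    have "finite {p. c x p \<noteq> \<zero>\<^bsub>RK\<^esub>}"
      by (rule finite_subset[OF supp[OF x]]) (use Y[OF x] J[OF x] in simp)
    moreover have "c x p = \<zero>\<^bsub>RK\<^esub>" if "p \<notin> ?I" for p
      using supp[OF x] Y(2)[OF x] that by blast
    ultimately show ?thesis using cK[OF x] by (auto simp: free_module_def)
  qed
  have c: "c \<in> module_hom RK P ?FK"
  proof (rule module_homI)
    fix x y assume x: "x \<in> carrier P" and y: "y \<in> carrier P"
    show "c (x \<oplus>\<^bsub>P\<^esub> y) = c x \<oplus>\<^bsub>?FK\<^esub> c y"
      unfolding c_def module_homD(2)[OF h x y]
      by (auto simp: free_module_def G.add_apply K.add_apply fun_eq_iff)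
  next
    fix a x assume a: "a \<in> carrier RK" and x: "x \<in> carrier P"
    have "c (a \<odot>\<^bsub>P\<^esub> x) (y, j) k = (a \<otimes>\<^bsub>RK\<^esub> c x (y, j)) k" for y j k
    proof (cases "k \<in> carrier K")
      case True
      then have "(a \<otimes>\<^bsub>RK\<^esub> c x (y, j)) k = (a \<otimes>\<^bsub>RG\<^esub> h x y) (k \<otimes>\<^bsub>G\<^esub> t [^]\<^bsub>G\<^esub> j)"
        using t_pow K_subgroup subgroup.m_closed[OF K_subgroup]
        by (intro RK_mult a hc[OF x] cK[OF x]) (auto simp: c_apply K_iff G.H.m_assoc phi_mult)
      moreover have "h (a \<odot>\<^bsub>P\<^esub> x) y = a \<otimes>\<^bsub>RG\<^esub> h x y"
        unfolding module_homD(3)[OF h RK_subset[OF a] x] by (simp add: free_module_def)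
      ultimately show ?thesis using True by (simp add: c_apply)
    qed (simp add: c_apply K.mult_outside)
    then show "c (a \<odot>\<^bsub>P\<^esub> x) = a \<odot>\<^bsub>?FK\<^esub> c x"
      by (auto simp: free_module_def fun_eq_iff)
  qed (rule cF)
  have b: "(\<lambda>(y, j). act P j y) \<in> ?I \<rightarrow> carrier P" using act_closed[OF X] by auto
  have "linear_combination RK P (\<lambda>(y, j). act P j y) (c x) = x" if x: "x \<in> carrier P" for x
  proof -
    \<comment> \<open>The parts on the cosets are reassembled: at \<open>g\<close> only the summand
      with index \<open>\<phi> g\<close> can be nonzero.\<close>
    have inner: "(\<Oplus>\<^bsub>P\<^esub>j\<in>?J x. c x (y, j) \<odot>\<^bsub>P\<^esub> act P j y) = h x y \<odot>\<^bsub>P\<^esub> y" if y: "y \<in> ?Y x" for y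
    proof -
      let ?m = "\<lambda>j. monomial R (t [^]\<^bsub>G\<^esub> j) \<one>\<^bsub>R\<^esub>"
      have m: "?m j \<in> carrier RG" for j :: int by (rule G.monomial_closed[OF t_pow]) simp
      have yP: "y \<in> carrier P" using Y(2)[OF x] y by blast
      have cG: "c x (y, j) \<in> carrier RG" for j by (rule RK_subset[OF cK[OF x]])
      have "(\<Oplus>\<^bsub>P\<^esub>j\<in>?J x. c x (y, j) \<odot>\<^bsub>P\<^esub> act P j y) = (\<Oplus>\<^bsub>P\<^esub>j\<in>?J x. (c x (y, j) \<otimes>\<^bsub>RG\<^esub> ?m j) \<odot>\<^bsub>P\<^esub> y)"
        using cG m yP
        by (intro X.M.finsum_cong') (auto simp: act_def X.smult_assoc1 intro!: X.smult_closed)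
      also have "\<dots> = (\<Oplus>\<^bsub>RG\<^esub>j\<in>?J x. c x (y, j) \<otimes>\<^bsub>RG\<^esub> ?m j) \<odot>\<^bsub>P\<^esub> y"
        using cG m yP by (intro X.finsum_smult_ldistr[symmetric] J[OF x]) auto
      also have "(\<Oplus>\<^bsub>RG\<^esub>j\<in>?J x. c x (y, j) \<otimes>\<^bsub>RG\<^esub> ?m j) = h x y"
      proof
        fix g
        have s: "(\<Oplus>\<^bsub>RG\<^esub>j\<in>?J x. c x (y, j) \<otimes>\<^bsub>RG\<^esub> ?m j) g = (\<Oplus>\<^bsub>R\<^esub>j\<in>?J x. (c x (y, j) \<otimes>\<^bsub>RG\<^esub> ?m j) g)"
          using cG m by (intro G.finsum_apply J[OF x]) auto
        show "(\<Oplus>\<^bsub>RG\<^esub>j\<in>?J x. c x (y, j) \<otimes>\<^bsub>RG\<^esub> ?m j) g = h x y g"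
        proof (cases "g \<in> carrier G")
          case True
          have e: "(c x (y, j) \<otimes>\<^bsub>RG\<^esub> ?m j) g = (if \<phi> g = j then h x y g else \<zero>\<^bsub>R\<^esub>)" for j
            using True t_pow G.carrierD(1)[OF hc[OF x]]
            by (simp add: G.mult_monomial_apply[OF cG t_pow _ True] c_apply K_iff phi_mult phi_inv phi_pow
                G.H.m_assoc)
          have "(\<Oplus>\<^bsub>R\<^esub>j\<in>?J x. (c x (y, j) \<otimes>\<^bsub>RG\<^esub> ?m j) g) =
              (\<Oplus>\<^bsub>R\<^esub>j\<in>insert (\<phi> g) (?J x). if \<phi> g = j then h x y g else \<zero>\<^bsub>R\<^esub>)"
            unfolding e using J[OF x] G.carrierD(1)[OF hc[OF x]] y
            by (intro G.R.add.finprod_mono_neutral_cong_left) auto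
          also have "\<dots> = h x y g"
            using J[OF x] G.carrierD(1)[OF hc[OF x]] by (intro G.R.finsum_singleton) auto
          finally show ?thesis using s by simp
        next
          case False
          then show ?thesis unfolding s using G.carrierD(2)[OF hc[OF x]] by (simp add: G.mult_outside)
        qed
      qed
      finally show ?thesis .
    qed
    have "linear_combination RK P (\<lambda>(y, j). act P j y) (c x) =
        (\<Oplus>\<^bsub>P\<^esub>p\<in>?Y x \<times> ?J x. c x p \<odot>\<^bsub>P\<^esub> (case p of (y, j) \<Rightarrow> act P j y))"
      using Y[OF x] J[OF x] supp[OF x]
      by (intro linear_combination_superset[OF XK.left_module_axioms b cF[OF x]]) auto
    also have "\<dots> = (\<Oplus>\<^bsub>P\<^esub>y\<in>?Y x. \<Oplus>\<^bsub>P\<^esub>j\<in>?J x. c x (y, j) \<odot>\<^bsub>P\<^esub> act P j y)"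
      using Y[OF x] cK[OF x]
      by (subst X.M.finsum_Times[OF Y(1)[OF x] J[OF x]]) (auto intro!: XK.smult_closed act_closed[OF X])
    also have "\<dots> = (\<Oplus>\<^bsub>P\<^esub>y\<in>?Y x. h x y \<odot>\<^bsub>P\<^esub> y)"
      using Y[OF x] hc[OF x] by (intro X.M.finsum_cong' inner refl) (auto intro!: X.smult_closed)
    also have "\<dots> = x" using rec[OF x] by (simp add: linear_combination_def)
    finally show ?thesis .
  qed
  then show thesis using b c by (intro that[of c]) (simp add: dual_basis_def)
qed

lemma projective_lifts_restricted:
  assumes "projective_module RG P" "left_module RK B" "abelian_group C"
  shows "lifts RK P B C"
proof -
  have X: "left_module RG P" using assms(1) unfolding projective_module_def by (rule conjunct1)
  obtain c where "dual_basis RK P (carrier P \<times> UNIV) (\<lambda>(y, j). act P j y) c"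
    using assms(1) by (rule restricted_dual_basis)
  then show ?thesis by (rule lifts_dual_basis[OF restrict_scalars[OF X] assms(2,3)])
qed

end

section \<open>Vanishing at one end\<close>

lemma finite_uniform_bound:
  fixes Q :: "'i \<Rightarrow> int \<Rightarrow> bool"
  assumes "finite I" "\<And>i. i \<in> I \<Longrightarrow> \<exists>N. \<forall>j\<ge>N. Q i j"
  obtains N where "\<And>i j. i \<in> I \<Longrightarrow> j \<ge> N \<Longrightarrow> Q i j"
proof -
  have "eventually (\<lambda>j. \<forall>i\<in>I. Q i j) at_top"
    using assms by (intro eventually_ball_finite) (auto simp: eventually_at_top_linorder)
  then show thesis using that by (auto simp: eventually_at_top_linorder)
qed

lemma (in abelian_group) finsum_telescope:
  assumes F: "\<And>m :: int. F m \<in> carrier G" and "J \<le> j"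
  shows "(\<Oplus>m\<in>{J..<j}. F m \<ominus> F (m + 1)) = F J \<ominus> F j"
  using \<open>J \<le> j\<close>
proof (induct j rule: int_ge_induct)
  case base
  then show ?case using F by (simp add: r_neg minus_eq)
next
  case (step j)
  then have "{J..<j + 1} = insert j {J..<j}" by auto
  then show ?case using F step by (simp add: group_simps Pi_def)
qed

text \<open>The infinite sum of the \<open>s m\<close> over \<open>m \<ge> J\<close>. At each
  \<open>x\<close> it has finitely many nonzero terms, but how many depends on \<open>x\<close>. Any
  late enough cut-off computes it, so two arguments can share one, which gives additivity.\<close>

lemma pointwise_finite_sum_hom:
  fixes s :: "int \<Rightarrow> 'x \<Rightarrow> 'y"
  assumes X: "left_module S X" and V: "left_module S V"
    and s: "\<And>m. s m \<in> module_hom S X V"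
    and fin: "\<And>x. x \<in> carrier X \<Longrightarrow> \<exists>N. \<forall>m\<ge>N. s m x = \<zero>\<^bsub>V\<^esub>"
  obtains T where "T \<in> module_hom S X V"
    "\<And>x N. \<lbrakk>x \<in> carrier X; \<And>m. m \<ge> N \<Longrightarrow> s m x = \<zero>\<^bsub>V\<^esub>\<rbrakk> \<Longrightarrow> T x = (\<Oplus>\<^bsub>V\<^esub>m\<in>{J..<N}. s m x)"
proof -
  interpret X: left_module S X by fact
  interpret V: left_module S V by fact
  note sc = module_homD(1)[OF s]
  define T where "T x = (\<Oplus>\<^bsub>V\<^esub>m\<in>{m \<in> {J..}. s m x \<noteq> \<zero>\<^bsub>V\<^esub>}. s m x)" for x
  have T: "T x = (\<Oplus>\<^bsub>V\<^esub>m\<in>{J..<N}. s m x)"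
    if "x \<in> carrier X" "\<And>m. m \<ge> N \<Longrightarrow> s m x = \<zero>\<^bsub>V\<^esub>" for x N
    unfolding T_def using that sc by (intro V.M.finsum_remove_zeros) (auto, meson not_le)
  have "T \<in> module_hom S X V"
  proof (rule module_homI)
    fix x assume x: "x \<in> carrier X"
    then obtain N where "\<And>m. m \<ge> N \<Longrightarrow> s m x = \<zero>\<^bsub>V\<^esub>" using fin by blast
    then have "T x = (\<Oplus>\<^bsub>V\<^esub>m\<in>{J..<N}. s m x)" by (rule T[OF x])
    then show "T x \<in> carrier V" using sc[OF x] by simp
  next
    fix x y assume x: "x \<in> carrier X" and y: "y \<in> carrier X"
    obtain N M where N: "\<And>m. m \<ge> N \<Longrightarrow> s m x = \<zero>\<^bsub>V\<^esub>" and M: "\<And>m. m \<ge> M \<Longrightarrow> s m y = \<zero>\<^bsub>V\<^esub>"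
      using fin[OF x] fin[OF y] by blast
    have xy: "s m (x \<oplus>\<^bsub>X\<^esub> y) = s m x \<oplus>\<^bsub>V\<^esub> s m y" for m by (rule module_homD(2)[OF s x y])
    have "T (x \<oplus>\<^bsub>X\<^esub> y) = (\<Oplus>\<^bsub>V\<^esub>m\<in>{J..<max N M}. s m x \<oplus>\<^bsub>V\<^esub> s m y)"
      using T[of "x \<oplus>\<^bsub>X\<^esub> y" "max N M"] x y N M by (simp add: xy)
    also have "\<dots> = T x \<oplus>\<^bsub>V\<^esub> T y"
      using sc x y T[OF x, of "max N M"] T[OF y, of "max N M"] N M by (simp add: V.M.finsum_addf)
    finally show "T (x \<oplus>\<^bsub>X\<^esub> y) = T x \<oplus>\<^bsub>V\<^esub> T y" .
  next
    fix a x assume a: "a \<in> carrier S" and x: "x \<in> carrier X"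
    obtain N where N: "\<And>m. m \<ge> N \<Longrightarrow> s m x = \<zero>\<^bsub>V\<^esub>" using fin[OF x] by blast
    have ax: "s m (a \<odot>\<^bsub>X\<^esub> x) = a \<odot>\<^bsub>V\<^esub> s m x" for m by (rule module_homD(3)[OF s a x])
    show "T (a \<odot>\<^bsub>X\<^esub> x) = a \<odot>\<^bsub>V\<^esub> T x"
      using T[of "a \<odot>\<^bsub>X\<^esub> x" N] T[OF x, of N] N a x sc
      by (simp add: ax X.smult_closed V.smult_r_null V.finsum_smult_rdistr)
  qed
  then show thesis using T by (rule that)
qed

context cyclic_quotient
begin

text \<open>Normality of \<open>K\<close> once more, with the power of \<open>t\<close> starting on
  the left. The new element depends on \<open>j\<close>, which is harmless where only the vanishing
  of a multiple matters.\<close>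

lemma act_monomial:
  fixes j :: int
  assumes X: "left_module RG X" and x: "x \<in> carrier X" and k: "k \<in> carrier K" and r: "r \<in> carrier R"
  obtains k' where "k' \<in> carrier K" "act X j (monomial R k r \<odot>\<^bsub>X\<^esub> x) = monomial R k' r \<odot>\<^bsub>X\<^esub> act X j x"
proof
  let ?k = "t [^]\<^bsub>G\<^esub> j \<otimes>\<^bsub>G\<^esub> k \<otimes>\<^bsub>G\<^esub> t [^]\<^bsub>G\<^esub> (- j)"
  note XK = restrict_scalars[OF X]
  have ax: "act X j x \<in> carrier X" by (rule act_closed[OF X x])
  have eq: "monomial R k r \<odot>\<^bsub>X\<^esub> act X (- j) (act X j x) = act X (- j) (monomial R ?k r \<odot>\<^bsub>X\<^esub> act X j x)"
    using monomial_act(2)[OF X ax k r, of "- j"] by simp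
  show k': "?k \<in> carrier K" using monomial_act(1)[OF X ax k r, of "- j"] by simp
  have m: "monomial R ?k r \<odot>\<^bsub>X\<^esub> act X j x \<in> carrier X"
    by (rule left_module.smult_closed[OF XK monomial_K[OF k' r] ax])
  have "act X j (monomial R k r \<odot>\<^bsub>X\<^esub> x) = act X j (act X (- j) (monomial R ?k r \<odot>\<^bsub>X\<^esub> act X j x))"
    unfolding eq[symmetric] using x by (simp add: act_act[OF X] act_0[OF X])
  also have "\<dots> = monomial R ?k r \<odot>\<^bsub>X\<^esub> act X j x"
    using m by (simp add: act_act[OF X] act_0[OF X])
  finally show "act X j (monomial R k r \<odot>\<^bsub>X\<^esub> x) = monomial R ?k r \<odot>\<^bsub>X\<^esub> act X j x" .
qed

lemma conjugate_act:
  assumes X: "left_module RG X" and Y: "left_module RG Y" and f: "f \<in> module_hom RK X Y" and x: "x \<in> carrier X"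
  shows "conjugate X Y m f (act X j x) = act Y j (conjugate X Y (m - j) f x)"
  using x act_closed[OF X x] module_homD(1)[OF f]
  by (simp add: conjugate_def act_act[OF X] act_act[OF Y] act_closed[OF X])

text \<open>The bound in \<open>vanishes_up\<close> depends on the point. The elements of
  \<open>F\<close> for which a given bound works form an \<open>RK\<close>-submodule, because
  \<open>t\<close> normalises \<open>K\<close>, so a common bound for finitely many generators works
  everywhere. This is where finite generation enters.\<close>

lemma finitely_generated_vanishing:
  assumes F: "left_module RK F" "finitely_generated_module RK F"
    and Z: "left_module RG Z" and V: "left_module RK V"
    and f: "f \<in> module_hom RK Z V" "vanishes_up Z \<zero>\<^bsub>V\<^esub> f"
    and w: "w \<in> module_hom RK F Z"
  obtains J where "\<And>m x. m \<ge> J \<Longrightarrow> x \<in> carrier F \<Longrightarrow> f (act Z m (w x)) = \<zero>\<^bsub>V\<^esub>"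
proof -
  interpret F: left_module RK F by fact
  interpret Z: left_module RK Z by (rule restrict_scalars[OF Z])
  interpret V: left_module RK V by fact
  note wc = module_homD(1)[OF w]
  from F(2) obtain B where B: "finite B" "B \<subseteq> carrier F"
    and gen: "\<And>N. submodule N RK F \<Longrightarrow> B \<subseteq> N \<Longrightarrow> N = carrier F"
    by (auto simp: finitely_generated_module_def)
  have "\<exists>N. \<forall>j\<ge>N. f (act Z j (w b)) = \<zero>\<^bsub>V\<^esub>" if "b \<in> B" for b
    using f(2) wc B(2) that by (auto simp: vanishes_up_def)
  from finite_uniform_bound[where Q = "\<lambda>b j. f (act Z j (w b)) = \<zero>\<^bsub>V\<^esub>", OF B(1) this] obtain J
    where J: "\<And>b j. b \<in> B \<Longrightarrow> j \<ge> J \<Longrightarrow> f (act Z j (w b)) = \<zero>\<^bsub>V\<^esub>" by metis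
  define N where "N = {x \<in> carrier F. \<forall>m\<ge>J. f (act Z m (w x)) = \<zero>\<^bsub>V\<^esub>}"
  have add: "f (act Z m (w (x \<oplus>\<^bsub>F\<^esub> y))) = f (act Z m (w x)) \<oplus>\<^bsub>V\<^esub> f (act Z m (w y))"
    if "x \<in> carrier F" "y \<in> carrier F" for x y m
    using that wc by (simp add: module_homD(2)[OF w] module_homD(2)[OF f(1)] act_add[OF Z] act_closed[OF Z])
  have cl: "f (act Z m (w x)) \<in> carrier V" if "x \<in> carrier F" for x m
    by (intro module_homD(1)[OF f(1)] act_closed[OF Z] wc that)
  have zero: "f (act Z m (w \<zero>\<^bsub>F\<^esub>)) = \<zero>\<^bsub>V\<^esub>" for m
    using module_hom_apply_zero[OF w F.M.abelian_group_axioms Z.M.abelian_group_axioms]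
      module_hom_apply_zero[OF f(1) Z.M.abelian_group_axioms V.M.abelian_group_axioms] act_zero[OF Z] by simp
  have "subgroup N (add_monoid F)"
  proof (rule group.subgroupI[OF F.M.a_group])
    show "N \<noteq> {}" using zero by (auto simp: N_def intro!: exI[of _ "\<zero>\<^bsub>F\<^esub>"])
    fix x assume x: "x \<in> N"
    then have xF: "x \<in> carrier F" by (simp add: N_def)
    have "f (act Z m (w (\<ominus>\<^bsub>F\<^esub> x))) = \<zero>\<^bsub>V\<^esub>" if "m \<ge> J" for m
    proof -
      have fx: "f (act Z m (w x)) = \<zero>\<^bsub>V\<^esub>" using x that by (simp add: N_def)
      have nx: "\<ominus>\<^bsub>F\<^esub> x \<in> carrier F" using xF by simp
      have "f (act Z m (w (\<ominus>\<^bsub>F\<^esub> x))) \<oplus>\<^bsub>V\<^esub> \<zero>\<^bsub>V\<^esub> = \<zero>\<^bsub>V\<^esub>"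
        using add[OF nx xF, of m] zero[of m] unfolding fx F.M.l_neg[OF xF] by simp
      then show ?thesis using cl[OF nx, of m] by simp
    qed
    then show "inv\<^bsub>add_monoid F\<^esub> x \<in> N" using xF by (simp add: N_def a_inv_def[symmetric])
    fix y assume "y \<in> N"
    then show "x \<otimes>\<^bsub>add_monoid F\<^esub> y \<in> N" using x add by (simp add: N_def)
  qed (auto simp: N_def)
  then have "submodule N RK F"
  proof (rule K.submodule_monomialI[OF F(1)])
    fix k r x assume k: "k \<in> carrier K" and r: "r \<in> carrier R" and x: "x \<in> N"
    then have xF: "x \<in> carrier F" by (simp add: N_def)
    have "f (act Z m (w (monomial R k r \<odot>\<^bsub>F\<^esub> x))) = \<zero>\<^bsub>V\<^esub>" if m: "m \<ge> J" for m
    proof -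
      obtain k' where k': "k' \<in> carrier K"
        "act Z m (monomial R k r \<odot>\<^bsub>Z\<^esub> w x) = monomial R k' r \<odot>\<^bsub>Z\<^esub> act Z m (w x)"
        using act_monomial[OF Z wc[OF xF] k r, of m] by blast
      have "f (act Z m (w (monomial R k r \<odot>\<^bsub>F\<^esub> x))) = monomial R k' r \<odot>\<^bsub>V\<^esub> f (act Z m (w x))"
        using k' module_homD(3)[OF w monomial_K[OF k r] xF]
          module_homD(3)[OF f(1) monomial_K[OF k'(1) r] act_closed[OF Z wc[OF xF]]] by simp
      then show ?thesis using x m V.smult_r_null[OF monomial_K[OF k'(1) r]] by (simp add: N_def)
    qed
    then show "monomial R k r \<odot>\<^bsub>F\<^esub> x \<in> N"
      using F.smult_closed[OF monomial_K[OF k r] xF] by (simp add: N_def)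
  qed
  moreover have "B \<subseteq> N" using B(2) J by (auto simp: N_def)
  ultimately have "N = carrier F" by (rule gen)
  then have "\<And>m x. m \<ge> J \<Longrightarrow> x \<in> carrier F \<Longrightarrow> f (act Z m (w x)) = \<zero>\<^bsub>V\<^esub>" by (auto simp: N_def)
  then show thesis by (rule that)
qed

text \<open>Write \<open>\<eta>\<^sub>m\<close> and \<open>\<zeta>\<^sub>m\<close> for the conjugates of \<open>h1\<close> and \<open>h0\<close> by \<open>t\<^sup>m\<close>. For \<open>m \<ge> J\<close> the map
  \<open>f \<circ> \<eta>\<^sub>m\<close> is a primitive of \<open>f\<close>, and \<open>f \<circ> \<eta>\<^sub>m - f \<circ> \<eta>\<^bsub>m+1\<^esub>\<close> is the coboundary of its composite with
  \<open>\<zeta>\<^bsub>m+1\<^esub>\<close>. Subtracting from \<open>f \<circ> \<eta>\<^sub>J\<close> only the part of these coboundaries that is cut out by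
  \<open>q\<close> makes the sum over \<open>m \<ge> J\<close> pointwise finite, and telescoping shows that the result
  vanishes in the positive direction.\<close>

lemma primitive_vanishing_up:
  fixes Y :: "('g \<Rightarrow> 'r, 'y, 'w) module_scheme"
  assumes X: "left_module RG X" and Y: "left_module RG Y" and Z: "left_module RG Z" and W: "left_module RG W"
    and d1: "d1 \<in> module_hom RG Y X" and d2: "d2 \<in> module_hom RG Z Y" and d3: "d3 \<in> module_hom RG W Z"
    and dd: "\<And>z. z \<in> carrier Z \<Longrightarrow> d1 (d2 z) = \<zero>\<^bsub>X\<^esub>"
    and h0: "h0 \<in> module_hom RK X Y" and h1: "h1 \<in> module_hom RK Y Z" and h2: "h2 \<in> module_hom RK Z W"
    and pi1: "\<pi>1 \<in> module_hom RK Y Y" and pi2: "\<pi>2 \<in> module_hom RK Z Z"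
    and id1: "\<And>y. y \<in> carrier Y \<Longrightarrow> y = \<pi>1 y \<oplus>\<^bsub>Y\<^esub> d2 (h1 y) \<oplus>\<^bsub>Y\<^esub> h0 (d1 y)"
    and id2: "\<And>z. z \<in> carrier Z \<Longrightarrow> z = \<pi>2 z \<oplus>\<^bsub>Z\<^esub> d3 (h2 z) \<oplus>\<^bsub>Z\<^esub> h1 (d2 z)"
    and p: "p \<in> module_hom RK X X" "vanishes_up X \<zero>\<^bsub>X\<^esub> p"
    and q: "q \<in> module_hom RK X X" "vanishes_down X \<zero>\<^bsub>X\<^esub> q"
    and pq: "\<And>x. x \<in> carrier X \<Longrightarrow> p x \<oplus>\<^bsub>X\<^esub> q x = x"
    and V: "left_module RK V"
    and f: "f \<in> module_hom RK Z V" "vanishes_up Z \<zero>\<^bsub>V\<^esub> f"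
    and fd: "\<And>w. w \<in> carrier W \<Longrightarrow> f (d3 w) = \<zero>\<^bsub>V\<^esub>"
    and J1: "\<And>m y. m \<ge> J \<Longrightarrow> y \<in> carrier Y \<Longrightarrow>
      f (act Z m (conjugate Y Z (- 1) h1 (\<pi>1 y) \<ominus>\<^bsub>Z\<^esub> h1 (\<pi>1 y))) = \<zero>\<^bsub>V\<^esub>"
    and J2: "\<And>m z. m \<ge> J \<Longrightarrow> z \<in> carrier Z \<Longrightarrow> f (act Z m (\<pi>2 z)) = \<zero>\<^bsub>V\<^esub>"
  obtains a where "a \<in> module_hom RK Y V" "vanishes_up Y \<zero>\<^bsub>V\<^esub> a" "\<And>z. z \<in> carrier Z \<Longrightarrow> a (d2 z) = f z"
proof -
  interpret X: left_module RG X by fact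
  interpret Y: left_module RG Y by fact
  interpret Z: left_module RG Z by fact
  interpret V: left_module RK V by fact
  interpret XK: left_module RK X by (rule restrict_scalars[OF X])
  interpret f: abelian_group_hom Z V f
    by (rule module_hom_abelian_group_hom[OF f(1)]) unfold_locales
  define \<eta> where "\<eta> m = conjugate Y Z m h1" for m
  define \<zeta> where "\<zeta> m = conjugate X Y m h0" for m
  define P where "P m = conjugate X X m p" for m
  define Q where "Q m = conjugate X X m q" for m
  define g where "g m y = f (\<eta> m y) \<ominus>\<^bsub>V\<^esub> f (\<eta> (m + 1) y)" for m y
  define s where "s m x = g m (\<zeta> (m + 1) (Q (m + 1) x))" for m x
  have \<eta>: "\<eta> m \<in> module_hom RK Y Z" for m unfolding \<eta>_def by (rule conjugate_hom[OF Y Z h1])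
  have \<zeta>: "\<zeta> m \<in> module_hom RK X Y" for m unfolding \<zeta>_def by (rule conjugate_hom[OF X Y h0])
  have P: "P m \<in> module_hom RK X X" for m unfolding P_def by (rule conjugate_hom[OF X X p(1)])
  have Q: "Q m \<in> module_hom RK X X" for m unfolding Q_def by (rule conjugate_hom[OF X X q(1)])
  have g: "g m \<in> module_hom RK Y V" for m
    unfolding g_def by (intro module_hom_diff[OF V] module_hom_compose[OF \<eta> f(1)])
  have s: "s m \<in> module_hom RK X V" for m
    unfolding s_def by (rule module_hom_compose[OF module_hom_compose[OF Q \<zeta>] g])
  note cl[simp] = module_homD(1)[OF \<eta>] module_homD(1)[OF \<zeta>] module_homD(1)[OF P] module_homD(1)[OF Q]
    module_homD(1)[OF g] module_homD(1)[OF s] module_homD(1)[OF d1] module_homD(1)[OF d2]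
    module_homD(1)[OF d3] module_homD(1)[OF h0] module_homD(1)[OF h1] module_homD(1)[OF h2]
    module_homD(1)[OF pi1] module_homD(1)[OF pi2] module_homD(1)[OF f(1)]
    act_closed[OF X] act_closed[OF Y] act_closed[OF Z] act_closed[OF W] module_homD(1)[OF p(1)] module_homD(1)[OF q(1)]
  have g0: "g m \<zero>\<^bsub>Y\<^esub> = \<zero>\<^bsub>V\<^esub>" for m
    by (rule module_hom_apply_zero[OF g Y.M.abelian_group_axioms V.M.abelian_group_axioms])
  have \<zeta>0: "\<zeta> m \<zero>\<^bsub>X\<^esub> = \<zero>\<^bsub>Y\<^esub>" for m
    by (rule module_hom_apply_zero[OF \<zeta> X.M.abelian_group_axioms Y.M.abelian_group_axioms])
  have \<eta>0: "\<eta> m \<zero>\<^bsub>Y\<^esub> = \<zero>\<^bsub>Z\<^esub>" for m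
    by (rule module_hom_apply_zero[OF \<eta> Y.M.abelian_group_axioms Z.M.abelian_group_axioms])

  \<comment> \<open>The homotopy identity is applied at \<open>t^(-m) z\<close> and carried back by
    \<open>t^m\<close>. The term with \<open>\<pi>2\<close> dies by the uniform bound, the term with
    \<open>d3\<close> because \<open>f\<close> is a cocycle.\<close>
  have prim: "f (\<eta> m (d2 z)) = f z" if m: "m \<ge> J" and z: "z \<in> carrier Z" for m z
  proof -
    let ?z = "act Z (- m) z"
    have "f z = f (act Z m ?z)" using z by (simp add: act_act[OF Z] act_0[OF Z])
    also have "\<dots> = f (act Z m (\<pi>2 ?z \<oplus>\<^bsub>Z\<^esub> d3 (h2 ?z) \<oplus>\<^bsub>Z\<^esub> h1 (d2 ?z)))"
      using id2[of ?z] z by simp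
    also have "\<dots> = f (act Z m (\<pi>2 ?z)) \<oplus>\<^bsub>V\<^esub> f (d3 (act W m (h2 ?z))) \<oplus>\<^bsub>V\<^esub> f (act Z m (h1 (d2 ?z)))"
      using z by (simp add: act_add[OF Z] hom_act[OF d3])
    also have "\<dots> = f (act Z m (h1 (act Y (- m) (d2 z))))"
      using z by (simp add: J2[OF m] fd hom_act[OF d2])
    finally show ?thesis by (simp add: \<eta>_def conjugate_def)
  qed
  have g_d2: "g m (d2 z) = \<zero>\<^bsub>V\<^esub>" if "m \<ge> J" "z \<in> carrier Z" for m z
    using that by (simp add: g_def prim V.M.r_neg V.M.minus_eq)
  \<comment> \<open>Translation by \<open>t^(m + 1)\<close> turns the indices \<open>m\<close> and
    \<open>m + 1\<close> into \<open>- 1\<close> and \<open>0\<close>, whatever \<open>m\<close> is.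
    That is why the hypothesis speaks of the conjugate with index \<open>- 1\<close>, and why one
    bound serves all \<open>m\<close>.\<close>
  have g_pi: "g m (act Y (m + 1) (\<pi>1 y)) = \<zero>\<^bsub>V\<^esub>" if m: "m \<ge> J" and y: "y \<in> carrier Y" for m y
  proof -
    have "\<eta> m (act Y (m + 1) (\<pi>1 y)) = act Z (m + 1) (\<eta> (- 1) (\<pi>1 y))"
      using y by (simp add: \<eta>_def conjugate_act[OF Y Z h1])
    moreover have "\<eta> (m + 1) (act Y (m + 1) (\<pi>1 y)) = act Z (m + 1) (h1 (\<pi>1 y))"
      using y by (simp add: \<eta>_def conjugate_def act_act[OF Y] act_0[OF Y])
    ultimately have "g m (act Y (m + 1) (\<pi>1 y)) = f (act Z (m + 1) (\<eta> (- 1) (\<pi>1 y) \<ominus>\<^bsub>Z\<^esub> h1 (\<pi>1 y)))"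
      using y by (simp add: g_def act_diff[OF Z] f.hom_minus)
    then show ?thesis using J1[of "m + 1" y] m y by (simp add: \<eta>_def)
  qed
  \<comment> \<open>Of the expansion of \<open>t^(-(m + 1)) y\<close> by the homotopy identity only
    the last term survives: after translation, \<open>g m\<close> kills the first by the previous
    fact and the second because it vanishes on the image of \<open>d2\<close>.\<close>
  have g_eq: "g m y = g m (\<zeta> (m + 1) (d1 y))" if m: "m \<ge> J" and y: "y \<in> carrier Y" for m y
  proof -
    let ?y = "act Y (- (m + 1)) y"
    have yc: "?y \<in> carrier Y" using y by simp
    have "y = act Y (m + 1) ?y" using y by (simp only: act_act[OF Y] act_0[OF Y]) (simp add: act_0[OF Y])
    also have "\<dots> = act Y (m + 1) (\<pi>1 ?y \<oplus>\<^bsub>Y\<^esub> d2 (h1 ?y) \<oplus>\<^bsub>Y\<^esub> h0 (d1 ?y))"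
      using id1[OF yc] by simp
    also have "\<dots> = act Y (m + 1) (\<pi>1 ?y) \<oplus>\<^bsub>Y\<^esub> d2 (act Z (m + 1) (h1 ?y)) \<oplus>\<^bsub>Y\<^esub> act Y (m + 1) (h0 (d1 ?y))"
      using yc by (simp del: minus_add_distrib add: act_add[OF Y] hom_act[OF d2])
    also have "act Y (m + 1) (h0 (d1 ?y)) = \<zeta> (m + 1) (d1 y)"
      using y by (simp del: minus_add_distrib add: \<zeta>_def conjugate_def hom_act[OF d1])
    finally have "g m y = g m (act Y (m + 1) (\<pi>1 ?y)) \<oplus>\<^bsub>V\<^esub> g m (d2 (act Z (m + 1) (h1 ?y))) \<oplus>\<^bsub>V\<^esub> g m (\<zeta> (m + 1) (d1 y))"
      using yc y by (metis (no_types, lifting) cl module_homD(2)[OF g] Y.M.a_closed)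
    then show ?thesis using g_pi[OF m yc] g_d2[OF m] yc y by simp
  qed

  have fin: "\<exists>N. \<forall>m\<ge>N. s m x = \<zero>\<^bsub>V\<^esub>" if x: "x \<in> carrier X" for x
  proof -
    obtain N where N: "\<And>j. j \<ge> N \<Longrightarrow> q (act X (- j) x) = \<zero>\<^bsub>X\<^esub>"
      using q(2) x by (auto simp: vanishes_down_def)
    have "s m x = \<zero>\<^bsub>V\<^esub>" if "m \<ge> N" for m
      using N[of "m + 1"] that by (simp add: s_def Q_def conjugate_def act_zero[OF X] \<zeta>0 g0)
    then show ?thesis by blast
  qed
  obtain T where T: "T \<in> module_hom RK X V" and
    T_sum: "\<And>x N. \<lbrakk>x \<in> carrier X; \<And>m. m \<ge> N \<Longrightarrow> s m x = \<zero>\<^bsub>V\<^esub>\<rbrakk> \<Longrightarrow> T x = (\<Oplus>\<^bsub>V\<^esub>m\<in>{J..<N}. s m x)"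
    using pointwise_finite_sum_hom[OF XK.left_module_axioms V s fin, of J] by metis
  define a where "a y = f (\<eta> J y) \<ominus>\<^bsub>V\<^esub> T (d1 y)" for y
  show thesis
  proof (rule that)
    show "a \<in> module_hom RK Y V"
      unfolding a_def
      by (intro module_hom_diff[OF V] module_hom_compose[OF \<eta> f(1)]
          module_hom_compose[OF module_hom_restrict_scalars[OF d1] T])
    have T0: "T \<zero>\<^bsub>X\<^esub> = \<zero>\<^bsub>V\<^esub>"
      by (rule module_hom_apply_zero[OF T X.M.abelian_group_axioms V.M.abelian_group_axioms])
    show "a (d2 z) = f z" if "z \<in> carrier Z" for z
      using that by (simp add: a_def prim dd T0 V.M.minus_eq)
    show "vanishes_up Y \<zero>\<^bsub>V\<^esub> a"
      unfolding vanishes_up_def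
    proof
      fix y assume y: "y \<in> carrier Y"
      let ?z = "d1 y"
      have z: "?z \<in> carrier X" using y by simp
      have g_act: "g m (act Y j y') = f (act Z j (\<eta> (m - j) y')) \<ominus>\<^bsub>V\<^esub> f (act Z j (\<eta> (m + 1 - j) y'))"
        if "y' \<in> carrier Y" for m j y'
        using that by (simp add: g_def \<eta>_def conjugate_act[OF Y Z h1])
      \<comment> \<open>At \<open>t^j\<close> times a point, every conjugate with index
        \<open>m\<close> acts like the one with index \<open>m - j\<close> at that point. So the
        expression depends on \<open>m - j\<close> alone, up to a translation by \<open>t^j\<close>
        under which \<open>f\<close> eventually vanishes.\<close>
      have shift: "g m (\<zeta> (m + 1) (conjugate X X (m + 1) r (act X j ?z))) =
          f (act Z j (\<eta> (m - j) (\<zeta> (m - j + 1) (conjugate X X (m - j + 1) r ?z)))) \<ominus>\<^bsub>V\<^esub>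
          f (act Z j (\<eta> (m - j + 1) (\<zeta> (m - j + 1) (conjugate X X (m - j + 1) r ?z))))"
        if r: "r \<in> module_hom RK X X" for r m j
      proof -
        have c: "conjugate X X i r ?z \<in> carrier X" for i
          by (rule module_homD(1)[OF conjugate_hom[OF X X r] z])
        have e: "m - j + 1 = m + 1 - j" by simp
        show ?thesis
          unfolding e using c z by (simp add: conjugate_act[OF X X r] \<zeta>_def conjugate_act[OF X Y h0] g_act
              module_homD(1)[OF conjugate_hom[OF X Y h0]])
      qed
      have up: "\<exists>N. \<forall>j\<ge>N. f (act Z j z') = \<zero>\<^bsub>V\<^esub>" if "z' \<in> carrier Z" for z'
        using f(2) that by (auto simp: vanishes_up_def)
      have small: "\<exists>N. \<forall>j\<ge>N. \<forall>i\<in>I. f (act Z j (\<eta> i (x i))) \<ominus>\<^bsub>V\<^esub> f (act Z j (\<eta> (i + 1) (x i))) = \<zero>\<^bsub>V\<^esub>"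
        if "finite I" "\<And>i. x i \<in> carrier Y" for I and x :: "int \<Rightarrow> 'y"
      proof -
        have "\<exists>N. \<forall>j\<ge>N. f (act Z j (\<eta> i (x i))) \<ominus>\<^bsub>V\<^esub> f (act Z j (\<eta> (i + 1) (x i))) = \<zero>\<^bsub>V\<^esub>" for i
        proof -
          have "\<exists>N. \<forall>j\<ge>N. f (act Z j (\<eta> i (x i))) = \<zero>\<^bsub>V\<^esub>"
            "\<exists>N. \<forall>j\<ge>N. f (act Z j (\<eta> (i + 1) (x i))) = \<zero>\<^bsub>V\<^esub>"
            by (rule up, simp add: that(2))+
          then obtain N M where "\<forall>j\<ge>N. f (act Z j (\<eta> i (x i))) = \<zero>\<^bsub>V\<^esub>"
            "\<forall>j\<ge>M. f (act Z j (\<eta> (i + 1) (x i))) = \<zero>\<^bsub>V\<^esub>"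
            by (elim exE)
          then show ?thesis by (intro exI[of _ "max N M"]) (simp add: V.M.minus_eq)
        qed
        then show ?thesis
          by (rule_tac finite_uniform_bound[OF that(1), where Q = "\<lambda>i j. f (act Z j (\<eta> i (x i))) \<ominus>\<^bsub>V\<^esub>
              f (act Z j (\<eta> (i + 1) (x i))) = \<zero>\<^bsub>V\<^esub>"]) blast+
      qed
      obtain Nq where Nq: "\<And>j. j \<ge> Nq \<Longrightarrow> q (act X (- j) ?z) = \<zero>\<^bsub>X\<^esub>"
        using q(2) z by (auto simp: vanishes_down_def)
      obtain Np where Np: "\<And>j. j \<ge> Np \<Longrightarrow> p (act X j ?z) = \<zero>\<^bsub>X\<^esub>"
        using p(2) z by (auto simp: vanishes_up_def)
      have Q0: "Q i ?z = \<zero>\<^bsub>X\<^esub>" if "i \<ge> Nq" for i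
        using Nq[OF that] by (simp add: Q_def conjugate_def act_zero[OF X])
      have P0: "P i ?z = \<zero>\<^bsub>X\<^esub>" if "- i \<ge> Np" for i
        using Np[OF that] by (simp add: P_def conjugate_def act_zero[OF X])
      \<comment> \<open>Beyond \<open>Nq\<close> the term with \<open>Q\<close> is zero, and below
        \<open>- Np - 1\<close> the term with \<open>P\<close> is. Finitely many differences
        \<open>i = m - j\<close> remain on each side, which gives bounds \<open>N1\<close> and
        \<open>N2\<close> independent of \<open>m\<close>.\<close>
      have "\<exists>N. \<forall>j\<ge>N. \<forall>i\<in>{0..Nq}.
          f (act Z j (\<eta> i (\<zeta> (i + 1) (Q (i + 1) ?z)))) \<ominus>\<^bsub>V\<^esub>
          f (act Z j (\<eta> (i + 1) (\<zeta> (i + 1) (Q (i + 1) ?z)))) = \<zero>\<^bsub>V\<^esub>"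
        by (rule small) (simp_all add: z)
      then obtain N1 where N1: "\<forall>j\<ge>N1. \<forall>i\<in>{0..Nq}.
          f (act Z j (\<eta> i (\<zeta> (i + 1) (Q (i + 1) ?z)))) \<ominus>\<^bsub>V\<^esub>
          f (act Z j (\<eta> (i + 1) (\<zeta> (i + 1) (Q (i + 1) ?z)))) = \<zero>\<^bsub>V\<^esub>"
        by (elim exE)
      have "\<exists>N. \<forall>j\<ge>N. \<forall>i\<in>{- Np - 1..0}.
          f (act Z j (\<eta> i (\<zeta> (i + 1) (P (i + 1) ?z)))) \<ominus>\<^bsub>V\<^esub>
          f (act Z j (\<eta> (i + 1) (\<zeta> (i + 1) (P (i + 1) ?z)))) = \<zero>\<^bsub>V\<^esub>"
        by (rule small) (simp_all add: z)
      then obtain N2 where N2: "\<forall>j\<ge>N2. \<forall>i\<in>{- Np - 1..0}.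
          f (act Z j (\<eta> i (\<zeta> (i + 1) (P (i + 1) ?z)))) \<ominus>\<^bsub>V\<^esub>
          f (act Z j (\<eta> (i + 1) (\<zeta> (i + 1) (P (i + 1) ?z)))) = \<zero>\<^bsub>V\<^esub>"
        by (elim exE)
      obtain N3 where N3: "\<And>j. j \<ge> N3 \<Longrightarrow> f (act Z j (h1 y)) = \<zero>\<^bsub>V\<^esub>"
        using up[OF module_homD(1)[OF h1 y]] by auto
      have f0: "f (act Z j (\<eta> i \<zero>\<^bsub>Y\<^esub>)) = \<zero>\<^bsub>V\<^esub>" for i j
        by (simp add: \<eta>0 act_zero[OF Z])
      \<comment> \<open>At \<open>t^j y\<close> the summands of \<open>T\<close> with
        \<open>m \<ge> j\<close> vanish, while for \<open>m < j\<close> the part cut out by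
        \<open>p\<close> vanishes, so the summand is all of \<open>g m\<close>. The sum telescopes
        from index \<open>J\<close> to index \<open>j\<close> and cancels the first term of
        \<open>a\<close>; what is left is \<open>f\<close> at \<open>t^j (h1 y)\<close>.\<close>
      have "a (act Y j y) = \<zero>\<^bsub>V\<^esub>" if j: "j \<ge> max J (max N1 (max N2 N3))" for j
      proof -
        let ?y = "act Y j y" and ?x = "act X j ?z"
        have x: "?x \<in> carrier X" using z by simp
        have dx: "d1 ?y = ?x" by (rule hom_act[OF d1 y])
        have hi: "s m ?x = \<zero>\<^bsub>V\<^esub>" if m: "m \<ge> j" for m
        proof (cases "m - j \<le> Nq")
          case True
          then show ?thesis
            using N1[rule_format, of j "m - j"] shift[OF q(1), of m j] m j by (simp add: s_def Q_def)
        next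
          case False
          then have "Q (m - j + 1) ?z = \<zero>\<^bsub>X\<^esub>" by (intro Q0) simp
          then show ?thesis
            using shift[OF q(1), of m j] by (simp add: s_def Q_def \<zeta>0 f0 V.M.minus_eq)
        qed
        have lo: "g m (\<zeta> (m + 1) (P (m + 1) ?x)) = \<zero>\<^bsub>V\<^esub>" if m: "m < j" for m
        proof (cases "m - j \<ge> - Np - 1")
          case True
          then show ?thesis
            using N2[rule_format, of j "m - j"] shift[OF p(1), of m j] m j by (simp add: P_def)
        next
          case False
          then have "P (m - j + 1) ?z = \<zero>\<^bsub>X\<^esub>" by (intro P0) simp
          then show ?thesis
            using shift[OF p(1), of m j] by (simp add: P_def \<zeta>0 f0 V.M.minus_eq)
        qed
        have mid: "s m ?x = g m ?y" if m: "m \<in> {J..<j}" for m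
        proof -
          have "P (m + 1) ?x \<oplus>\<^bsub>X\<^esub> Q (m + 1) ?x = ?x"
            using x pq by (simp only: P_def Q_def conjugate_def)
              (simp del: minus_add_distrib add: act_add[OF X, symmetric] act_act[OF X] act_0[OF X])
          then have "g m (\<zeta> (m + 1) ?x) = g m (\<zeta> (m + 1) (P (m + 1) ?x)) \<oplus>\<^bsub>V\<^esub> s m ?x"
            using x module_homD(2)[OF g, of "\<zeta> (m + 1) (P (m + 1) ?x)" "\<zeta> (m + 1) (Q (m + 1) ?x)" m]
              module_homD(2)[OF \<zeta>, of "P (m + 1) ?x" "Q (m + 1) ?x" "m + 1"]
            by (simp add: s_def)
          then show ?thesis using g_eq[of m ?y] lo[of m] m y x dx by simp
        qed
        have "T ?x = (\<Oplus>\<^bsub>V\<^esub>m\<in>{J..<j}. s m ?x)" by (rule T_sum[OF x hi])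
        also have "\<dots> = (\<Oplus>\<^bsub>V\<^esub>m\<in>{J..<j}. f (\<eta> m ?y) \<ominus>\<^bsub>V\<^esub> f (\<eta> (m + 1) ?y))"
          using mid y by (intro V.M.finsum_cong') (auto simp: g_def)
        also have "\<dots> = f (\<eta> J ?y) \<ominus>\<^bsub>V\<^esub> f (\<eta> j ?y)"
          using y j by (intro V.M.finsum_telescope) auto
        also have "f (\<eta> j ?y) = f (act Z j (h1 y))"
          using y by (simp add: \<eta>_def conjugate_def act_act[OF Y] act_0[OF Y])
        also have "\<dots> = \<zero>\<^bsub>V\<^esub>" using N3 j by simp
        finally show ?thesis using y by (simp add: a_def dx V.M.group_simps)
      qed
      then show "\<exists>N. \<forall>j\<ge>N. a (act Y j y) = \<zero>\<^bsub>V\<^esub>" by blast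
    qed
  qed
qed

end

section \<open>The connecting map\<close>

context cyclic_quotient
begin

abbreviation V where "V \<equiv> regular_module RK"

lemma V: "left_module RK V"
  by (rule K.A.regular_left_module)

text \<open>\<open>RG\<close>-linear maps commute with \<open>t\<close>. Maps that are merely
  \<open>RK\<close>-linear need not, which is why \<open>C\<^sub>+\<close> and
  \<open>C\<^sub>-\<close> are stable under the differential of \<open>P\<close> but not necessarily
  under the homotopies.\<close>

lemma vanishes_up_compose_RG:
  assumes "vanishes_up Y z f" "d \<in> module_hom RG X Y"
  shows "vanishes_up X z (\<lambda>x. f (d x))"
  using assms(1) module_homD(1)[OF assms(2)] unfolding vanishes_up_def by (simp add: hom_act[OF assms(2)])

lemma vanishes_down_compose_RG:
  assumes "vanishes_down Y z f" "d \<in> module_hom RG X Y"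
  shows "vanishes_down X z (\<lambda>x. f (d x))"
  using assms(1) module_homD(1)[OF assms(2)] unfolding vanishes_down_def by (simp add: hom_act[OF assms(2)])

lemma vanishes_up_apply: "vanishes_up X z f \<Longrightarrow> g z = z' \<Longrightarrow> vanishes_up X z' (\<lambda>x. g (f x))"
  unfolding vanishes_up_def by metis

lemma vanishes_down_apply: "vanishes_down X z f \<Longrightarrow> g z = z' \<Longrightarrow> vanishes_down X z' (\<lambda>x. g (f x))"
  unfolding vanishes_down_def by metis

lemma vanishes_up_combine:
  assumes "vanishes_up X z f" "vanishes_up X z' f'" "op z z' = z''"
  shows "vanishes_up X z'' (\<lambda>x. op (f x) (f' x))"
  unfolding vanishes_up_def
proof
  fix x assume x: "x \<in> carrier X"
  obtain N M where "\<forall>j\<ge>N. f (act X j x) = z" "\<forall>j\<ge>M. f' (act X j x) = z'"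
    using assms(1,2) x unfolding vanishes_up_def by blast
  then show "\<exists>N. \<forall>j\<ge>N. op (f (act X j x)) (f' (act X j x)) = z''"
    using assms(3) by (intro exI[of _ "max N M"]) simp
qed

lemma vanishes_down_combine:
  assumes "vanishes_down X z f" "vanishes_down X z' f'" "op z z' = z''"
  shows "vanishes_down X z'' (\<lambda>x. op (f x) (f' x))"
  unfolding vanishes_down_def
proof
  fix x assume x: "x \<in> carrier X"
  obtain N M where "\<forall>j\<ge>N. f (act X (- j) x) = z" "\<forall>j\<ge>M. f' (act X (- j) x) = z'"
    using assms(1,2) x unfolding vanishes_down_def by blast
  then show "\<exists>N. \<forall>j\<ge>N. op (f (act X (- j) x)) (f' (act X (- j) x)) = z''"
    using assms(3) by (intro exI[of _ "max N M"]) simp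
qed

lemma vanishes_up_cong:
  assumes "left_module RG X" "vanishes_up X z f" "\<And>x. x \<in> carrier X \<Longrightarrow> f x = f' x"
  shows "vanishes_up X z f'"
  using assms(2) assms(3)[OF act_closed[OF assms(1)]] unfolding vanishes_up_def by simp

lemma vanishes_down_cong:
  assumes "left_module RG X" "vanishes_down X z f" "\<And>x. x \<in> carrier X \<Longrightarrow> f x = f' x"
  shows "vanishes_down X z f'"
  using assms(2) assms(3)[OF act_closed[OF assms(1)]] unfolding vanishes_down_def by simp

lemma restricted_resolution:
  assumes "projective_resolution RG (trivial_module R G) P d \<epsilon>"
  shows "resolution RK (trivial_module R K) P d \<epsilon>"
proof -
  interpret P: resolution RG "trivial_module R G" P d \<epsilon>
    using assms by (rule projective_resolution_resolution)
  have ops: "carrier (trivial_module R K) = carrier (trivial_module R G)"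
    "zero (trivial_module R K) = zero (trivial_module R G)"
    "add (trivial_module R K) = add (trivial_module R G)"
    by (simp_all add: trivial_module_def)
  have smult: "a \<odot>\<^bsub>trivial_module R K\<^esub> r = a \<odot>\<^bsub>trivial_module R G\<^esub> r" if "a \<in> carrier RK" for a r
  proof -
    have "{g \<in> carrier K. a g \<noteq> \<zero>\<^bsub>R\<^esub>} = {g \<in> carrier G. a g \<noteq> \<zero>\<^bsub>R\<^esub>}"
      using K.carrierD(2)[OF that] K_iff by auto
    then show ?thesis by (simp add: trivial_module_def)
  qed
  show ?thesis
  proof (rule resolution.intro)
    show "\<epsilon> \<in> module_hom RK (P 0) (trivial_module R K)"
      using module_homD[OF P.eps] by (intro module_homI) (simp_all add: ops smult RK_subset)
  qed (simp_all add: restrict_scalars P.P module_hom_restrict_scalars P.d ops P.eps_onto P.eps_d P.d_d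
      P.eps_exact P.d_exact)
qed

lemma trivial_module_group: "abelian_group (trivial_module R H)"
  by (rule abelian_groupI) (auto simp: trivial_module_def G.R.a_ac intro: G.R.add.l_inv_ex)

text \<open>Needed for two choices of \<open>Q\<close>: the resolution witnessing the finiteness
  property, to prove acyclicity, and the given resolution for \<open>K\<close>, to compute
  \<open>H^i(K; RK)\<close> from \<open>P\<close>.\<close>

lemma comparison_maps:
  assumes P: "projective_resolution RG (trivial_module R G) P d \<epsilon>"
    and Q: "projective_resolution RK (trivial_module R K) Q e \<eta>"
  obtains v u h k where "chain_map RK P d \<epsilon> Q e \<eta> v" "chain_map RK Q e \<eta> P d \<epsilon> u"
    "homotopy_to_id RK P d (\<lambda>i x. u i (v i x)) h" "homotopy_to_id RK Q e (\<lambda>i x. v i (u i x)) k"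
proof -
  interpret P: resolution RK "trivial_module R K" P d \<epsilon>
    using P by (rule restricted_resolution)
  interpret Q: resolution RK "trivial_module R K" Q e \<eta>
    using Q by (rule projective_resolution_resolution)
  have projP: "projective_module RG (P i)" for i
    by (rule P[unfolded projective_resolution_def, THEN conjunct1, THEN spec])
  have projQ: "projective_module RK (Q i)" for i
    by (rule Q[unfolded projective_resolution_def, THEN conjunct1, THEN spec])
  note liftP = projective_lifts_restricted[OF projP] and liftQ = projective_lifts[OF projQ]
    and M = trivial_module_group
  obtain v where v: "chain_map RK P d \<epsilon> Q e \<eta> v"
    by (rule chain_map_exists[OF P.resolution_axioms Q.resolution_axioms liftP[OF Q.P M]
          liftP[OF Q.P Q.P_group] M])
  obtain u where u: "chain_map RK Q e \<eta> P d \<epsilon> u"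
    by (rule chain_map_exists[OF Q.resolution_axioms P.resolution_axioms liftQ[OF P.P M]
          liftQ[OF P.P P.P_group] M])
  obtain h where h: "homotopy_to_id RK P d (\<lambda>i x. u i (v i x)) h"
    by (rule homotopy_exists[OF P.resolution_axioms chain_map_compose[OF v u] liftP[OF P.P P.P_group] M])
  obtain k where k: "homotopy_to_id RK Q e (\<lambda>i x. v i (u i x)) k"
    by (rule homotopy_exists[OF Q.resolution_axioms chain_map_compose[OF u v] liftQ[OF Q.P Q.P_group] M])
  from v u h k show thesis by (rule that)
qed

text \<open>Exactness of \<open>C\<^sub>+\<close> in degree \<open>i\<close>; in degree zero this
  means that cocycles vanish. The composite of \<open>v\<close> and \<open>u\<close> factors through
  the finitely generated \<open>F i\<close>, which provides the uniform bounds that the construction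
  of a primitive asks for.\<close>

lemma acyclic_up:
  assumes P: "projective_resolution RG (trivial_module R G) P d \<epsilon>"
    and FP: "type_FP TYPE('f) R K n" and i: "i \<le> n"
    and f: "f \<in> module_hom RK (P i) V" "vanishes_up (P i) \<zero>\<^bsub>V\<^esub> f"
    and fd: "\<And>x. x \<in> carrier (P (Suc i)) \<Longrightarrow> f (d i x) = \<zero>\<^bsub>V\<^esub>"
  shows "case i of 0 \<Rightarrow> \<forall>x\<in>carrier (P 0). f x = \<zero>\<^bsub>V\<^esub>
    | Suc j \<Rightarrow> \<exists>a\<in>module_hom RK (P j) V. vanishes_up (P j) \<zero>\<^bsub>V\<^esub> a \<and> (\<forall>x\<in>carrier (P i). a (d j x) = f x)"
proof -
  from FP obtain F :: "nat \<Rightarrow> ('g \<Rightarrow> 'r, 'f) module" and \<delta> \<theta>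
    where F: "projective_resolution RK (trivial_module R K) F \<delta> \<theta>"
      and fg: "\<And>i. i \<le> n \<Longrightarrow> finitely_generated_module RK (F i)"
    unfolding type_FP_def by blast
  interpret P: resolution RG "trivial_module R G" P d \<epsilon>
    using P by (rule projective_resolution_resolution)
  interpret PK: resolution RK "trivial_module R K" P d \<epsilon>
    using P by (rule restricted_resolution)
  interpret F: resolution RK "trivial_module R K" F \<delta> \<theta>
    using F by (rule projective_resolution_resolution)
  interpret V: left_module RK V by (rule V)
  have projP: "projective_module RG (P i)" for i
    by (rule P[unfolded projective_resolution_def, THEN conjunct1, THEN spec])
  obtain v u h k where v: "chain_map RK P d \<epsilon> F \<delta> \<theta> v" and u: "chain_map RK F \<delta> \<theta> P d \<epsilon> u"
    and h: "homotopy_to_id RK P d (\<lambda>i x. u i (v i x)) h"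
    and k: "homotopy_to_id RK F \<delta> (\<lambda>i x. v i (u i x)) k"
    by (rule comparison_maps[OF P F])
  have vi: "v i \<in> module_hom RK (P i) (F i)" and ui: "u i \<in> module_hom RK (F i) (P i)"
    and hi: "h i \<in> module_hom RK (P i) (P (Suc i))" for i
    using v u h by (simp_all add: chain_map_def homotopy_to_id_def)
  have id0: "x = u 0 (v 0 x) \<oplus>\<^bsub>P 0\<^esub> d 0 (h 0 x)" if "x \<in> carrier (P 0)" for x
    using bspec[OF conjunct1[OF conjunct2[OF h[unfolded homotopy_to_id_def]]] that] .
  have id: "x = u (Suc i) (v (Suc i) x) \<oplus>\<^bsub>P (Suc i)\<^esub> d (Suc i) (h (Suc i) x) \<oplus>\<^bsub>P (Suc i)\<^esub> h i (d i x)"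
    if "x \<in> carrier (P (Suc i))" for i x
    using bspec[OF spec[OF conjunct2[OF conjunct2[OF h[unfolded homotopy_to_id_def]]]] that] .
  have uv: "(\<lambda>x. u i (v i x)) \<in> module_hom RK (P i) (P i)" for i
    by (rule module_hom_compose[OF vi ui])
  show ?thesis
  proof (cases i)
    case 0
    note f = f[unfolded 0] and fd = fd[unfolded 0]
    obtain J where J: "\<And>m x. m \<ge> J \<Longrightarrow> x \<in> carrier (F 0) \<Longrightarrow> f (act (P 0) m (u 0 x)) = \<zero>\<^bsub>V\<^esub>"
      using finitely_generated_vanishing[OF F.P fg P.P V f ui] by blast
    \<comment> \<open>The bound \<open>J\<close> holds on all of \<open>F 0\<close>, so it may be
      used at the translate \<open>t^(-J) x\<close>. After moving back by \<open>t^J\<close>,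
      \<open>f\<close> kills both terms of the expansion.\<close>
    have "f x = \<zero>\<^bsub>V\<^esub>" if x: "x \<in> carrier (P 0)" for x
    proof -
      let ?x = "act (P 0) (- J) x"
      have xc: "?x \<in> carrier (P 0)" by (rule act_closed[OF P.P x])
      have uc: "u 0 (v 0 ?x) \<in> carrier (P 0)" by (rule module_homD(1)[OF uv xc])
      have hc: "h 0 ?x \<in> carrier (P (Suc 0))" by (rule module_homD(1)[OF hi xc])
      have "x = act (P 0) J ?x" using x by (simp add: act_act[OF P.P] act_0[OF P.P])
      also have "\<dots> = act (P 0) J (u 0 (v 0 ?x) \<oplus>\<^bsub>P 0\<^esub> d 0 (h 0 ?x))" using id0[OF xc] by simp
      also have "\<dots> = act (P 0) J (u 0 (v 0 ?x)) \<oplus>\<^bsub>P 0\<^esub> d 0 (act (P (Suc 0)) J (h 0 ?x))"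
        using uc hc by (simp add: act_add[OF P.P] P.d_closed hom_act[OF P.d])
      finally have "f x = f (act (P 0) J (u 0 (v 0 ?x))) \<oplus>\<^bsub>V\<^esub> f (d 0 (act (P (Suc 0)) J (h 0 ?x)))"
        using module_homD(2)[OF f(1) act_closed[OF P.P uc] P.d_closed[OF act_closed[OF P.P hc]]] by metis
      also have "\<dots> = \<zero>\<^bsub>V\<^esub>"
        using J[OF order_refl module_homD(1)[OF vi xc]] fd[OF act_closed[OF P.P hc]] by simp
      finally show ?thesis .
    qed
    then show ?thesis by (simp add: 0)
  next
    case (Suc j)
    note f = f[unfolded Suc] and fd = fd[unfolded Suc] and i = i[unfolded Suc]
    \<comment> \<open>The change of the homotopy under conjugation by the inverse of
      \<open>t\<close>, evaluated on \<open>F j\<close>. As \<open>F j\<close> is finitely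
      generated, a single bound takes care of it.\<close>
    let ?w = "\<lambda>x. conjugate (P j) (P (Suc j)) (- 1) (h j) (u j x) \<ominus>\<^bsub>P (Suc j)\<^esub> h j (u j x)"
    have w: "?w \<in> module_hom RK (F j) (P (Suc j))"
      by (intro module_hom_diff[OF PK.P] module_hom_compose[OF ui hi]
          module_hom_compose[OF ui conjugate_hom[OF P.P P.P hi]])
    obtain J1 where J1: "\<And>m x. m \<ge> J1 \<Longrightarrow> x \<in> carrier (F j) \<Longrightarrow> f (act (P (Suc j)) m (?w x)) = \<zero>\<^bsub>V\<^esub>"
      using finitely_generated_vanishing[OF F.P fg P.P V f w] i by (metis Suc_leD)
    obtain J2 where J2: "\<And>m x. m \<ge> J2 \<Longrightarrow> x \<in> carrier (F (Suc j)) \<Longrightarrow>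
        f (act (P (Suc j)) m (u (Suc j) x)) = \<zero>\<^bsub>V\<^esub>"
      using finitely_generated_vanishing[OF F.P fg[OF i] P.P V f ui] by metis
    let ?J = "max J1 J2"
    have J1': "f (act (P (Suc j)) m (?w (v j y))) = \<zero>\<^bsub>V\<^esub>" if "m \<ge> ?J" "y \<in> carrier (P j)" for m y
      using that by (intro J1 module_homD(1)[OF vi]) auto
    have J2': "f (act (P (Suc j)) m (u (Suc j) (v (Suc j) z))) = \<zero>\<^bsub>V\<^esub>"
      if "m \<ge> ?J" "z \<in> carrier (P (Suc j))" for m z
      using that by (intro J2 module_homD(1)[OF vi]) auto
    have "\<exists>a\<in>module_hom RK (P j) V. vanishes_up (P j) \<zero>\<^bsub>V\<^esub> a \<and> (\<forall>x\<in>carrier (P (Suc j)). a (d j x) = f x)"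
    proof (cases j)
      case 0
      \<comment> \<open>Nothing precedes degree zero. Zero maps into and out of a second copy of
        \<open>P 0\<close> stand for the missing differential and homotopy, so that the general
        construction applies.\<close>
      let ?d1 = "\<lambda>x. \<zero>\<^bsub>P 0\<^esub>"
      have d1: "?d1 \<in> module_hom RG (P j) (P 0)" by (rule module_hom_zero[OF P.P])
      have h0: "?d1 \<in> module_hom RK (P 0) (P j)" unfolding 0 by (rule module_hom_zero[OF PK.P])
      interpret P0: left_module RK "P 0" by (rule PK.P)
      have id1: "y = u j (v j y) \<oplus>\<^bsub>P j\<^esub> d j (h j y) \<oplus>\<^bsub>P j\<^esub> \<zero>\<^bsub>P 0\<^esub>" if "y \<in> carrier (P j)" for y
        using id0[of y] that module_homD(1)[OF uv] P.d_closed module_homD(1)[OF hi] unfolding 0 by simp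
      obtain p q where pq: "p \<in> module_hom RK (P 0) (P 0)" "q \<in> module_hom RK (P 0) (P 0)"
        "\<And>x. x \<in> carrier (P 0) \<Longrightarrow> p x \<oplus>\<^bsub>P 0\<^esub> q x = x"
        "vanishes_up (P 0) \<zero>\<^bsub>P 0\<^esub> p" "vanishes_down (P 0) \<zero>\<^bsub>P 0\<^esub> q"
        using projective_halves[OF projP[of 0]] by blast
      show ?thesis
        by (rule primitive_vanishing_up[OF P.P P.P P.P P.P d1 P.d P.d refl h0 hi hi uv uv id1 id
              pq(1,4,2,5,3) V f fd J1' J2']) blast+
    next
      case (Suc l)
      obtain p q where pq: "p \<in> module_hom RK (P l) (P l)" "q \<in> module_hom RK (P l) (P l)"
        "\<And>x. x \<in> carrier (P l) \<Longrightarrow> p x \<oplus>\<^bsub>P l\<^esub> q x = x"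
        "vanishes_up (P l) \<zero>\<^bsub>P l\<^esub> p" "vanishes_down (P l) \<zero>\<^bsub>P l\<^esub> q"
        using projective_halves[OF projP[of l]] by blast
      have d1: "d l \<in> module_hom RG (P j) (P l)" and h0: "h l \<in> module_hom RK (P l) (P j)"
        unfolding Suc by (rule P.d, rule hi)
      have dd: "d l (d j z) = \<zero>\<^bsub>P l\<^esub>" if "z \<in> carrier (P (Suc j))" for z
        using P.d_d that unfolding Suc by blast
      have id1: "y = u j (v j y) \<oplus>\<^bsub>P j\<^esub> d j (h j y) \<oplus>\<^bsub>P j\<^esub> h l (d l y)" if "y \<in> carrier (P j)" for y
        using that unfolding Suc by (rule id)
      show ?thesis
        by (rule primitive_vanishing_up[OF P.P P.P P.P P.P d1 P.d P.d dd h0 hi hi uv uv id1 id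
              pq(1,4,2,5,3) V f fd J1' J2']) blast+
    qed
    then show ?thesis by (simp add: Suc)
  qed
qed

text \<open>The hypotheses are symmetric under replacing \<open>\<phi>\<close> by \<open>- \<phi>\<close> and \<open>t\<close> by its inverse.\<close>

lemma acyclic_down:
  assumes P: "projective_resolution RG (trivial_module R G) P d \<epsilon>"
    and FP: "type_FP TYPE('f) R K n" and i: "i \<le> n"
    and f: "f \<in> module_hom RK (P i) V" "vanishes_down (P i) \<zero>\<^bsub>V\<^esub> f"
    and fd: "\<And>x. x \<in> carrier (P (Suc i)) \<Longrightarrow> f (d i x) = \<zero>\<^bsub>V\<^esub>"
  shows "case i of 0 \<Rightarrow> \<forall>x\<in>carrier (P 0). f x = \<zero>\<^bsub>V\<^esub>
    | Suc j \<Rightarrow> \<exists>a\<in>module_hom RK (P j) V. vanishes_down (P j) \<zero>\<^bsub>V\<^esub> a \<and> (\<forall>x\<in>carrier (P i). a (d j x) = f x)"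
proof -
  interpret op: cyclic_quotient R G K "\<lambda>g. - \<phi> g" "inv\<^bsub>G\<^esub> t"
    by unfold_locales (auto simp: hom_def phi_mult phi_inv phi_t K_eq t)
  have "op.act (P m) j x = act (P m) (- j) x" for m j x
    by (simp add: op.act_def act_def G.H.int_pow_inv t G.H.int_pow_neg)
  then have "op.vanishes_up (P m) \<zero>\<^bsub>V\<^esub> g = vanishes_down (P m) \<zero>\<^bsub>V\<^esub> g" for m g
    by (simp add: op.vanishes_up_def vanishes_down_def)
  then show ?thesis
    using op.acyclic_up[OF P FP i f(1) _ fd] f(2) by (cases i) simp_all
qed

text \<open>These are the components at \<open>K\<close> of the \<open>RG\<close>-linear maps \<open>M \<rightarrow> RG\<close>.\<close>

definition compact_cochain :: "('g \<Rightarrow> 'r, 'a) module \<Rightarrow> ('a \<Rightarrow> 'g \<Rightarrow> 'r) \<Rightarrow> bool"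
  where "compact_cochain M f \<longleftrightarrow>
    f \<in> module_hom RK M V \<and> vanishes_up M \<zero>\<^bsub>V\<^esub> f \<and> vanishes_down M \<zero>\<^bsub>V\<^esub> f"

end

section \<open>Mayer-Vietoris for \<open>C\<^sub>+\<close> and \<open>C\<^sub>-\<close>\<close>

locale compared_resolutions = cyclic_quotient R G K \<phi> t
  for R :: "('r, 'u) ring_scheme" and G K :: "('g, 'v) monoid_scheme" and \<phi> t +
  fixes P :: "nat \<Rightarrow> ('g \<Rightarrow> 'r, 'p) module" and d :: "nat \<Rightarrow> 'p \<Rightarrow> 'p" and \<epsilon> :: "'p \<Rightarrow> 'r"
    and Q :: "nat \<Rightarrow> ('g \<Rightarrow> 'r, 'q) module" and e :: "nat \<Rightarrow> 'q \<Rightarrow> 'q" and \<eta> :: "'q \<Rightarrow> 'r"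
    and v u h k p q
  assumes PG: "projective_resolution RG (trivial_module R G) P d \<epsilon>"
    and QK: "projective_resolution RK (trivial_module R K) Q e \<eta>"
    and v: "chain_map RK P d \<epsilon> Q e \<eta> v" and u: "chain_map RK Q e \<eta> P d \<epsilon> u"
    and h: "homotopy_to_id RK P d (\<lambda>i x. u i (v i x)) h"
    and k: "homotopy_to_id RK Q e (\<lambda>i x. v i (u i x)) k"
    and p: "\<And>i. p i \<in> module_hom RK (P i) (P i)" and q: "\<And>i. q i \<in> module_hom RK (P i) (P i)"
    and pq: "\<And>i x. x \<in> carrier (P i) \<Longrightarrow> p i x \<oplus>\<^bsub>P i\<^esub> q i x = x"
    and p_up: "\<And>i. vanishes_up (P i) \<zero>\<^bsub>P i\<^esub> (p i)" and q_down: "\<And>i. vanishes_down (P i) \<zero>\<^bsub>P i\<^esub> (q i)"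
begin

sublocale P: resolution RG "trivial_module R G" P d \<epsilon>
  using PG by (rule projective_resolution_resolution)

sublocale PK: resolution RK "trivial_module R K" P d \<epsilon>
  using PG by (rule restricted_resolution)

sublocale Q: resolution RK "trivial_module R K" Q e \<eta>
  using QK by (rule projective_resolution_resolution)

sublocale V: left_module RK V
  by (rule V)

lemma v_hom: "v i \<in> module_hom RK (P i) (Q i)" and u_hom: "u i \<in> module_hom RK (Q i) (P i)"
  and h_hom: "h i \<in> module_hom RK (P i) (P (Suc i))" and k_hom: "k i \<in> module_hom RK (Q i) (Q (Suc i))"
  using v u h k by (simp_all add: chain_map_def homotopy_to_id_def)

lemma v_d: "x \<in> carrier (P (Suc i)) \<Longrightarrow> e i (v (Suc i) x) = v i (d i x)"
  and u_e: "y \<in> carrier (Q (Suc i)) \<Longrightarrow> d i (u (Suc i) y) = u i (e i y)"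
  using v u by (simp_all add: chain_map_def)

lemma h_0: "x \<in> carrier (P 0) \<Longrightarrow> x = u 0 (v 0 x) \<oplus>\<^bsub>P 0\<^esub> d 0 (h 0 x)"
  by (rule bspec[OF conjunct1[OF conjunct2[OF h[unfolded homotopy_to_id_def]]]])

lemma h_Suc: "x \<in> carrier (P (Suc i)) \<Longrightarrow>
    x = u (Suc i) (v (Suc i) x) \<oplus>\<^bsub>P (Suc i)\<^esub> d (Suc i) (h (Suc i) x) \<oplus>\<^bsub>P (Suc i)\<^esub> h i (d i x)"
  by (rule bspec[OF spec[OF conjunct2[OF conjunct2[OF h[unfolded homotopy_to_id_def]]]]])

lemma k_0: "x \<in> carrier (Q 0) \<Longrightarrow> x = v 0 (u 0 x) \<oplus>\<^bsub>Q 0\<^esub> e 0 (k 0 x)"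
  by (rule bspec[OF conjunct1[OF conjunct2[OF k[unfolded homotopy_to_id_def]]]])

lemma k_Suc: "x \<in> carrier (Q (Suc i)) \<Longrightarrow>
    x = v (Suc i) (u (Suc i) x) \<oplus>\<^bsub>Q (Suc i)\<^esub> e (Suc i) (k (Suc i) x) \<oplus>\<^bsub>Q (Suc i)\<^esub> k i (e i x)"
  by (rule bspec[OF spec[OF conjunct2[OF conjunct2[OF k[unfolded homotopy_to_id_def]]]]])

lemmas closed = module_homD(1)[OF v_hom] module_homD(1)[OF u_hom] module_homD(1)[OF h_hom]
  module_homD(1)[OF k_hom] module_homD(1)[OF p] module_homD(1)[OF q] P.d_closed Q.d_closed

lemma P_apply_zero: "c \<in> module_hom RK (P i) V \<Longrightarrow> c \<zero>\<^bsub>P i\<^esub> = \<zero>\<^bsub>V\<^esub>"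
  by (rule module_hom_apply_zero[OF _ P.P_group V.M.abelian_group_axioms])

lemma split_pq:
  assumes "c \<in> module_hom RK (P i) V" "x \<in> carrier (P i)"
  shows "c x = c (p i x) \<oplus>\<^bsub>V\<^esub> c (q i x)"
  using module_homD(2)[OF assms(1) closed(5,6)[OF assms(2)]] pq[OF assms(2)] by simp

text \<open>The Mayer-Vietoris boundary. The cochain \<open>c \<circ> v i\<close> is the sum of its
  composites with \<open>p i\<close> in \<open>C\<^sub>+\<close> and with \<open>q i\<close> in
  \<open>C\<^sub>-\<close>, and the class of \<open>c\<close> is sent to the coboundary of the first
  summand.\<close>

definition connecting :: "nat \<Rightarrow> ('q \<Rightarrow> 'g \<Rightarrow> 'r) \<Rightarrow> 'p \<Rightarrow> 'g \<Rightarrow> 'r"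
  where "connecting i c x = c (v i (p i (d i x)))"

lemma up_p: "c \<in> module_hom RK (P i) V \<Longrightarrow> vanishes_up (P i) \<zero>\<^bsub>V\<^esub> (\<lambda>x. c (p i x))"
  by (rule vanishes_up_apply[OF p_up P_apply_zero])

lemma down_q: "c \<in> module_hom RK (P i) V \<Longrightarrow> vanishes_down (P i) \<zero>\<^bsub>V\<^esub> (\<lambda>x. c (q i x))"
  by (rule vanishes_down_apply[OF q_down P_apply_zero])

lemma compact_cochain_add:
  "compact_cochain M f \<Longrightarrow> compact_cochain M g \<Longrightarrow> compact_cochain M (\<lambda>x. f x \<oplus>\<^bsub>V\<^esub> g x)"
  unfolding compact_cochain_def
  by (auto intro!: module_hom_add[OF V] vanishes_up_combine[where op = "add V"]
      vanishes_down_combine[where op = "add V"])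

text \<open>The factor \<open>p i\<close> gives vanishing upwards. Downwards,
  \<open>a \<circ> p i\<close> is the difference of \<open>a\<close> and
  \<open>a \<circ> q i\<close>, which both vanish there.\<close>

lemma compact_cochain_up_p:
  assumes "a \<in> module_hom RK (P i) V" "vanishes_down (P i) \<zero>\<^bsub>V\<^esub> a"
  shows "compact_cochain (P i) (\<lambda>x. a (p i x))"
  unfolding compact_cochain_def
proof (intro conjI module_hom_compose[OF p assms(1)] up_p[OF assms(1)])
  have "vanishes_down (P i) \<zero>\<^bsub>V\<^esub> (\<lambda>x. a x \<ominus>\<^bsub>V\<^esub> a (q i x))"
    by (rule vanishes_down_combine[OF assms(2) down_q[OF assms(1)], where op = "a_minus V"])
      (simp add: V.M.minus_eq)
  then show "vanishes_down (P i) \<zero>\<^bsub>V\<^esub> (\<lambda>x. a (p i x))"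
  proof (rule vanishes_down_cong[OF P.P])
    fix x assume x: "x \<in> carrier (P i)"
    show "a x \<ominus>\<^bsub>V\<^esub> a (q i x) = a (p i x)"
      unfolding split_pq[OF assms(1) x] using module_homD(1)[OF assms(1)] closed(5,6)[OF x]
      by (simp add: V.M.group_simps V.M.group_cancel)
  qed
qed

lemma compact_cochain_down_q:
  assumes "a \<in> module_hom RK (P i) V" "vanishes_up (P i) \<zero>\<^bsub>V\<^esub> a"
  shows "compact_cochain (P i) (\<lambda>x. a (q i x))"
  unfolding compact_cochain_def
proof (intro conjI module_hom_compose[OF q assms(1)] down_q[OF assms(1)])
  have "vanishes_up (P i) \<zero>\<^bsub>V\<^esub> (\<lambda>x. a x \<ominus>\<^bsub>V\<^esub> a (p i x))"
    by (rule vanishes_up_combine[OF assms(2) up_p[OF assms(1)], where op = "a_minus V"])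
      (simp add: V.M.minus_eq)
  then show "vanishes_up (P i) \<zero>\<^bsub>V\<^esub> (\<lambda>x. a (q i x))"
  proof (rule vanishes_up_cong[OF P.P])
    fix x assume x: "x \<in> carrier (P i)"
    show "a x \<ominus>\<^bsub>V\<^esub> a (p i x) = a (q i x)"
      unfolding split_pq[OF assms(1) x] using module_homD(1)[OF assms(1)] closed(5,6)[OF x]
      by (simp add: V.M.group_simps V.M.group_cancel)
  qed
qed

text \<open>The maps \<open>p\<close> need not commute with the differential. Since
  \<open>p + q\<close> is the identity, the commutator of \<open>d\<close> with \<open>p\<close> is
  the negative of that with \<open>q\<close>, so it vanishes at both ends. Such commutators are the
  error terms that arise when \<open>p\<close> is moved past \<open>d\<close>.\<close>

lemma compact_cochain_commutator:
  assumes b: "b \<in> module_hom RK (P j) V"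
  shows "compact_cochain (P (Suc j)) (\<lambda>x. b (d j (p (Suc j) x)) \<ominus>\<^bsub>V\<^esub> b (p j (d j x)))"
  unfolding compact_cochain_def
proof (intro conjI)
  have bd: "(\<lambda>x. b (d j x)) \<in> module_hom RK (P (Suc j)) V"
    by (rule module_hom_compose[OF PK.d b])
  have bp: "(\<lambda>x. b (p j x)) \<in> module_hom RK (P j) V"
    by (rule module_hom_compose[OF p b])
  show "(\<lambda>x. b (d j (p (Suc j) x)) \<ominus>\<^bsub>V\<^esub> b (p j (d j x))) \<in> module_hom RK (P (Suc j)) V"
    by (intro module_hom_diff[OF V] module_hom_compose[OF p bd] module_hom_compose[OF PK.d bp])
  show "vanishes_up (P (Suc j)) \<zero>\<^bsub>V\<^esub> (\<lambda>x. b (d j (p (Suc j) x)) \<ominus>\<^bsub>V\<^esub> b (p j (d j x)))"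
    by (rule vanishes_up_combine[OF up_p[OF bd] vanishes_up_compose_RG[OF up_p[OF b] P.d], where op = "a_minus V"])
      (simp add: V.M.minus_eq)
  have "vanishes_down (P (Suc j)) \<zero>\<^bsub>V\<^esub> (\<lambda>x. b (q j (d j x)) \<ominus>\<^bsub>V\<^esub> b (d j (q (Suc j) x)))"
    by (rule vanishes_down_combine[OF vanishes_down_compose_RG[OF down_q[OF b] P.d] down_q[OF bd],
          where op = "a_minus V"]) (simp add: V.M.minus_eq)
  then show "vanishes_down (P (Suc j)) \<zero>\<^bsub>V\<^esub> (\<lambda>x. b (d j (p (Suc j) x)) \<ominus>\<^bsub>V\<^esub> b (p j (d j x)))"
  proof (rule vanishes_down_cong[OF P.P])
    fix x assume x: "x \<in> carrier (P (Suc j))"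
    note bc = module_homD(1)[OF b]
    have "b (p j (d j x)) \<oplus>\<^bsub>V\<^esub> b (q j (d j x)) = b (d j (p (Suc j) x)) \<oplus>\<^bsub>V\<^esub> b (d j (q (Suc j) x))"
      using split_pq[OF b P.d_closed[OF x]] split_pq[OF bd x] by simp
    moreover have "b (p j (d j x)) \<in> carrier V" "b (q j (d j x)) \<in> carrier V"
      "b (d j (p (Suc j) x)) \<in> carrier V" "b (d j (q (Suc j) x)) \<in> carrier V"
      using x by (auto intro!: bc closed)
    moreover have "B \<ominus>\<^bsub>V\<^esub> D = C \<ominus>\<^bsub>V\<^esub> A"
      if "A \<oplus>\<^bsub>V\<^esub> B = C \<oplus>\<^bsub>V\<^esub> D" "A \<in> carrier V" "B \<in> carrier V" "C \<in> carrier V" "D \<in> carrier V" for A B C D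
    proof -
      have "B \<ominus>\<^bsub>V\<^esub> D = (A \<oplus>\<^bsub>V\<^esub> B) \<ominus>\<^bsub>V\<^esub> D \<ominus>\<^bsub>V\<^esub> A" using that(2-5) by (simp add: V.M.group_simps V.M.group_cancel)
      also have "\<dots> = C \<ominus>\<^bsub>V\<^esub> A" unfolding that(1) using that(2-5) by (simp add: V.M.group_simps V.M.group_cancel)
      finally show ?thesis .
    qed
    ultimately show "b (q j (d j x)) \<ominus>\<^bsub>V\<^esub> b (d j (q (Suc j) x)) = b (d j (p (Suc j) x)) \<ominus>\<^bsub>V\<^esub> b (p j (d j x))"
      by blast
  qed
qed

lemma cocycle_v_d:
  assumes "c \<in> module_hom RK (Q i) V" "\<And>y. y \<in> carrier (Q (Suc i)) \<Longrightarrow> c (e i y) = \<zero>\<^bsub>V\<^esub>"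
    and "x \<in> carrier (P (Suc i))"
  shows "c (v i (d i x)) = \<zero>\<^bsub>V\<^esub>"
  using assms(2)[OF closed(1)[OF assms(3)]] v_d[OF assms(3)] by simp

lemma connecting_compact:
  assumes c: "c \<in> module_hom RK (Q i) V" "\<And>y. y \<in> carrier (Q (Suc i)) \<Longrightarrow> c (e i y) = \<zero>\<^bsub>V\<^esub>"
  shows "compact_cochain (P (Suc i)) (connecting i c)"
    and "x \<in> carrier (P (Suc (Suc i))) \<Longrightarrow> connecting i c (d (Suc i) x) = \<zero>\<^bsub>V\<^esub>"
proof -
  have cv: "(\<lambda>x. c (v i x)) \<in> module_hom RK (P i) V" by (rule module_hom_compose[OF v_hom c(1)])
  show "compact_cochain (P (Suc i)) (connecting i c)"
    unfolding compact_cochain_def connecting_def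
  proof (intro conjI)
    show "(\<lambda>x. c (v i (p i (d i x)))) \<in> module_hom RK (P (Suc i)) V"
      by (rule module_hom_compose[OF PK.d module_hom_compose[OF p cv]])
    show "vanishes_up (P (Suc i)) \<zero>\<^bsub>V\<^esub> (\<lambda>x. c (v i (p i (d i x))))"
      by (rule vanishes_up_compose_RG[OF up_p[OF cv] P.d])
    \<comment> \<open>For a cocycle \<open>c\<close> the composites of \<open>c \<circ> v i\<close>
      with \<open>p i \<circ> d i\<close> and with \<open>q i \<circ> d i\<close> add up to zero, so
      vanishing downwards can be read off from \<open>q i\<close>.\<close>
    have "vanishes_down (P (Suc i)) \<zero>\<^bsub>V\<^esub> (\<lambda>x. \<ominus>\<^bsub>V\<^esub> c (v i (q i (d i x))))"
      by (rule vanishes_down_apply[OF vanishes_down_compose_RG[OF down_q[OF cv] P.d]]) simp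
    then show "vanishes_down (P (Suc i)) \<zero>\<^bsub>V\<^esub> (\<lambda>x. c (v i (p i (d i x))))"
    proof (rule vanishes_down_cong[OF P.P])
      fix x assume x: "x \<in> carrier (P (Suc i))"
      then have "c (v i (p i (d i x))) \<oplus>\<^bsub>V\<^esub> c (v i (q i (d i x))) = \<zero>\<^bsub>V\<^esub>"
        using split_pq[OF cv P.d_closed[OF x]] cocycle_v_d[OF c x] by simp
      then show "\<ominus>\<^bsub>V\<^esub> c (v i (q i (d i x))) = c (v i (p i (d i x)))"
        using x by (intro V.M.minus_equality) (auto intro!: closed module_homD(1)[OF c(1)])
    qed
  qed
  show "connecting i c (d (Suc i) x) = \<zero>\<^bsub>V\<^esub>" if x: "x \<in> carrier (P (Suc (Suc i)))"
    using P_apply_zero[OF module_hom_compose[OF p cv]] by (simp add: connecting_def P.d_d[OF x])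
qed

text \<open>If \<open>c\<close> is the coboundary of \<open>b\<close>, the connecting map gives
  \<open>b \<circ> v \<circ> d \<circ> p \<circ> d\<close>. The commutator of \<open>d\<close> with
  \<open>p\<close>, followed by \<open>b \<circ> v\<close> and evaluated on boundaries, has the same
  value because \<open>d \<circ> d\<close> is zero, and it is compact.\<close>

lemma connecting_coboundary:
  assumes b: "b \<in> module_hom RK (Q j) V" and c: "\<And>y. y \<in> carrier (Q (Suc j)) \<Longrightarrow> c y = b (e j y)"
  obtains g where "compact_cochain (P (Suc j)) g"
    "\<And>x. x \<in> carrier (P (Suc (Suc j))) \<Longrightarrow> g (d (Suc j) x) = connecting (Suc j) c x"
proof (rule that)
  have bv: "(\<lambda>x. b (v j x)) \<in> module_hom RK (P j) V" by (rule module_hom_compose[OF v_hom b])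
  let ?g = "\<lambda>x. b (v j (d j (p (Suc j) x))) \<ominus>\<^bsub>V\<^esub> b (v j (p j (d j x)))"
  show "compact_cochain (P (Suc j)) ?g" by (rule compact_cochain_commutator[OF bv])
  fix x assume x: "x \<in> carrier (P (Suc (Suc j)))"
  let ?y = "p (Suc j) (d (Suc j) x)"
  have y: "?y \<in> carrier (P (Suc j))" by (rule closed(5)[OF closed(7)[OF x]])
  have "b (v j (p j (d j (d (Suc j) x)))) = \<zero>\<^bsub>V\<^esub>"
    using P_apply_zero[OF module_hom_compose[OF p bv]] by (simp add: P.d_d[OF x])
  moreover have "b (v j (d j ?y)) \<in> carrier V"
    by (rule module_homD(1)[OF b closed(1)[OF closed(7)[OF y]]])
  moreover have "b (v j (d j ?y)) = c (v (Suc j) ?y)" using c[OF closed(1)[OF y]] v_d[OF y] by simp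
  ultimately show "?g (d (Suc j) x) = connecting (Suc j) c x"
    by (simp add: connecting_def V.M.minus_eq)
qed

text \<open>If \<open>connecting i c\<close> has a compact primitive \<open>g\<close>, then
  \<open>c \<circ> v \<circ> p - g\<close> and \<open>c \<circ> v \<circ> q + g\<close> are cocycles
  in \<open>C\<^sub>+\<close> and \<open>C\<^sub>-\<close>. Both complexes are exact in degree
  \<open>i\<close>, and the two cocycles add up to \<open>c \<circ> v\<close>, which is therefore a
  coboundary over \<open>RK\<close>.\<close>

lemma connecting_injective:
  assumes FP: "type_FP TYPE('f) R K n" and i: "i \<le> n"
    and c: "c \<in> module_hom RK (Q i) V" "\<And>y. y \<in> carrier (Q (Suc i)) \<Longrightarrow> c (e i y) = \<zero>\<^bsub>V\<^esub>"
    and g: "compact_cochain (P i) g" "\<And>x. x \<in> carrier (P (Suc i)) \<Longrightarrow> g (d i x) = connecting i c x"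
  shows "case i of 0 \<Rightarrow> \<forall>y\<in>carrier (Q 0). c y = \<zero>\<^bsub>V\<^esub>
    | Suc j \<Rightarrow> \<exists>b\<in>module_hom RK (Q j) V. \<forall>y\<in>carrier (Q i). c y = b (e j y)"
proof -
  have cv: "(\<lambda>x. c (v i x)) \<in> module_hom RK (P i) V" by (rule module_hom_compose[OF v_hom c(1)])
  from g(1) have gh: "g \<in> module_hom RK (P i) V" and gu: "vanishes_up (P i) \<zero>\<^bsub>V\<^esub> g"
    and gd: "vanishes_down (P i) \<zero>\<^bsub>V\<^esub> g" by (auto simp: compact_cochain_def)
  let ?f = "\<lambda>x. c (v i (p i x)) \<ominus>\<^bsub>V\<^esub> g x" and ?f' = "\<lambda>x. c (v i (q i x)) \<oplus>\<^bsub>V\<^esub> g x"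
  have f: "?f \<in> module_hom RK (P i) V" "vanishes_up (P i) \<zero>\<^bsub>V\<^esub> ?f"
    by (intro module_hom_diff[OF V] module_hom_compose[OF p cv] gh,
        rule vanishes_up_combine[OF up_p[OF cv] gu, where op = "a_minus V"]) (simp add: V.M.minus_eq)
  have f': "?f' \<in> module_hom RK (P i) V" "vanishes_down (P i) \<zero>\<^bsub>V\<^esub> ?f'"
    by (intro module_hom_add[OF V] module_hom_compose[OF q cv] gh,
        rule vanishes_down_combine[OF down_q[OF cv] gd, where op = "add V"]) simp
  have cl: "c (v i (p i x)) \<in> carrier V" "c (v i (q i x)) \<in> carrier V" "g x \<in> carrier V"
    if "x \<in> carrier (P i)" for x
    using that by (auto intro!: closed module_homD(1)[OF c(1)] module_homD(1)[OF gh])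
  have fd: "?f (d i x) = \<zero>\<^bsub>V\<^esub>" if x: "x \<in> carrier (P (Suc i))" for x
    using g(2)[OF x] cl[OF P.d_closed[OF x]] by (simp add: connecting_def V.M.r_neg V.M.minus_eq)
  have fd': "?f' (d i x) = \<zero>\<^bsub>V\<^esub>" if x: "x \<in> carrier (P (Suc i))" for x
    using g(2)[OF x] cl[OF P.d_closed[OF x]] split_pq[OF cv P.d_closed[OF x]] cocycle_v_d[OF c x]
    by (simp add: connecting_def V.M.a_comm)
  have sum: "c (v i x) = ?f x \<oplus>\<^bsub>V\<^esub> ?f' x" if x: "x \<in> carrier (P i)" for x
    using split_pq[OF cv x] cl[OF x] by (simp add: V.M.group_simps V.M.group_cancel)
  note up = acyclic_up[OF PG FP i f fd] and down = acyclic_down[OF PG FP i f' fd']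
  show ?thesis
  proof (cases i)
    case 0
    have "c y = \<zero>\<^bsub>V\<^esub>" if y: "y \<in> carrier (Q 0)" for y
    proof -
      have "c (v 0 (u 0 y)) = \<zero>\<^bsub>V\<^esub>"
        using sum[of "u 0 y"] up down closed(2)[OF y] by (simp add: 0)
      moreover have "c y = c (v 0 (u 0 y)) \<oplus>\<^bsub>V\<^esub> c (e 0 (k 0 y))"
        using k_0[OF y] module_homD(2)[OF c(1)[unfolded 0] closed(1)[OF closed(2)[OF y]] closed(8)[OF closed(4)[OF y]]]
        by metis
      ultimately show ?thesis using c(2)[unfolded 0, OF closed(4)[OF y]] by simp
    qed
    then show ?thesis by (simp add: 0)
  next
    case (Suc j)
    obtain a where a: "a \<in> module_hom RK (P j) V" "\<And>x. x \<in> carrier (P i) \<Longrightarrow> a (d j x) = ?f x"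
      using up unfolding Suc by auto
    obtain a' where a': "a' \<in> module_hom RK (P j) V" "\<And>x. x \<in> carrier (P i) \<Longrightarrow> a' (d j x) = ?f' x"
      using down unfolding Suc by auto
    \<comment> \<open>Back on \<open>Q\<close>: expanding \<open>y\<close> by the homotopy
      \<open>k\<close> gives \<open>c\<close> as the sum of \<open>c \<circ> v \<circ> u\<close> and
      \<open>c \<circ> k \<circ> e\<close>, the remaining term being killed because \<open>c\<close>
      is a cocycle. The first summand factors through \<open>e\<close> since \<open>u\<close> is a
      chain map.\<close>
    let ?b = "\<lambda>y. a (u j y) \<oplus>\<^bsub>V\<^esub> a' (u j y) \<oplus>\<^bsub>V\<^esub> c (k j y)"
    have "?b \<in> module_hom RK (Q j) V"
      using c(1) unfolding Suc
      by (intro module_hom_add[OF V] module_hom_compose[OF u_hom] a a' module_hom_compose[OF k_hom])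
    moreover have "c y = ?b (e j y)" if y: "y \<in> carrier (Q i)" for y
    proof -
      note y' = y[unfolded Suc]
      have uy: "u i y \<in> carrier (P i)" by (rule closed(2)[OF y])
      have ke: "k j (e j y) \<in> carrier (Q i)" unfolding Suc by (intro closed y')
      have ek: "e i (k i y) \<in> carrier (Q i)" by (intro closed y)
      have vu: "v i (u i y) \<in> carrier (Q i)" by (intro closed y)
      interpret Qi: abelian_group "Q i" by (rule Q.P_group)
      have "c y = c (v i (u i y) \<oplus>\<^bsub>Q i\<^esub> e i (k i y) \<oplus>\<^bsub>Q i\<^esub> k j (e j y))"
        using k_Suc[OF y'] unfolding Suc[symmetric] by simp
      also have "\<dots> = c (v i (u i y)) \<oplus>\<^bsub>V\<^esub> c (e i (k i y)) \<oplus>\<^bsub>V\<^esub> c (k j (e j y))"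
        using vu ek ke by (simp add: module_homD(2)[OF c(1)])
      also have "c (e i (k i y)) = \<zero>\<^bsub>V\<^esub>" by (rule c(2)[OF closed(4)[OF y]])
      also have "c (v i (u i y)) = a (d j (u i y)) \<oplus>\<^bsub>V\<^esub> a' (d j (u i y))"
        using sum[OF uy] a(2)[OF uy] a'(2)[OF uy] by simp
      also have "d j (u i y) = u j (e j y)" using u_e[OF y'] unfolding Suc .
      finally show ?thesis
        using closed(8)[OF y'] by (simp add: module_homD(1)[OF a(1)] module_homD(1)[OF a'(1)] closed)
    qed
    ultimately show ?thesis unfolding Suc by auto
  qed
qed

text \<open>A compact cocycle lies in both \<open>C\<^sub>+\<close> and \<open>C\<^sub>-\<close> and
  has a primitive in each. Their difference is an \<open>RK\<close>-cocycle of degree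
  \<open>i\<close>, and the connecting map takes it back to the given cocycle up to a compact
  coboundary. Exactness is used in degree \<open>i + 1\<close>, one more than for
  injectivity.\<close>

lemma connecting_surjective:
  assumes FP: "type_FP TYPE('f) R K n" and i: "Suc i \<le> n"
    and f: "compact_cochain (P (Suc i)) f" "\<And>x. x \<in> carrier (P (Suc (Suc i))) \<Longrightarrow> f (d (Suc i) x) = \<zero>\<^bsub>V\<^esub>"
  obtains c g where "c \<in> module_hom RK (Q i) V" "\<And>y. y \<in> carrier (Q (Suc i)) \<Longrightarrow> c (e i y) = \<zero>\<^bsub>V\<^esub>"
    "compact_cochain (P i) g"
    "\<And>x. x \<in> carrier (P (Suc i)) \<Longrightarrow> f x = connecting i c x \<oplus>\<^bsub>V\<^esub> g (d i x)"
proof -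
  from f(1) have fh: "f \<in> module_hom RK (P (Suc i)) V" and fu: "vanishes_up (P (Suc i)) \<zero>\<^bsub>V\<^esub> f"
    and fd: "vanishes_down (P (Suc i)) \<zero>\<^bsub>V\<^esub> f" by (auto simp: compact_cochain_def)
  obtain a where a: "a \<in> module_hom RK (P i) V" "vanishes_up (P i) \<zero>\<^bsub>V\<^esub> a"
    "\<And>x. x \<in> carrier (P (Suc i)) \<Longrightarrow> a (d i x) = f x"
    using acyclic_up[OF PG FP i fh fu f(2)] by auto
  obtain a' where a': "a' \<in> module_hom RK (P i) V" "vanishes_down (P i) \<zero>\<^bsub>V\<^esub> a'"
    "\<And>x. x \<in> carrier (P (Suc i)) \<Longrightarrow> a' (d i x) = f x"
    using acyclic_down[OF PG FP i fh fd f(2)] by auto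
  let ?c' = "\<lambda>x. a x \<ominus>\<^bsub>V\<^esub> a' x"
  let ?c = "\<lambda>y. ?c' (u i y)"
  have c'h: "?c' \<in> module_hom RK (P i) V" by (rule module_hom_diff[OF V a(1) a'(1)])
  note ac = module_homD(1)[OF a(1)] and a'c = module_homD(1)[OF a'(1)] and fc = module_homD(1)[OF fh]
    and c'c = module_homD(1)[OF c'h]
  have c: "?c \<in> module_hom RK (Q i) V" by (rule module_hom_compose[OF u_hom c'h])
  have c'd: "?c' (d i x) = \<zero>\<^bsub>V\<^esub>" if "x \<in> carrier (P (Suc i))" for x
    using that by (simp add: a(3) a'(3) fc V.M.minus_eq V.M.r_neg)
  have ce: "?c (e i y) = \<zero>\<^bsub>V\<^esub>" if y: "y \<in> carrier (Q (Suc i))" for y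
    using c'd[OF closed(2)[OF y]] u_e[OF y] by simp
  \<comment> \<open>Transporting \<open>?c'\<close> to \<open>Q\<close> by \<open>u\<close> and back
    by \<open>v\<close> costs a homotopy term, \<open>?c' \<circ> h \<circ> d\<close> at
    \<open>p i (d i x)\<close>. This is the value on a boundary of a compact commutator; in degree
    zero there is no such term.\<close>
  obtain g0 where g0: "compact_cochain (P i) g0"
    and g0_eq: "\<And>x. x \<in> carrier (P (Suc i)) \<Longrightarrow>
      ?c' (p i (d i x)) = ?c' (u i (v i (p i (d i x)))) \<oplus>\<^bsub>V\<^esub> g0 (d i x)"
  proof (cases i)
    case 0
    have "compact_cochain (P i) (\<lambda>x. \<zero>\<^bsub>V\<^esub>)"
      unfolding compact_cochain_def
      by (auto intro: module_hom_zero[OF V] simp: vanishes_up_def vanishes_down_def)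
    moreover have "?c' (p i (d i x)) = ?c' (u i (v i (p i (d i x)))) \<oplus>\<^bsub>V\<^esub> \<zero>\<^bsub>V\<^esub>"
      if x: "x \<in> carrier (P (Suc i))" for x
    proof -
      let ?y = "p i (d i x)"
      have y: "?y \<in> carrier (P i)" using x by (intro closed)
      have "?c' ?y = ?c' (u i (v i ?y) \<oplus>\<^bsub>P i\<^esub> d i (h i ?y))" using h_0[OF y[unfolded 0]] unfolding 0 by simp
      also have "\<dots> = ?c' (u i (v i ?y)) \<oplus>\<^bsub>V\<^esub> ?c' (d i (h i ?y))"
        by (intro module_homD(2)[OF c'h] closed y)
      finally show ?thesis using c'd[OF closed(3)[OF y]] by simp
    qed
    ultimately show thesis by (rule that)
  next
    case (Suc j)
    let ?b = "\<lambda>x. ?c' (h j x)"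
    have b: "?b \<in> module_hom RK (P j) V"
      by (rule module_hom_compose[OF h_hom c'h[unfolded Suc]])
    let ?g = "\<lambda>x. ?b (d j (p (Suc j) x)) \<ominus>\<^bsub>V\<^esub> ?b (p j (d j x))"
    have "compact_cochain (P i) ?g" unfolding Suc by (rule compact_cochain_commutator[OF b])
    moreover have "?c' (p i (d i x)) = ?c' (u i (v i (p i (d i x)))) \<oplus>\<^bsub>V\<^esub> ?g (d i x)"
      if x: "x \<in> carrier (P (Suc i))" for x
    proof -
      let ?y = "p i (d i x)"
      have y: "?y \<in> carrier (P i)" using x by (intro closed)
      note y' = y[unfolded Suc]
      interpret Pi: abelian_group "P i" by (rule P.P_group)
      have cl: "u i (v i ?y) \<in> carrier (P i)" "d i (h i ?y) \<in> carrier (P i)" "h j (d j ?y) \<in> carrier (P i)"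
        using y y' closed(3)[OF closed(7)[OF y']] by (auto intro: closed simp: Suc)
      have "?c' ?y = ?c' (u i (v i ?y) \<oplus>\<^bsub>P i\<^esub> d i (h i ?y) \<oplus>\<^bsub>P i\<^esub> h j (d j ?y))"
        using h_Suc[OF y'] unfolding Suc[symmetric] by simp
      also have "\<dots> = ?c' (u i (v i ?y)) \<oplus>\<^bsub>V\<^esub> ?c' (d i (h i ?y)) \<oplus>\<^bsub>V\<^esub> ?c' (h j (d j ?y))"
        using cl module_homD(2)[OF c'h] by simp
      also have "?c' (d i (h i ?y)) = \<zero>\<^bsub>V\<^esub>" by (rule c'd[OF closed(3)[OF y]])
      finally have 1: "?c' ?y = ?c' (u i (v i ?y)) \<oplus>\<^bsub>V\<^esub> ?b (d j ?y)"
        using c'c[OF cl(1)] by simp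
      have "d j (d i x) = \<zero>\<^bsub>P j\<^esub>" using P.d_d x unfolding Suc by blast
      then have "?b (p j (d j (d i x))) = \<zero>\<^bsub>V\<^esub>"
        using P_apply_zero[OF module_hom_compose[OF p b]] by simp
      then have 2: "?g (d i x) = ?b (d j ?y)"
        using c'c[OF cl(3)] unfolding Suc[symmetric] by (simp only: V.M.minus_eq) simp
      show ?thesis using 1 unfolding 2 .
    qed
    ultimately show thesis by (rule that)
  qed
  \<comment> \<open>As \<open>?c'\<close> is \<open>a\<close> minus \<open>a'\<close> and
    \<open>p + q\<close> is the identity, \<open>a\<close> is the sum of
    \<open>?c' \<circ> p\<close>, \<open>a \<circ> q\<close> and \<open>a' \<circ> p\<close>. The
    last two are compact: each combines a cochain vanishing at one end with the map that forces
    vanishing at the other.\<close>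
  let ?g = "\<lambda>x. a (q i x) \<oplus>\<^bsub>V\<^esub> a' (p i x) \<oplus>\<^bsub>V\<^esub> g0 x"
  have g: "compact_cochain (P i) ?g"
    by (intro compact_cochain_add compact_cochain_down_q[OF a(1,2)] compact_cochain_up_p[OF a'(1,2)] g0)
  have g0c: "g0 y \<in> carrier V" if "y \<in> carrier (P i)" for y
    using g0 module_homD(1) that by (auto simp: compact_cochain_def)
  have "f x = connecting i ?c x \<oplus>\<^bsub>V\<^esub> ?g (d i x)" if x: "x \<in> carrier (P (Suc i))" for x
  proof -
    let ?y = "d i x"
    have y: "?y \<in> carrier (P i)" by (rule P.d_closed[OF x])
    have cl: "a (p i ?y) \<in> carrier V" "a (q i ?y) \<in> carrier V" "a' (p i ?y) \<in> carrier V"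
      "g0 ?y \<in> carrier V" "?c' (u i (v i (p i ?y))) \<in> carrier V"
      using y by (auto intro!: ac a'c g0c c'c closed)
    have "f x = a (p i ?y) \<oplus>\<^bsub>V\<^esub> a (q i ?y)" using a(3)[OF x] split_pq[OF a(1) y] by simp
    also have "\<dots> = ?c' (p i ?y) \<oplus>\<^bsub>V\<^esub> (a (q i ?y) \<oplus>\<^bsub>V\<^esub> a' (p i ?y))"
      using cl by (simp add: V.M.group_simps V.M.group_cancel)
    also have "?c' (p i ?y) = connecting i ?c x \<oplus>\<^bsub>V\<^esub> g0 ?y"
      using g0_eq[OF x] by (simp only: connecting_def)
    also have "\<dots> \<oplus>\<^bsub>V\<^esub> (a (q i ?y) \<oplus>\<^bsub>V\<^esub> a' (p i ?y)) = connecting i ?c x \<oplus>\<^bsub>V\<^esub> ?g ?y"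
      using cl unfolding connecting_def by (simp only: V.M.a_ac V.M.a_closed)
    finally show ?thesis .
  qed
  then show thesis by (intro that[OF c ce g])
qed

end

section \<open>Quotient modules\<close>

lemma group_cong:
  assumes "group A" "carrier B = carrier A" "mult B = mult A" "one B = one A"
  shows "group B"
proof -
  interpret A: group A by fact
  show ?thesis
    by (rule groupI) (use A.l_inv_ex in \<open>auto simp: assms(2-4) A.m_assoc\<close>)
qed

text \<open>What lets sums and scalar multiples pass to cosets. The scalars enter through
  \<open>carrier S\<close>, so the group ring over \<open>opposite_ring R\<close> can act here as a
  mere set of operators.\<close>

locale quotient_data = M: abelian_group M
  for S :: "('s, 'u) ring_scheme" and M :: "('s, 'a, 'v) module_scheme" and B :: "'a set" +
  assumes B_subgroup: "subgroup B (add_monoid M)"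
    and smult_closed: "a \<in> carrier S \<Longrightarrow> x \<in> carrier M \<Longrightarrow> a \<odot>\<^bsub>M\<^esub> x \<in> carrier M"
    and smult_add: "a \<in> carrier S \<Longrightarrow> x \<in> carrier M \<Longrightarrow> y \<in> carrier M \<Longrightarrow>
      a \<odot>\<^bsub>M\<^esub> (x \<oplus>\<^bsub>M\<^esub> y) = a \<odot>\<^bsub>M\<^esub> x \<oplus>\<^bsub>M\<^esub> a \<odot>\<^bsub>M\<^esub> y"
    and smult_B: "a \<in> carrier S \<Longrightarrow> x \<in> B \<Longrightarrow> a \<odot>\<^bsub>M\<^esub> x \<in> B"
begin

sublocale abelian_subgroup B M
  by (rule abelian_subgroupI3) (intro additive_subgroup.intro B_subgroup M.abelian_group_axioms)+

abbreviation quot where "quot \<equiv> quotient_module M B"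

lemma B_carrier: "x \<in> B \<Longrightarrow> x \<in> carrier M"
  using a_subset by blast

lemma quot_carrier: "carrier quot = (\<lambda>x. B +>\<^bsub>M\<^esub> x) ` carrier M"
  by (auto simp: quotient_module_def A_RCOSETS_def' a_r_coset_def')

lemma quot_add:
  "x \<in> carrier M \<Longrightarrow> y \<in> carrier M \<Longrightarrow> (B +>\<^bsub>M\<^esub> x) \<oplus>\<^bsub>quot\<^esub> (B +>\<^bsub>M\<^esub> y) = B +>\<^bsub>M\<^esub> (x \<oplus>\<^bsub>M\<^esub> y)"
  by (simp add: quotient_module_def a_rcos_sum)

lemma coset_eq_iff:
  assumes "x \<in> carrier M" "y \<in> carrier M"
  shows "B +>\<^bsub>M\<^esub> x = B +>\<^bsub>M\<^esub> y \<longleftrightarrow> x \<ominus>\<^bsub>M\<^esub> y \<in> B"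
proof
  assume "B +>\<^bsub>M\<^esub> x = B +>\<^bsub>M\<^esub> y"
  then have "x \<in> B +>\<^bsub>M\<^esub> y" using a_rcos_self[OF assms(1)] by simp
  then show "x \<ominus>\<^bsub>M\<^esub> y \<in> B" using a_rcos_module[OF assms(2,1)] by (simp add: M.minus_eq)
next
  assume "x \<ominus>\<^bsub>M\<^esub> y \<in> B"
  then have "x \<in> B +>\<^bsub>M\<^esub> y" using a_rcos_module[OF assms(2,1)] by (simp add: M.minus_eq)
  then show "B +>\<^bsub>M\<^esub> x = B +>\<^bsub>M\<^esub> y" using a_repr_independence'[OF _ assms(2)] by simp
qed

text \<open>The product in \<open>quotient_module\<close> is a union over all representatives. As
  \<open>B\<close> is stable under scalars, every representative yields the same coset, and the
  union is that coset.\<close>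

lemma quot_smult:
  assumes a: "a \<in> carrier S" and x: "x \<in> carrier M"
  shows "a \<odot>\<^bsub>quot\<^esub> (B +>\<^bsub>M\<^esub> x) = B +>\<^bsub>M\<^esub> (a \<odot>\<^bsub>M\<^esub> x)"
proof -
  have "B +>\<^bsub>M\<^esub> (a \<odot>\<^bsub>M\<^esub> y) = B +>\<^bsub>M\<^esub> (a \<odot>\<^bsub>M\<^esub> x)" if "y \<in> B +>\<^bsub>M\<^esub> x" for y
  proof -
    define b where "b = y \<oplus>\<^bsub>M\<^esub> \<ominus>\<^bsub>M\<^esub> x"
    have "y \<in> carrier M" using that M.a_r_coset_subset_G[OF a_subset x] by blast
    then have b: "b \<in> B" "y = b \<oplus>\<^bsub>M\<^esub> x"
      using a_rcos_module_imp[OF x that] x by (simp_all add: b_def M.a_assoc M.l_neg)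
    then have "a \<odot>\<^bsub>M\<^esub> y = a \<odot>\<^bsub>M\<^esub> b \<oplus>\<^bsub>M\<^esub> a \<odot>\<^bsub>M\<^esub> x" using a x by (simp add: smult_add B_carrier)
    moreover have "a \<odot>\<^bsub>M\<^esub> b \<in> B" by (rule smult_B[OF a b(1)])
    moreover have "a \<odot>\<^bsub>M\<^esub> x \<in> carrier M" by (rule smult_closed[OF a x])
    ultimately show ?thesis
      by (simp add: coset_eq_iff B_carrier M.minus_eq M.a_assoc M.r_neg)
  qed
  then have "(\<Union>y\<in>B +>\<^bsub>M\<^esub> x. B +>\<^bsub>M\<^esub> (a \<odot>\<^bsub>M\<^esub> y)) = B +>\<^bsub>M\<^esub> (a \<odot>\<^bsub>M\<^esub> x)"
    by (intro UN_constant_eq[OF a_rcos_self[OF x]] ballI)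
  then show ?thesis by (simp add: quotient_module_def)
qed

lemma quot_group: "group (add_monoid quot)"
  by (rule group_cong[OF a_factorgroup_is_group])
    (simp_all add: quotient_module_def A_FactGroup_def FactGroup_def A_RCOSETS_def set_add_def)

lemma quot_cases:
  assumes "X \<in> carrier quot"
  obtains x where "x \<in> carrier M" "X = B +>\<^bsub>M\<^esub> x"
  using assms unfolding quot_carrier by (rule imageE)

lemma coset_closed: "x \<in> carrier M \<Longrightarrow> B +>\<^bsub>M\<^esub> x \<in> carrier quot"
  unfolding quot_carrier by (rule imageI)

lemma quot_add_closed:
  assumes "X \<in> carrier quot" "Y \<in> carrier quot"
  shows "X \<oplus>\<^bsub>quot\<^esub> Y \<in> carrier quot"
proof -
  obtain x y where "x \<in> carrier M" "X = B +>\<^bsub>M\<^esub> x" "y \<in> carrier M" "Y = B +>\<^bsub>M\<^esub> y"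
    using assms by (metis quot_cases)
  then show ?thesis using coset_closed[of "x \<oplus>\<^bsub>M\<^esub> y"] by (simp add: quot_add)
qed

lemma quot_smult_closed:
  assumes "a \<in> carrier S" "X \<in> carrier quot"
  shows "a \<odot>\<^bsub>quot\<^esub> X \<in> carrier quot"
proof -
  obtain x where "x \<in> carrier M" "X = B +>\<^bsub>M\<^esub> x" using assms(2) by (rule quot_cases)
  then show ?thesis using coset_closed[OF smult_closed[OF assms(1)]] assms(1) by (simp add: quot_smult)
qed

end

lemma module_isomorphic_sym:
  assumes "module_isomorphic S A B"
    and "\<And>x y. \<lbrakk>x \<in> carrier A; y \<in> carrier A\<rbrakk> \<Longrightarrow> x \<oplus>\<^bsub>A\<^esub> y \<in> carrier A"
    and "\<And>a x. \<lbrakk>a \<in> carrier S; x \<in> carrier A\<rbrakk> \<Longrightarrow> a \<odot>\<^bsub>A\<^esub> x \<in> carrier A"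
  shows "module_isomorphic S B A"
proof -
  obtain f where f: "f \<in> module_hom S A B" and bij: "bij_betw f (carrier A) (carrier B)"
    using assms(1) by (auto simp: module_isomorphic_def)
  let ?g = "inv_into (carrier A) f"
  have inj: "inj_on f (carrier A)" and im: "f ` carrier A = carrier B"
    using bij by (auto simp: bij_betw_def)
  have g: "?g (f x) = x" if "x \<in> carrier A" for x by (rule inv_into_f_f[OF inj that])
  have obt: "\<exists>x\<in>carrier A. y = f x" if "y \<in> carrier B" for y using that im by blast
  have "?g \<in> module_hom S B A"
  proof (rule module_homI)
    fix x assume "x \<in> carrier B"
    then show "?g x \<in> carrier A" using obt g by metis
  next
    fix x y assume "x \<in> carrier B" "y \<in> carrier B"
    then obtain x' y' where "x' \<in> carrier A" "x = f x'" "y' \<in> carrier A" "y = f y'" using obt by blast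
    then show "?g (x \<oplus>\<^bsub>B\<^esub> y) = ?g x \<oplus>\<^bsub>A\<^esub> ?g y"
      using assms(2) by (simp add: g flip: module_homD(2)[OF f])
  next
    fix a x assume a: "a \<in> carrier S" and "x \<in> carrier B"
    then obtain x' where "x' \<in> carrier A" "x = f x'" using obt by blast
    then show "?g (a \<odot>\<^bsub>B\<^esub> x) = a \<odot>\<^bsub>A\<^esub> ?g x"
      using assms(3) a by (simp add: g flip: module_homD(3)[OF f])
  qed
  moreover have "bij_betw ?g (carrier B) (carrier A)" by (rule bij_betw_inv_into[OF bij])
  ultimately show ?thesis unfolding module_isomorphic_def by blast
qed

text \<open>Since the preimage of \<open>B2\<close> is exactly \<open>B1\<close>, the induced map on
  cosets is well defined and injective at once.\<close>

lemma quotient_embedding: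
  assumes "quotient_data S M1 B1" "quotient_data S M2 B2"
    and f: "f \<in> module_hom S M1 M2" and ker: "\<And>x. x \<in> carrier M1 \<Longrightarrow> f x \<in> B2 \<longleftrightarrow> x \<in> B1"
  defines "N \<equiv> (\<lambda>x. B2 +>\<^bsub>M2\<^esub> f x) ` carrier M1"
  shows "submodule N S (quotient_module M2 B2)"
    and "module_isomorphic S (quotient_module M1 B1) ((quotient_module M2 B2)\<lparr>carrier := N\<rparr>)"
proof -
  interpret M1: quotient_data S M1 B1 by fact
  interpret M2: quotient_data S M2 B2 by fact
  interpret f: abelian_group_hom M1 M2 f
    by (rule module_hom_abelian_group_hom[OF f]) unfold_locales
  note fc = module_homD(1)[OF f]
  let ?q = "\<lambda>x. B2 +>\<^bsub>M2\<^esub> f x"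
  have eq_iff: "?q x = ?q y \<longleftrightarrow> B1 +>\<^bsub>M1\<^esub> x = B1 +>\<^bsub>M1\<^esub> y" if "x \<in> carrier M1" "y \<in> carrier M1" for x y
    using that fc ker[of "x \<ominus>\<^bsub>M1\<^esub> y"]
    by (simp add: M2.coset_eq_iff M1.coset_eq_iff f.hom_minus)
  have qN: "?q x \<in> N" if "x \<in> carrier M1" for x unfolding N_def using that by (rule imageI)
  have N_carrier: "N \<subseteq> carrier M2.quot" using fc by (auto simp: N_def M2.quot_carrier)
  have add: "?q x \<oplus>\<^bsub>M2.quot\<^esub> ?q y = ?q (x \<oplus>\<^bsub>M1\<^esub> y)" if "x \<in> carrier M1" "y \<in> carrier M1" for x y
    using that fc by (simp add: M2.quot_add module_homD(2)[OF f])
  have smult: "a \<odot>\<^bsub>M2.quot\<^esub> ?q x = ?q (a \<odot>\<^bsub>M1\<^esub> x)" if "a \<in> carrier S" "x \<in> carrier M1" for a x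
    using that fc by (simp add: M2.quot_smult module_homD(3)[OF f])
  have zero: "?q \<zero>\<^bsub>M1\<^esub> = \<one>\<^bsub>add_monoid M2.quot\<^esub>"
  proof -
    have "B2 +>\<^bsub>M2\<^esub> \<zero>\<^bsub>M2\<^esub> = B2" by (rule M2.M.a_coset_add_zero[OF M2.a_subset])
    then show ?thesis by (simp add: quotient_module_def)
  qed
  show "submodule N S M2.quot"
  proof (intro submodule.intro submodule_axioms.intro group.subgroupI[OF M2.quot_group])
    show "N \<subseteq> carrier (add_monoid M2.quot)" using N_carrier by simp
    show "N \<noteq> {}" by (auto simp: N_def)
    fix X assume X: "X \<in> N"
    then obtain x where x: "x \<in> carrier M1" "X = ?q x" by (auto simp: N_def)
    have "inv\<^bsub>add_monoid M2.quot\<^esub> X = ?q (\<ominus>\<^bsub>M1\<^esub> x)"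
    proof (rule group.inv_equality[OF M2.quot_group])
      show "?q (\<ominus>\<^bsub>M1\<^esub> x) \<otimes>\<^bsub>add_monoid M2.quot\<^esub> X = \<one>\<^bsub>add_monoid M2.quot\<^esub>"
        unfolding zero[symmetric] using add[of "\<ominus>\<^bsub>M1\<^esub> x" x] x by (simp add: M1.M.l_neg del: f.hom_zero)
      show "?q (\<ominus>\<^bsub>M1\<^esub> x) \<in> carrier (add_monoid M2.quot)" "X \<in> carrier (add_monoid M2.quot)"
        using x fc by (auto simp: M2.quot_carrier)
    qed
    then show "inv\<^bsub>add_monoid M2.quot\<^esub> X \<in> N" using qN[OF M1.M.a_inv_closed[OF x(1)]] by metis
    fix Y assume "Y \<in> N"
    then obtain y where y: "y \<in> carrier M1" "Y = ?q y" by (auto simp: N_def)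
    then show "X \<otimes>\<^bsub>add_monoid M2.quot\<^esub> Y \<in> N"
      using x add[OF x(1) y(1)] qN[OF M1.M.a_closed[OF x(1) y(1)]] by (metis monoid.simps(1))
  next
    fix a X assume a: "a \<in> carrier S" and "X \<in> N"
    then obtain x where x: "x \<in> carrier M1" "X = ?q x" by (auto simp: N_def)
    then show "a \<odot>\<^bsub>M2.quot\<^esub> X \<in> N" using qN[OF M1.smult_closed[OF a x(1)]] a smult by simp
  qed
  \<comment> \<open>The union over a coset of values that all agree, which avoids choosing
    representatives.\<close>
  define \<Psi> where "\<Psi> X = (\<Union>x\<in>X. ?q x)" for X
  have \<Psi>: "\<Psi> (B1 +>\<^bsub>M1\<^esub> x) = ?q x" if x: "x \<in> carrier M1" for x
  proof -
    have "?q y = ?q x" if "y \<in> B1 +>\<^bsub>M1\<^esub> x" for y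
    proof -
      have y: "y \<in> carrier M1" using that M1.M.a_r_coset_subset_G[OF M1.a_subset x] by blast
      have "B1 +>\<^bsub>M1\<^esub> y = B1 +>\<^bsub>M1\<^esub> x"
        using M1.a_repr_independence'[OF that x] by simp
      then show ?thesis using eq_iff[OF y x] by simp
    qed
    then show ?thesis unfolding \<Psi>_def by (intro UN_constant_eq[OF M1.a_rcos_self[OF x]] ballI)
  qed
  have "\<Psi> \<in> module_hom S M1.quot (M2.quot\<lparr>carrier := N\<rparr>)"
  proof (rule module_homI)
    fix X assume "X \<in> carrier M1.quot"
    then show "\<Psi> X \<in> carrier (M2.quot\<lparr>carrier := N\<rparr>)" by (auto simp: M1.quot_carrier \<Psi> N_def)
  next
    fix X Y assume "X \<in> carrier M1.quot" "Y \<in> carrier M1.quot"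
    then show "\<Psi> (X \<oplus>\<^bsub>M1.quot\<^esub> Y) = \<Psi> X \<oplus>\<^bsub>M2.quot\<lparr>carrier := N\<rparr>\<^esub> \<Psi> Y"
      by (auto simp: M1.quot_carrier M1.quot_add \<Psi> add)
  next
    fix a X assume "a \<in> carrier S" "X \<in> carrier M1.quot"
    then show "\<Psi> (a \<odot>\<^bsub>M1.quot\<^esub> X) = a \<odot>\<^bsub>M2.quot\<lparr>carrier := N\<rparr>\<^esub> \<Psi> X"
      by (auto simp: M1.quot_carrier M1.quot_smult M1.smult_closed \<Psi> smult)
  qed
  moreover have "bij_betw \<Psi> (carrier M1.quot) N"
  proof (rule bij_betwI')
    fix X Y assume "X \<in> carrier M1.quot" "Y \<in> carrier M1.quot"
    then show "\<Psi> X = \<Psi> Y \<longleftrightarrow> X = Y" by (auto simp: M1.quot_carrier \<Psi> eq_iff)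
  qed (auto simp: M1.quot_carrier \<Psi> N_def)
  ultimately show "module_isomorphic S M1.quot (M2.quot\<lparr>carrier := N\<rparr>)"
    unfolding module_isomorphic_def by auto
qed

text \<open>Surjectivity modulo \<open>B2\<close> makes the image of the embedding the whole
  quotient. The inverse is taken because the theorem names the cohomology of \<open>G\<close>, the
  target of the connecting map, first.\<close>

lemma quotient_isomorphism:
  assumes "quotient_data S M1 B1" "quotient_data S M2 B2"
    and f: "f \<in> module_hom S M1 M2" and ker: "\<And>x. x \<in> carrier M1 \<Longrightarrow> f x \<in> B2 \<longleftrightarrow> x \<in> B1"
    and surj: "\<And>y. y \<in> carrier M2 \<Longrightarrow> \<exists>x\<in>carrier M1. \<exists>b\<in>B2. y = b \<oplus>\<^bsub>M2\<^esub> f x"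
  shows "module_isomorphic S (quotient_module M2 B2) (quotient_module M1 B1)"
proof (rule module_isomorphic_sym)
  interpret M1: quotient_data S M1 B1 by fact
  interpret M2: quotient_data S M2 B2 by fact
  note fc = module_homD(1)[OF f]
  have "B2 +>\<^bsub>M2\<^esub> y \<in> (\<lambda>x. B2 +>\<^bsub>M2\<^esub> f x) ` carrier M1" if y: "y \<in> carrier M2" for y
  proof -
    obtain x b where xb: "x \<in> carrier M1" "b \<in> B2" "y = b \<oplus>\<^bsub>M2\<^esub> f x" using surj[OF y] by blast
    then have "y \<ominus>\<^bsub>M2\<^esub> f x = b" using fc by (simp add: M2.B_carrier M2.M.minus_eq M2.M.a_assoc M2.M.r_neg)
    then have "B2 +>\<^bsub>M2\<^esub> y = B2 +>\<^bsub>M2\<^esub> f x" using xb y fc by (simp add: M2.coset_eq_iff)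
    then show ?thesis using xb by blast
  qed
  then have "(\<lambda>x. B2 +>\<^bsub>M2\<^esub> f x) ` carrier M1 = carrier M2.quot"
    using fc by (auto simp: M2.quot_carrier)
  then show "module_isomorphic S M1.quot M2.quot"
    using quotient_embedding(2)[OF assms(1-4)] by simp
  show "X \<oplus>\<^bsub>M1.quot\<^esub> Y \<in> carrier M1.quot" if "X \<in> carrier M1.quot" "Y \<in> carrier M1.quot" for X Y
    by (rule M1.quot_add_closed[OF that])
  show "a \<odot>\<^bsub>M1.quot\<^esub> X \<in> carrier M1.quot" if "a \<in> carrier S" "X \<in> carrier M1.quot" for a X
    by (rule M1.quot_smult_closed[OF that])
qed

section \<open>Cochains with group ring coefficients\<close>

context group_algebra
begin

abbreviation V where "V \<equiv> regular_module RH"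

lemma V: "left_module RH V"
  by (rule A.regular_left_module)

lemma V_simps: "carrier V = carrier RH" "add V = add RH" "zero V = zero RH" "smult V = mult RH"
  by (simp_all add: regular_module_def)

lemma cochains_simps:
  "carrier (cochains R H X) = module_hom RH X V \<inter> extensional (carrier X)"
  "zero (cochains R H X) = (\<lambda>x\<in>carrier X. \<zero>\<^bsub>RH\<^esub>)"
  "add (cochains R H X) = (\<lambda>f h. \<lambda>x\<in>carrier X. f x \<oplus>\<^bsub>RH\<^esub> h x)"
  "smult (cochains R H X) = (\<lambda>a f. \<lambda>x\<in>carrier X. f x \<otimes>\<^bsub>RH\<^esub> group_ring_inversion R H a)"
  by (simp_all add: cochains_def)

lemma hom_V_closed: "f \<in> module_hom RH X V \<Longrightarrow> x \<in> carrier X \<Longrightarrow> f x \<in> carrier RH"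
  using module_homD(1) V_simps(1) by metis

text \<open>Linearity turns a coefficient at \<open>g\<close> into the coefficient at the identity
  of a translated argument. So a linear map into the group ring is determined by its coefficients at
  the identity; the same formula later defines the extension from \<open>K\<close> to
  \<open>G\<close>.\<close>

lemma hom_V_apply:
  assumes "f \<in> module_hom RH X V" "x \<in> carrier X" "g \<in> carrier H"
  shows "f x g = f (monomial R (inv\<^bsub>H\<^esub> g) \<one>\<^bsub>R\<^esub> \<odot>\<^bsub>X\<^esub> x) \<one>\<^bsub>H\<^esub>"
proof -
  have "f (monomial R (inv\<^bsub>H\<^esub> g) \<one>\<^bsub>R\<^esub> \<odot>\<^bsub>X\<^esub> x) = monomial R (inv\<^bsub>H\<^esub> g) \<one>\<^bsub>R\<^esub> \<otimes>\<^bsub>RH\<^esub> f x"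
    using module_homD(3)[OF assms(1) monomial_closed assms(2), of "inv\<^bsub>H\<^esub> g" "\<one>\<^bsub>R\<^esub>"] assms(3)
    by (simp add: V_simps)
  then show ?thesis
    using assms hom_V_closed[OF assms(1,2)] carrierD(1)[OF hom_V_closed[OF assms(1,2)]]
    by (simp add: monomial_mult_apply)
qed

lemma hom_V_eqI:
  assumes X: "left_module RH X" and f: "f \<in> module_hom RH X V" and g: "g \<in> module_hom RH X V"
    and eq: "\<And>x. x \<in> carrier X \<Longrightarrow> f x \<one>\<^bsub>H\<^esub> = g x \<one>\<^bsub>H\<^esub>" and x: "x \<in> carrier X"
  shows "f x = g x"
proof
  interpret X: left_module RH X by fact
  fix y
  show "f x y = g x y"
  proof (cases "y \<in> carrier H")
    case True
    have "monomial R (inv\<^bsub>H\<^esub> y) \<one>\<^bsub>R\<^esub> \<odot>\<^bsub>X\<^esub> x \<in> carrier X"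
      using True x by (intro X.smult_closed monomial_closed) auto
    then show ?thesis
      using hom_V_apply[OF f x True] hom_V_apply[OF g x True] eq by simp
  next
    case False
    then show ?thesis
      using carrierD(2)[OF hom_V_closed[OF f x]] carrierD(2)[OF hom_V_closed[OF g x]] by simp
  qed
qed

lemma inversion_closed:
  assumes "a \<in> carrier RH"
  shows "group_ring_inversion R H a \<in> carrier RH"
proof (rule carrierI)
  show "finite (m_inv H ` {g. a g \<noteq> \<zero>\<^bsub>R\<^esub>})" using carrierD(3)[OF assms] by simp
  fix g assume g: "g \<in> carrier H" "g \<notin> m_inv H ` {g. a g \<noteq> \<zero>\<^bsub>R\<^esub>}"
  have "a (inv\<^bsub>H\<^esub> g) = \<zero>\<^bsub>R\<^esub>"
  proof (rule ccontr)
    assume "a (inv\<^bsub>H\<^esub> g) \<noteq> \<zero>\<^bsub>R\<^esub>"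
    then have "inv\<^bsub>H\<^esub> (inv\<^bsub>H\<^esub> g) \<in> m_inv H ` {g. a g \<noteq> \<zero>\<^bsub>R\<^esub>}" by blast
    then show False using g by simp
  qed
  then show "group_ring_inversion R H a g = \<zero>\<^bsub>R\<^esub>" by (simp add: group_ring_inversion_def)
qed (simp_all add: group_ring_inversion_def carrierD(1)[OF assms])

text \<open>The inversion cancels the one in the convolution and leaves a pairing of coefficients.
  For \<open>a\<close> supported on \<open>K\<close> it involves only the coefficients of
  \<open>b\<close> on \<open>K\<close>, which is how the actions over \<open>K\<close> and over
  \<open>G\<close> are matched.\<close>

lemma mult_inversion_one:
  assumes a: "a \<in> carrier RH" and b: "b \<in> carrier RH"
  shows "(b \<otimes>\<^bsub>RH\<^esub> group_ring_inversion R H a) \<one>\<^bsub>H\<^esub> = (\<Oplus>\<^bsub>R\<^esub>g\<in>{g. a g \<noteq> \<zero>\<^bsub>R\<^esub>}. b g \<otimes>\<^bsub>R\<^esub> a g)"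
proof -
  let ?B = "{g. b g \<noteq> \<zero>\<^bsub>R\<^esub>} \<union> {g. a g \<noteq> \<zero>\<^bsub>R\<^esub>}"
  have B: "finite ?B" "?B \<subseteq> carrier H" using carrierD[OF a] carrierD[OF b] by auto
  have "(b \<otimes>\<^bsub>RH\<^esub> group_ring_inversion R H a) \<one>\<^bsub>H\<^esub> =
      (\<Oplus>\<^bsub>R\<^esub>g\<in>?B. b g \<otimes>\<^bsub>R\<^esub> group_ring_inversion R H a (inv\<^bsub>H\<^esub> g \<otimes>\<^bsub>H\<^esub> \<one>\<^bsub>H\<^esub>))"
    by (rule mult_apply[OF b inversion_closed[OF a] _ B]) auto
  also have "\<dots> = (\<Oplus>\<^bsub>R\<^esub>g\<in>?B. b g \<otimes>\<^bsub>R\<^esub> a g)"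
  proof (rule R.finsum_cong')
    fix g assume "g \<in> ?B"
    then have "g \<in> carrier H" using B by blast
    then show "b g \<otimes>\<^bsub>R\<^esub> group_ring_inversion R H a (inv\<^bsub>H\<^esub> g \<otimes>\<^bsub>H\<^esub> \<one>\<^bsub>H\<^esub>) = b g \<otimes>\<^bsub>R\<^esub> a g"
      by (simp add: group_ring_inversion_def)
  qed (use carrierD(1)[OF a] carrierD(1)[OF b] in auto)
  also have "\<dots> = (\<Oplus>\<^bsub>R\<^esub>g\<in>{g. a g \<noteq> \<zero>\<^bsub>R\<^esub>}. b g \<otimes>\<^bsub>R\<^esub> a g)"
    using B carrierD(1)[OF a] carrierD(1)[OF b] by (intro R.finsum_remove_zeros[symmetric]) auto
  finally show ?thesis .
qed

lemma hom_V_mult_right: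
  assumes X: "left_module RH X" and f: "f \<in> module_hom RH X V" and b: "b \<in> carrier RH"
  shows "(\<lambda>x. f x \<otimes>\<^bsub>RH\<^esub> b) \<in> module_hom RH X V"
  using b hom_V_closed[OF f] module_homD(2,3)[OF f]
  by (intro module_homI) (simp_all add: V_simps A.l_distr A.m_assoc)

lemma cocyclesD:
  assumes "f \<in> cocycles R H P d i"
  shows "f \<in> module_hom RH (P i) V" "f \<in> extensional (carrier (P i))"
    "x \<in> carrier (P (Suc i)) \<Longrightarrow> f (d i x) = \<zero>\<^bsub>RH\<^esub>"
  using assms by (auto simp: cocycles_def cochains_simps)

lemma cocyclesI:
  assumes "left_module RH (P i)" "d i \<in> module_hom RH (P (Suc i)) (P i)"
    and "f \<in> module_hom RH (P i) V" "\<And>x. x \<in> carrier (P (Suc i)) \<Longrightarrow> f (d i x) = \<zero>\<^bsub>RH\<^esub>"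
  shows "restrict f (carrier (P i)) \<in> cocycles R H P d i"
  using assms module_homD(1)[OF assms(2)]
  by (simp add: cocycles_def cochains_simps module_hom_restrict)

text \<open>Trades the extensional representatives of the definition for linear maps and pointwise
  equations, the form in which the results on the connecting map are stated.\<close>

lemma coboundaries_iff:
  assumes P: "\<And>i. left_module RH (P i)" and d: "\<And>i. d i \<in> module_hom RH (P (Suc i)) (P i)"
    and f: "f \<in> extensional (carrier (P i))"
  shows "f \<in> coboundaries R H P d i \<longleftrightarrow>
    (case i of 0 \<Rightarrow> \<forall>x\<in>carrier (P 0). f x = \<zero>\<^bsub>RH\<^esub>
     | Suc j \<Rightarrow> \<exists>b\<in>module_hom RH (P j) V. \<forall>x\<in>carrier (P i). f x = b (d j x))"
proof (cases i)
  case 0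
  have "f = (\<lambda>x\<in>carrier (P 0). \<zero>\<^bsub>RH\<^esub>) \<longleftrightarrow> (\<forall>x\<in>carrier (P 0). f x = \<zero>\<^bsub>RH\<^esub>)"
    using f[unfolded 0] by (auto intro!: extensionalityI[of _ "carrier (P 0)"])
  then show ?thesis by (simp add: 0 cochains_simps)
next
  case (Suc j)
  have "f \<in> coboundaries R H P d (Suc j) \<longleftrightarrow>
      (\<exists>b\<in>carrier (cochains R H (P j)). \<forall>x\<in>carrier (P (Suc j)). f x = b (d j x))"
    using f[unfolded Suc] by (auto intro!: image_eqI extensionalityI[of _ "carrier (P (Suc j))"])
  also have "\<dots> \<longleftrightarrow> (\<exists>b\<in>module_hom RH (P j) V. \<forall>x\<in>carrier (P (Suc j)). f x = b (d j x))"
  proof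
    assume "\<exists>b\<in>module_hom RH (P j) V. \<forall>x\<in>carrier (P (Suc j)). f x = b (d j x)"
    then obtain b where b: "b \<in> module_hom RH (P j) V" "\<forall>x\<in>carrier (P (Suc j)). f x = b (d j x)" by blast
    then show "\<exists>b\<in>carrier (cochains R H (P j)). \<forall>x\<in>carrier (P (Suc j)). f x = b (d j x)"
      using module_homD(1)[OF d[of j]]
      by (intro bexI[of _ "restrict b (carrier (P j))"]) (simp_all add: cochains_simps module_hom_restrict[OF P])
  qed (auto simp: cochains_simps)
  finally show ?thesis by (simp add: Suc)
qed

lemma quotient_data_cohomology:
  assumes res: "resolution RH M P d \<epsilon>" and S: "carrier S \<subseteq> carrier RH"
  shows "quotient_data S ((cochains R H (P i))\<lparr>carrier := cocycles R H P d i\<rparr>) (coboundaries R H P d i)"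
proof -
  interpret P: resolution RH M P d \<epsilon> by fact
  interpret V: left_module RH V by (rule V)
  let ?Z = "cocycles R H P d i" and ?X = "carrier (P i)" and ?B = "coboundaries R H P d i"
  let ?M = "(cochains R H (P i))\<lparr>carrier := ?Z\<rparr>"
  note Z = cocyclesD
  have zc: "f x \<in> carrier RH" if "f \<in> ?Z" "x \<in> ?X" for f x
    by (rule hom_V_closed[OF Z(1)[OF that(1)] that(2)])
  have M: "carrier ?M = ?Z" "zero ?M = (\<lambda>x\<in>?X. \<zero>\<^bsub>RH\<^esub>)" "add ?M = (\<lambda>f h. \<lambda>x\<in>?X. f x \<oplus>\<^bsub>RH\<^esub> h x)"
    "smult ?M = (\<lambda>a f. \<lambda>x\<in>?X. f x \<otimes>\<^bsub>RH\<^esub> group_ring_inversion R H a)"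
    by (simp_all add: cochains_simps)
  have eqI: "f = g" if "f \<in> extensional ?X" "g \<in> extensional ?X" "\<And>x. x \<in> ?X \<Longrightarrow> f x = g x" for f g :: "'c \<Rightarrow> 'g \<Rightarrow> 'r"
    using that by (rule extensionalityI)
  have add_Z: "(\<lambda>x\<in>?X. f x \<oplus>\<^bsub>RH\<^esub> h x) \<in> ?Z" if "f \<in> ?Z" "h \<in> ?Z" for f h
    using module_hom_add[OF V Z(1)[OF that(1)] Z(1)[OF that(2)]] that
    by (intro cocyclesI P.P P.d) (simp_all add: V_simps Z(3))
  have zero_Z: "(\<lambda>x\<in>?X. \<zero>\<^bsub>RH\<^esub>) \<in> ?Z"
    using module_hom_zero[OF V, of "P i"] by (intro cocyclesI P.P P.d) (simp_all add: V_simps)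
  have mult_Z: "(\<lambda>x\<in>?X. f x \<otimes>\<^bsub>RH\<^esub> c) \<in> ?Z" if "f \<in> ?Z" "c \<in> carrier RH" for f c
    using hom_V_mult_right[OF P.P Z(1)[OF that(1)] that(2)] that
    by (intro cocyclesI P.P P.d) (simp_all add: Z(3))
  \<comment> \<open>Right multiplication by this element is negation, so closure under negatives
    becomes a case of closure under right multiplication.\<close>
  have minus_one: "\<zero>\<^bsub>RH\<^esub> \<ominus>\<^bsub>RH\<^esub> \<one>\<^bsub>RH\<^esub> \<in> carrier RH" by simp
  have group: "abelian_group ?M"
  proof (rule abelian_groupI, unfold M)
    fix f g k assume *: "f \<in> ?Z" "g \<in> ?Z" "k \<in> ?Z"
    show "(\<lambda>x\<in>?X. (\<lambda>x\<in>?X. f x \<oplus>\<^bsub>RH\<^esub> g x) x \<oplus>\<^bsub>RH\<^esub> k x) = (\<lambda>x\<in>?X. f x \<oplus>\<^bsub>RH\<^esub> (\<lambda>x\<in>?X. g x \<oplus>\<^bsub>RH\<^esub> k x) x)"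
      using zc * by (intro eqI) (simp_all add: A.a_assoc)
  next
    fix f g assume *: "f \<in> ?Z" "g \<in> ?Z"
    show "(\<lambda>x\<in>?X. f x \<oplus>\<^bsub>RH\<^esub> g x) = (\<lambda>x\<in>?X. g x \<oplus>\<^bsub>RH\<^esub> f x)"
      using zc * by (intro eqI) (simp_all add: A.a_comm)
  next
    fix f assume f: "f \<in> ?Z"
    show "(\<lambda>x\<in>?X. (\<lambda>x\<in>?X. \<zero>\<^bsub>RH\<^esub>) x \<oplus>\<^bsub>RH\<^esub> f x) = f"
      using zc f Z(2)[OF f] by (intro eqI) simp_all
    show "\<exists>y\<in>?Z. (\<lambda>x\<in>?X. y x \<oplus>\<^bsub>RH\<^esub> f x) = (\<lambda>x\<in>?X. \<zero>\<^bsub>RH\<^esub>)"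
      using zc f by (intro bexI[OF _ mult_Z[OF f minus_one]] eqI) (simp_all add: A.minus_eq A.r_minus A.l_neg)
  qed (use add_Z zero_Z in auto)
  have Bext: "f \<in> extensional ?X" if "f \<in> ?B" for f
    using that by (cases i) (auto simp: cochains_simps)
  note B_iff = coboundaries_iff[where P = P and d = d and i = i, OF P.P P.d]
  have B_Z: "f \<in> ?Z" if f: "f \<in> ?B" for f
  proof (cases i)
    case 0
    then have "f = (\<lambda>x\<in>?X. \<zero>\<^bsub>RH\<^esub>)" using f by (simp add: cochains_simps)
    then show ?thesis using zero_Z by simp
  next
    case (Suc j)
    obtain b where b: "b \<in> module_hom RH (P j) V" "\<And>x. x \<in> ?X \<Longrightarrow> f x = b (d j x)"
      using B_iff[OF Bext[OF f]] f by (auto simp: Suc)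
    have "(\<lambda>x\<in>?X. b (d j x)) \<in> ?Z"
    proof (rule cocyclesI[where P = P and d = d and i = i, OF P.P P.d])
      show "(\<lambda>x. b (d j x)) \<in> module_hom RH (P i) V"
        unfolding Suc by (rule module_hom_compose[OF P.d b(1)])
      show "b (d j (d i x)) = \<zero>\<^bsub>RH\<^esub>" if "x \<in> carrier (P (Suc i))" for x
        using module_hom_apply_zero[OF b(1) P.P_group V.M.abelian_group_axioms] P.d_d that
        unfolding Suc by (simp add: V_simps)
    qed
    moreover have "f = (\<lambda>x\<in>?X. b (d j x))"
      using Bext[OF f] b(2) by (intro eqI) simp_all
    ultimately show ?thesis by simp
  qed
  have B_add: "(\<lambda>x\<in>?X. f x \<oplus>\<^bsub>RH\<^esub> h x) \<in> ?B" if fB: "f \<in> ?B" and hB: "h \<in> ?B" for f h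
  proof (cases i)
    case 0
    then show ?thesis using that B_iff[of f] B_iff[of h] Bext by (subst B_iff) (auto simp: 0)
  next
    case (Suc j)
    obtain b b' where b: "b \<in> module_hom RH (P j) V" "\<And>x. x \<in> ?X \<Longrightarrow> f x = b (d j x)"
      and b': "b' \<in> module_hom RH (P j) V" "\<And>x. x \<in> ?X \<Longrightarrow> h x = b' (d j x)"
      using B_iff[OF Bext[OF fB]] B_iff[OF Bext[OF hB]] fB hB by (auto simp: Suc)
    have "(\<lambda>y. b y \<oplus>\<^bsub>RH\<^esub> b' y) \<in> module_hom RH (P j) V"
      using module_hom_add[OF V b(1) b'(1)] by (simp add: V_simps)
    then show ?thesis using b(2) b'(2) by (subst B_iff) (auto simp: Suc intro!: bexI)
  qed
  have B_mult: "(\<lambda>x\<in>?X. f x \<otimes>\<^bsub>RH\<^esub> c) \<in> ?B" if fB: "f \<in> ?B" and c: "c \<in> carrier RH" for f c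
  proof (cases i)
    case 0
    then show ?thesis using that B_iff[of f] Bext by (subst B_iff) (auto simp: 0)
  next
    case (Suc j)
    obtain b where b: "b \<in> module_hom RH (P j) V" "\<And>x. x \<in> ?X \<Longrightarrow> f x = b (d j x)"
      using B_iff[OF Bext[OF fB]] fB by (auto simp: Suc)
    have "(\<lambda>y. b y \<otimes>\<^bsub>RH\<^esub> c) \<in> module_hom RH (P j) V"
      by (rule hom_V_mult_right[OF P.P b(1) c])
    then show ?thesis using b(2) by (subst B_iff) (auto simp: Suc intro!: bexI)
  qed
  show ?thesis
  proof (intro quotient_data.intro quotient_data_axioms.intro group)
    show "subgroup ?B (add_monoid ?M)"
    proof (rule group.subgroupI[OF abelian_group.a_group[OF group]])
      show "?B \<subseteq> carrier (add_monoid ?M)" using B_Z by auto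
      have "(\<lambda>x\<in>?X. \<zero>\<^bsub>RH\<^esub>) \<in> ?B"
      proof (cases i)
        case (Suc j)
        show ?thesis
          using module_hom_zero[OF V, of "P j"] by (subst B_iff) (auto simp: Suc V_simps intro!: bexI)
      qed (simp add: cochains_simps)
      then show "?B \<noteq> {}" by blast
      fix f assume f: "f \<in> ?B"
      have "inv\<^bsub>add_monoid ?M\<^esub> f = (\<lambda>x\<in>?X. f x \<otimes>\<^bsub>RH\<^esub> (\<zero>\<^bsub>RH\<^esub> \<ominus>\<^bsub>RH\<^esub> \<one>\<^bsub>RH\<^esub>))" (is "_ = ?f")
      proof (rule group.inv_equality[OF abelian_group.a_group[OF group]])
        show "?f \<otimes>\<^bsub>add_monoid ?M\<^esub> f = \<one>\<^bsub>add_monoid ?M\<^esub>"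
          using zc[OF B_Z[OF f]] by (auto simp: cochains_simps A.minus_eq A.r_minus A.l_neg intro!: restrict_ext)
        show "f \<in> carrier (add_monoid ?M)" using B_Z[OF f] by simp
        show "?f \<in> carrier (add_monoid ?M)" using B_Z[OF B_mult[OF f]] by simp
      qed
      then show "inv\<^bsub>add_monoid ?M\<^esub> f \<in> ?B" using B_mult[OF f] by simp
      fix h assume "h \<in> ?B"
      then show "f \<otimes>\<^bsub>add_monoid ?M\<^esub> h \<in> ?B" using B_add[OF f] by (simp add: cochains_simps)
    qed
  next
    fix a f assume a: "a \<in> carrier S" and "f \<in> carrier ?M"
    then have f: "f \<in> ?Z" by simp
    have a': "group_ring_inversion R H a \<in> carrier RH" using a S by (intro inversion_closed) auto
    show "a \<odot>\<^bsub>?M\<^esub> f \<in> carrier ?M" unfolding M by (rule mult_Z[OF f a'])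
    fix g assume "g \<in> carrier ?M"
    then have g: "g \<in> ?Z" by simp
    show "a \<odot>\<^bsub>?M\<^esub> (f \<oplus>\<^bsub>?M\<^esub> g) = a \<odot>\<^bsub>?M\<^esub> f \<oplus>\<^bsub>?M\<^esub> a \<odot>\<^bsub>?M\<^esub> g"
      unfolding M using zc[OF f] zc[OF g] a' by (intro eqI) (simp_all add: A.l_distr)
  next
    fix a f assume a: "a \<in> carrier S" and f: "f \<in> ?B"
    have a': "group_ring_inversion R H a \<in> carrier RH" using a S by (intro inversion_closed) auto
    show "a \<odot>\<^bsub>?M\<^esub> f \<in> ?B" unfolding M by (rule B_mult[OF f a'])
  qed
qed

end

section \<open>Compact cochains as group ring cochains\<close>

context cyclic_quotient
begin

text \<open>The inverse of taking components at \<open>K\<close>: the coefficient of an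
  \<open>RG\<close>-linear map at \<open>g\<close> is its coefficient at the identity after
  translation by the inverse of \<open>g\<close>, and the identity lies in \<open>K\<close>.\<close>

definition extend :: "('g \<Rightarrow> 'r, 'a, 'w) module_scheme \<Rightarrow> ('a \<Rightarrow> 'g \<Rightarrow> 'r) \<Rightarrow> 'a \<Rightarrow> 'g \<Rightarrow> 'r"
  where "extend M f x g =
    (if g \<in> carrier G then f (monomial R (inv\<^bsub>G\<^esub> g) \<one>\<^bsub>R\<^esub> \<odot>\<^bsub>M\<^esub> x) \<one>\<^bsub>G\<^esub> else \<zero>\<^bsub>R\<^esub>)"

definition core :: "('a \<Rightarrow> 'g \<Rightarrow> 'r) \<Rightarrow> 'a \<Rightarrow> 'g \<Rightarrow> 'r"
  where "core F x g = (if g \<in> carrier K then F x g else \<zero>\<^bsub>R\<^esub>)"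

lemma compact_cochain_hom: "compact_cochain M f \<Longrightarrow> f \<in> module_hom RK M V"
  by (simp add: compact_cochain_def)

lemma extend_K:
  assumes "f \<in> module_hom RK M V" "x \<in> carrier M" "g \<in> carrier K"
  shows "extend M f x g = f x g"
  using K.hom_V_apply[OF assms] assms(3) by (simp add: extend_def K_iff K_inv K_one)

lemma extend_one:
  assumes "f \<in> module_hom RK M V" "x \<in> carrier M"
  shows "extend M f x \<one>\<^bsub>G\<^esub> = f x \<one>\<^bsub>G\<^esub>"
  by (rule extend_K[OF assms]) (simp add: K_iff phi_one)

text \<open>Writing \<open>g\<close> as \<open>t^j k\<close> with \<open>j\<close> its value under
  \<open>\<phi>\<close> separates the two sources of finiteness: the conditions at the ends bound
  \<open>j\<close>, and \<open>f (act M (- j) x)\<close> has finite support in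
  \<open>k\<close>.\<close>

lemma extend_apply:
  assumes M: "left_module RG M" and f: "f \<in> module_hom RK M V" and x: "x \<in> carrier M" and g: "g \<in> carrier G"
  shows "extend M f x g = f (act M (- \<phi> g) x) (t [^]\<^bsub>G\<^esub> (- \<phi> g) \<otimes>\<^bsub>G\<^esub> g)"
proof -
  interpret M: left_module RG M by fact
  let ?t = "t [^]\<^bsub>G\<^esub> (- \<phi> g)"
  let ?k = "?t \<otimes>\<^bsub>G\<^esub> g"
  have t': "?t \<in> carrier G" using t by simp
  have k: "?k \<in> carrier K" using g t' by (simp add: K_iff phi_mult phi_pow)
  have kG: "inv\<^bsub>G\<^esub> ?k \<in> carrier G" using g t' by simp
  have "inv\<^bsub>G\<^esub> ?k \<otimes>\<^bsub>G\<^esub> ?t = inv\<^bsub>G\<^esub> g"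
    using g t' by (simp add: G.H.inv_mult_group G.H.m_assoc)
  then have "monomial R (inv\<^bsub>G\<^esub> g) \<one>\<^bsub>R\<^esub> = monomial R (inv\<^bsub>G\<^esub> ?k) \<one>\<^bsub>R\<^esub> \<otimes>\<^bsub>RG\<^esub> monomial R ?t \<one>\<^bsub>R\<^esub>"
    using G.monomial_mult[OF kG _ t', of "\<one>\<^bsub>R\<^esub>" "\<one>\<^bsub>R\<^esub>"] by simp
  then have "monomial R (inv\<^bsub>G\<^esub> g) \<one>\<^bsub>R\<^esub> \<odot>\<^bsub>M\<^esub> x = monomial R (inv\<^bsub>G\<^esub> ?k) \<one>\<^bsub>R\<^esub> \<odot>\<^bsub>M\<^esub> act M (- \<phi> g) x"
    unfolding act_def using M.smult_assoc1[OF G.monomial_closed[OF kG] G.monomial_closed[OF t'] x] by simp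
  then show ?thesis
    using g K.hom_V_apply[OF f act_closed[OF M x] k] by (simp add: extend_def K_inv[OF k] K_one)
qed

lemma extend_closed:
  assumes M: "left_module RG M" and f: "compact_cochain M f" and x: "x \<in> carrier M"
  shows "extend M f x \<in> carrier RG"
proof -
  interpret M: left_module RG M by fact
  note fh = compact_cochain_hom[OF f]
  note fc = K.hom_V_closed[OF fh]
  obtain N1 where N1: "\<forall>j\<ge>N1. f (act M j x) = \<zero>\<^bsub>V\<^esub>"
    using f x unfolding compact_cochain_def vanishes_up_def by blast
  obtain N2 where N2: "\<forall>j\<ge>N2. f (act M (- j) x) = \<zero>\<^bsub>V\<^esub>"
    using f x unfolding compact_cochain_def vanishes_down_def by blast
  let ?S = "\<lambda>j. (\<lambda>k. t [^]\<^bsub>G\<^esub> j \<otimes>\<^bsub>G\<^esub> k) ` {k. f (act M (- j) x) k \<noteq> \<zero>\<^bsub>R\<^esub>}"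
  show ?thesis
  proof (rule G.carrierI)
    \<comment> \<open>Here \<open>j\<close> is the value of \<open>\<phi>\<close>: the condition
      upwards excludes \<open>- j \<ge> N1\<close>, the one downwards excludes
      \<open>j \<ge> N2\<close>.\<close>
    show "finite (\<Union>j\<in>{- N1..N2}. ?S j)"
      using K.carrierD(3)[OF fc[OF act_closed[OF M x]]] by blast
    fix g assume g: "g \<in> carrier G"
    show "extend M f x g \<in> carrier R"
      using g x by (simp add: extend_def K.carrierD(1)[OF fc] M.smult_closed G.monomial_closed)
    assume n: "g \<notin> (\<Union>j\<in>{- N1..N2}. ?S j)"
    show "extend M f x g = \<zero>\<^bsub>R\<^esub>"
    proof (rule ccontr)
      let ?j = "\<phi> g"
      let ?k = "t [^]\<^bsub>G\<^esub> (- ?j) \<otimes>\<^bsub>G\<^esub> g"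
      assume "extend M f x g \<noteq> \<zero>\<^bsub>R\<^esub>"
      then have ne: "f (act M (- ?j) x) ?k \<noteq> \<zero>\<^bsub>R\<^esub>" by (simp add: extend_apply[OF M fh x g])
      then have "\<not> - ?j \<ge> N1" "\<not> ?j \<ge> N2"
        using N1 N2 by (auto simp: K.V_simps K.zero_apply)
      moreover have "t [^]\<^bsub>G\<^esub> ?j \<otimes>\<^bsub>G\<^esub> ?k = g"
        using g t by (simp add: G.H.m_assoc[symmetric] G.H.int_pow_mult[symmetric])
      then have "g \<in> ?S ?j" using ne by (intro image_eqI[of _ _ ?k]) simp_all
      ultimately show False using n by auto
    qed
  qed (simp add: extend_def)
qed

lemma extend_hom:
  assumes M: "left_module RG M" and f: "compact_cochain M f"
  shows "extend M f \<in> module_hom RG M G.V"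
proof (rule G.module_hom_monomialI[OF M G.V])
  interpret M: left_module RG M by fact
  note fh = compact_cochain_hom[OF f]
  note fc = K.hom_V_closed[OF fh]
  have mc: "monomial R h r \<odot>\<^bsub>M\<^esub> x \<in> carrier M" if "h \<in> carrier G" "r \<in> carrier R" "x \<in> carrier M" for h r x
    using that by (intro M.smult_closed G.monomial_closed)
  fix x assume x: "x \<in> carrier M"
  show "extend M f x \<in> carrier G.V" using extend_closed[OF M f x] by (simp add: G.V_simps)
  {
    fix y assume y: "y \<in> carrier M"
    show "extend M f (x \<oplus>\<^bsub>M\<^esub> y) = extend M f x \<oplus>\<^bsub>G.V\<^esub> extend M f y"
    proof
      fix g
      show "extend M f (x \<oplus>\<^bsub>M\<^esub> y) g = (extend M f x \<oplus>\<^bsub>G.V\<^esub> extend M f y) g"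
        using x y mc G.monomial_closed
        by (simp add: extend_def G.V_simps G.add_apply M.smult_r_distr module_homD(2)[OF fh] K.V_simps K.add_apply)
    qed
  }
  fix h r assume h: "h \<in> carrier G" and r: "r \<in> carrier R"
  have one: "\<one>\<^bsub>G\<^esub> \<in> carrier K" by (simp add: K_iff phi_one)
  show "extend M f (monomial R h r \<odot>\<^bsub>M\<^esub> x) = monomial R h r \<odot>\<^bsub>G.V\<^esub> extend M f x"
  proof
    fix g
    show "extend M f (monomial R h r \<odot>\<^bsub>M\<^esub> x) g = (monomial R h r \<odot>\<^bsub>G.V\<^esub> extend M f x) g"
    proof (cases "g \<in> carrier G")
      case g: True
      let ?k = "inv\<^bsub>G\<^esub> g \<otimes>\<^bsub>G\<^esub> h"
      have k: "?k \<in> carrier G" using g h by simp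
      let ?y = "monomial R ?k \<one>\<^bsub>R\<^esub> \<odot>\<^bsub>M\<^esub> x"
      have y: "?y \<in> carrier M" using k x by (intro mc) simp_all
      have "monomial R (inv\<^bsub>G\<^esub> g) \<one>\<^bsub>R\<^esub> \<odot>\<^bsub>M\<^esub> (monomial R h r \<odot>\<^bsub>M\<^esub> x) = monomial R ?k r \<odot>\<^bsub>M\<^esub> x"
        using g h r x G.monomial_closed by (simp add: M.smult_assoc1[symmetric] G.monomial_mult)
      also have "\<dots> = monomial R \<one>\<^bsub>G\<^esub> r \<odot>\<^bsub>M\<^esub> ?y"
        using k r x G.monomial_closed by (simp add: M.smult_assoc1[symmetric] G.monomial_mult)
      finally have "extend M f (monomial R h r \<odot>\<^bsub>M\<^esub> x) g = f (monomial R \<one>\<^bsub>G\<^esub> r \<odot>\<^bsub>M\<^esub> ?y) \<one>\<^bsub>G\<^esub>"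
        using g by (simp add: extend_def)
      also have "\<dots> = (monomial R \<one>\<^bsub>G\<^esub> r \<otimes>\<^bsub>RK\<^esub> f ?y) \<one>\<^bsub>G\<^esub>"
        using module_homD(3)[OF fh monomial_K[OF one r] y] by (simp add: K.V_simps)
      also have "\<dots> = r \<otimes>\<^bsub>R\<^esub> f ?y \<one>\<^bsub>G\<^esub>"
        using K.monomial_mult_apply[OF one r fc[OF y] one] by (simp add: K_inv[OF one] K_mult)
      also have "\<dots> = r \<otimes>\<^bsub>R\<^esub> extend M f x (inv\<^bsub>G\<^esub> h \<otimes>\<^bsub>G\<^esub> g)"
        using g h by (simp add: extend_def G.H.inv_mult_group)
      also have "\<dots> = (monomial R h r \<otimes>\<^bsub>RG\<^esub> extend M f x) g"
        by (rule G.monomial_mult_apply[OF h r extend_closed[OF M f x] g, symmetric])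
      finally show ?thesis by (simp add: G.V_simps)
    next
      case False
      then show ?thesis by (simp add: extend_def G.V_simps G.mult_outside)
    qed
  qed
qed

lemma extend_compose:
  assumes M: "left_module RG M" and d: "d \<in> module_hom RG M N" and x: "x \<in> carrier M"
    and eq: "\<And>y. y \<in> carrier M \<Longrightarrow> f (d y) = f' y"
  shows "extend N f (d x) = extend M f' x"
proof
  interpret M: left_module RG M by fact
  fix g
  show "extend N f (d x) g = extend M f' x g"
  proof (cases "g \<in> carrier G")
    case True
    then have m: "monomial R (inv\<^bsub>G\<^esub> g) \<one>\<^bsub>R\<^esub> \<in> carrier RG" by (intro G.monomial_closed) simp_all
    show ?thesis
      using True eq[OF M.smult_closed[OF m x]] module_homD(3)[OF d m x] by (simp add: extend_def)
  qed (simp add: extend_def)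
qed

lemma extend_add:
  assumes "left_module RG M" "f \<in> module_hom RK M V" "x \<in> carrier M"
    and "\<And>y. y \<in> carrier M \<Longrightarrow> f'' y = f y \<oplus>\<^bsub>RK\<^esub> f' y"
  shows "extend M f'' x = extend M f x \<oplus>\<^bsub>RG\<^esub> extend M f' x"
proof
  interpret M: left_module RG M by fact
  fix g
  show "extend M f'' x g = (extend M f x \<oplus>\<^bsub>RG\<^esub> extend M f' x) g"
    using assms(3,4) by (simp add: extend_def G.add_apply K.add_apply M.smult_closed G.monomial_closed)
qed

lemma extend_zero:
  assumes "left_module RG M" "x \<in> carrier M" "\<And>y. y \<in> carrier M \<Longrightarrow> f y = \<zero>\<^bsub>V\<^esub>"
  shows "extend M f x = \<zero>\<^bsub>RG\<^esub>"
proof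
  interpret M: left_module RG M by fact
  fix g
  show "extend M f x g = \<zero>\<^bsub>RG\<^esub> g"
    using assms(2,3)
    by (simp add: extend_def G.zero_apply K.zero_apply K.V_simps M.smult_closed G.monomial_closed)
qed

text \<open>The support of \<open>F\<close> at \<open>t^j x\<close> is that of \<open>F x\<close>
  moved by \<open>t^j\<close>. As the latter is finite, the moved support misses \<open>K\<close>
  for large \<open>j\<close> in either direction.\<close>

lemma core_compact:
  assumes M: "left_module RG M" and F: "F \<in> module_hom RG M G.V"
  shows "compact_cochain M (core F)"
  unfolding compact_cochain_def
proof (intro conjI)
  note Fc = G.hom_V_closed[OF F]
  have cc: "core F x \<in> carrier RK" if "x \<in> carrier M" for x
    using G.carrierD[OF Fc[OF that]]
    by (intro K.carrierI[of _ "{g. F x g \<noteq> \<zero>\<^bsub>R\<^esub>}"]) (auto simp: core_def)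
  show "core F \<in> module_hom RK M V"
  proof (rule K.module_hom_monomialI[OF restrict_scalars[OF M] V])
    fix x assume x: "x \<in> carrier M"
    show "core F x \<in> carrier V" using cc[OF x] by (simp add: K.V_simps)
    {
      fix y assume y: "y \<in> carrier M"
      show "core F (x \<oplus>\<^bsub>M\<^esub> y) = core F x \<oplus>\<^bsub>V\<^esub> core F y"
        using module_homD(2)[OF F x y] by (auto simp: core_def K.V_simps G.V_simps K.add_apply G.add_apply fun_eq_iff)
    }
    fix k r assume k: "k \<in> carrier K" and r: "r \<in> carrier R"
    have kG: "k \<in> carrier G" using k by (simp add: K_iff)
    show "core F (monomial R k r \<odot>\<^bsub>M\<^esub> x) = monomial R k r \<odot>\<^bsub>V\<^esub> core F x"
    proof
      fix g
      show "core F (monomial R k r \<odot>\<^bsub>M\<^esub> x) g = (monomial R k r \<odot>\<^bsub>V\<^esub> core F x) g"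
      proof (cases "g \<in> carrier K")
        case g: True
        then have "inv\<^bsub>G\<^esub> k \<otimes>\<^bsub>G\<^esub> g \<in> carrier K" using k by (simp add: K_iff phi_mult phi_inv)
        moreover have "g \<in> carrier G" using g by (simp add: K_iff)
        ultimately show ?thesis
          using module_homD(3)[OF F G.monomial_closed[OF kG r] x] g
          by (simp add: core_def K.V_simps G.V_simps G.monomial_mult_apply[OF kG r Fc[OF x]]
              K.monomial_mult_apply[OF k r cc[OF x]] K_inv[OF k] K_mult)
      qed (simp add: core_def K.V_simps K.mult_outside)
    qed
  qed
  have shift: "\<exists>N. \<forall>j. \<bar>j\<bar> \<ge> N \<longrightarrow> core F (act M j x) = \<zero>\<^bsub>V\<^esub>" if x: "x \<in> carrier M" for x
  proof -
    have "finite (\<phi> ` {g. F x g \<noteq> \<zero>\<^bsub>R\<^esub>})" using G.carrierD(3)[OF Fc[OF x]] by simp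
    from int_set_bounded[OF this] obtain N where N: "\<And>j. j \<in> \<phi> ` {g. F x g \<noteq> \<zero>\<^bsub>R\<^esub>} \<Longrightarrow> \<bar>j\<bar> \<le> N" by metis
    have "core F (act M j x) = \<zero>\<^bsub>V\<^esub>" if j: "\<bar>j\<bar> \<ge> N + 1" for j
    proof
      fix g
      show "core F (act M j x) g = \<zero>\<^bsub>V\<^esub> g"
      proof (cases "g \<in> carrier K")
        case True
        then have g: "g \<in> carrier G" "\<phi> g = 0" by (auto simp: K_iff)
        let ?g = "inv\<^bsub>G\<^esub> (t [^]\<^bsub>G\<^esub> j) \<otimes>\<^bsub>G\<^esub> g"
        have "\<phi> ?g = - j" using g t_pow by (simp add: phi_mult phi_inv phi_pow)
        then have "F x ?g = \<zero>\<^bsub>R\<^esub>" using N[of "- j"] j by force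
        moreover have "F (act M j x) = monomial R (t [^]\<^bsub>G\<^esub> j) \<one>\<^bsub>R\<^esub> \<otimes>\<^bsub>RG\<^esub> F x"
          unfolding act_def using module_homD(3)[OF F G.monomial_closed[OF t_pow] x] by (simp add: G.V_simps)
        ultimately show ?thesis
          using g by (simp add: core_def K.V_simps K.zero_apply G.monomial_mult_apply[OF t_pow _ Fc[OF x]])
      qed (simp add: core_def K.V_simps K.zero_apply)
    qed
    then show ?thesis by blast
  qed
  show "vanishes_up M \<zero>\<^bsub>V\<^esub> (core F)"
    unfolding vanishes_up_def
  proof
    fix x assume "x \<in> carrier M"
    then obtain N where "\<forall>j. \<bar>j\<bar> \<ge> N \<longrightarrow> core F (act M j x) = \<zero>\<^bsub>V\<^esub>" using shift by blast
    then show "\<exists>N. \<forall>j\<ge>N. core F (act M j x) = \<zero>\<^bsub>V\<^esub>" by (intro exI[of _ N]) simp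
  qed
  show "vanishes_down M \<zero>\<^bsub>V\<^esub> (core F)"
    unfolding vanishes_down_def
  proof
    fix x assume "x \<in> carrier M"
    then obtain N where "\<forall>j. \<bar>j\<bar> \<ge> N \<longrightarrow> core F (act M j x) = \<zero>\<^bsub>V\<^esub>" using shift by blast
    then show "\<exists>N. \<forall>j\<ge>N. core F (act M (- j) x) = \<zero>\<^bsub>V\<^esub>" by (intro exI[of _ N]) simp
  qed
qed

lemma extend_core:
  assumes F: "F \<in> module_hom RG M G.V" and x: "x \<in> carrier M"
  shows "extend M (core F) x = F x"
proof
  fix g
  show "extend M (core F) x g = F x g"
    using G.hom_V_apply[OF F x, of g] G.carrierD(2)[OF G.hom_V_closed[OF F x], of g]
    by (simp add: extend_def core_def K_iff phi_one)
qed

lemma opposite_group_ring_carrier: "carrier (group_ring (opposite_ring R) K) = carrier RK"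
  by (simp add: group_ring_def opposite_ring_def)

end

section \<open>The connecting map on cohomology\<close>

context compared_resolutions
begin

abbreviation S where "S \<equiv> group_ring (opposite_ring R) K"

abbreviation cocycle_module_K where
  "cocycle_module_K i \<equiv> (cochains R K (Q i))\<lparr>carrier := cocycles R K Q e i\<rparr>"

abbreviation cocycle_module_G where
  "cocycle_module_G i \<equiv> (cochains R G (P i))\<lparr>carrier := cocycles R G P d i\<rparr>"

definition connecting_cocycle :: "nat \<Rightarrow> ('q \<Rightarrow> 'g \<Rightarrow> 'r) \<Rightarrow> 'p \<Rightarrow> 'g \<Rightarrow> 'r"
  where "connecting_cocycle i c = restrict (extend (P (Suc i)) (connecting i c)) (carrier (P (Suc i)))"

lemma quotient_data_K: "quotient_data S (cocycle_module_K i) (coboundaries R K Q e i)"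
  by (rule K.quotient_data_cohomology[OF Q.resolution_axioms]) (simp add: opposite_group_ring_carrier)

lemma quotient_data_G: "quotient_data S (cocycle_module_G i) (coboundaries R G P d i)"
  by (rule G.quotient_data_cohomology[OF P.resolution_axioms])
    (auto simp: opposite_group_ring_carrier intro: RK_subset)

lemma cocycle_K:
  assumes "c \<in> cocycles R K Q e i"
  shows "c \<in> module_hom RK (Q i) V" "\<And>y. y \<in> carrier (Q (Suc i)) \<Longrightarrow> c (e i y) = \<zero>\<^bsub>V\<^esub>"
  using K.cocyclesD[OF assms] by (simp_all add: K.V_simps)

lemma connecting_arg: "x \<in> carrier (P (Suc i)) \<Longrightarrow> v i (p i (d i x)) \<in> carrier (Q i)"
  by (rule closed(1)[OF closed(5)[OF closed(7)]])

lemma connecting_cocycle_closed: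
  assumes "c \<in> cocycles R K Q e i"
  shows "connecting_cocycle i c \<in> cocycles R G P d (Suc i)"
  unfolding connecting_cocycle_def
proof (rule G.cocyclesI[where P = P and d = d and i = "Suc i", OF P.P P.d])
  note c = cocycle_K[OF assms]
  show "extend (P (Suc i)) (connecting i c) \<in> module_hom RG (P (Suc i)) G.V"
    by (rule extend_hom[OF P.P connecting_compact(1)[OF c]])
  fix x assume x: "x \<in> carrier (P (Suc (Suc i)))"
  have "extend (P (Suc i)) (connecting i c) (d (Suc i) x) = extend (P (Suc (Suc i))) (\<lambda>y. \<zero>\<^bsub>V\<^esub>) x"
    by (rule extend_compose[OF P.P P.d x]) (rule connecting_compact(2)[OF c])
  also have "\<dots> = \<zero>\<^bsub>RG\<^esub>" by (rule extend_zero[OF P.P x refl])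
  finally show "extend (P (Suc i)) (connecting i c) (d (Suc i) x) = \<zero>\<^bsub>RG\<^esub>" .
qed

text \<open>The connecting map changes the argument of a cochain, while scalars multiply its values
  on the right. The values over \<open>G\<close> have coefficients off \<open>K\<close> as well, so
  the two sides are compared at the identity, which suffices by \<open>hom_V_eqI\<close> and
  involves coefficients on \<open>K\<close> alone.\<close>

lemma connecting_cocycle_hom:
  "connecting_cocycle i \<in> module_hom S (cocycle_module_K i) (cocycle_module_G (Suc i))"
proof (rule module_homI)
  let ?X = "carrier (P (Suc i))"
  fix c assume "c \<in> carrier (cocycle_module_K i)"
  then have c: "c \<in> cocycles R K Q e i" by simp
  then show "connecting_cocycle i c \<in> carrier (cocycle_module_G (Suc i))"
    by (simp add: connecting_cocycle_closed)
  note compact = connecting_compact(1)[OF cocycle_K[OF c]]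
  note ch = compact_cochain_hom[OF compact]
  note eh = extend_hom[OF P.P compact]
  {
    fix c' assume "c' \<in> carrier (cocycle_module_K i)"
    have "extend (P (Suc i)) (connecting i (\<lambda>x\<in>carrier (Q i). c x \<oplus>\<^bsub>RK\<^esub> c' x)) x =
        extend (P (Suc i)) (connecting i c) x \<oplus>\<^bsub>RG\<^esub> extend (P (Suc i)) (connecting i c') x"
      if x: "x \<in> ?X" for x
    proof (rule extend_add[OF P.P ch x])
      fix y assume "y \<in> carrier (P (Suc i))"
      then have "v i (p i (d i y)) \<in> carrier (Q i)" by (rule connecting_arg)
      then show "connecting i (\<lambda>x\<in>carrier (Q i). c x \<oplus>\<^bsub>RK\<^esub> c' x) y =
          connecting i c y \<oplus>\<^bsub>RK\<^esub> connecting i c' y"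
        unfolding connecting_def by simp
    qed
    then show "connecting_cocycle i (c \<oplus>\<^bsub>cocycle_module_K i\<^esub> c') =
        connecting_cocycle i c \<oplus>\<^bsub>cocycle_module_G (Suc i)\<^esub> connecting_cocycle i c'"
      by (auto simp: connecting_cocycle_def K.cochains_simps G.cochains_simps intro!: restrict_ext)
  }
  fix a assume "a \<in> carrier S"
  then have a: "a \<in> carrier RK" by (simp add: opposite_group_ring_carrier)
  note aG = RK_subset[OF a]
  let ?ac = "\<lambda>x\<in>carrier (Q i). c x \<otimes>\<^bsub>RK\<^esub> group_ring_inversion R K a"
  have ac: "?ac \<in> cocycles R K Q e i"
    using quotient_data.smult_closed[OF quotient_data_K[of i], of a c] a c
    by (simp add: opposite_group_ring_carrier K.cochains_simps)
  note compact' = connecting_compact(1)[OF cocycle_K[OF ac]]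
  have "extend (P (Suc i)) (connecting i ?ac) x =
      extend (P (Suc i)) (connecting i c) x \<otimes>\<^bsub>RG\<^esub> group_ring_inversion R G a" if x: "x \<in> ?X" for x
  proof (rule G.hom_V_eqI[OF P.P extend_hom[OF P.P compact']
        G.hom_V_mult_right[OF P.P eh G.inversion_closed[OF aG]] _ x])
    fix x assume x: "x \<in> ?X"
    let ?y = "v i (p i (d i x))"
    have cy: "c ?y \<in> carrier RK"
      by (rule K.hom_V_closed[OF cocycle_K(1)[OF c] connecting_arg[OF x]])
    have "extend (P (Suc i)) (connecting i ?ac) x \<one>\<^bsub>G\<^esub> = connecting i ?ac x \<one>\<^bsub>G\<^esub>"
      by (rule extend_one[OF compact_cochain_hom[OF compact'] x])
    also have "\<dots> = (c ?y \<otimes>\<^bsub>RK\<^esub> group_ring_inversion R K a) \<one>\<^bsub>K\<^esub>"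
      using connecting_arg[OF x] by (simp add: connecting_def K_one)
    also have "\<dots> = (\<Oplus>\<^bsub>R\<^esub>g\<in>{g. a g \<noteq> \<zero>\<^bsub>R\<^esub>}. c ?y g \<otimes>\<^bsub>R\<^esub> a g)"
      by (rule K.mult_inversion_one[OF a cy])
    also have "\<dots> = (\<Oplus>\<^bsub>R\<^esub>g\<in>{g. a g \<noteq> \<zero>\<^bsub>R\<^esub>}. extend (P (Suc i)) (connecting i c) x g \<otimes>\<^bsub>R\<^esub> a g)"
    proof (rule G.R.finsum_cong')
      fix g assume "g \<in> {g. a g \<noteq> \<zero>\<^bsub>R\<^esub>}"
      then have "g \<in> carrier K" using K.carrierD(4)[OF a] by blast
      then show "c ?y g \<otimes>\<^bsub>R\<^esub> a g = extend (P (Suc i)) (connecting i c) x g \<otimes>\<^bsub>R\<^esub> a g"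
        using extend_K[OF ch x] by (simp add: connecting_def)
    qed (use K.carrierD(1)[OF a] G.carrierD(1)[OF extend_closed[OF P.P compact x]] in auto)
    also have "\<dots> = (extend (P (Suc i)) (connecting i c) x \<otimes>\<^bsub>RG\<^esub> group_ring_inversion R G a) \<one>\<^bsub>G\<^esub>"
      by (rule G.mult_inversion_one[OF aG extend_closed[OF P.P compact x], symmetric])
    finally show "extend (P (Suc i)) (connecting i ?ac) x \<one>\<^bsub>G\<^esub> =
        (extend (P (Suc i)) (connecting i c) x \<otimes>\<^bsub>RG\<^esub> group_ring_inversion R G a) \<one>\<^bsub>G\<^esub>" .
  qed
  then show "connecting_cocycle i (a \<odot>\<^bsub>cocycle_module_K i\<^esub> c) =
      a \<odot>\<^bsub>cocycle_module_G (Suc i)\<^esub> connecting_cocycle i c"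
    by (auto simp: connecting_cocycle_def K.cochains_simps G.cochains_simps intro!: restrict_ext)
qed

text \<open>Taking components at \<open>K\<close> turns a primitive over \<open>RG\<close> into a
  compact one, and extension turns it back, so the question becomes the one on compact cochains
  settled by \<open>connecting_injective\<close> and \<open>connecting_coboundary\<close>.\<close>

lemma connecting_cocycle_kernel:
  assumes FP: "type_FP TYPE('f) R K n" and i: "i \<le> n" and c: "c \<in> cocycles R K Q e i"
  shows "connecting_cocycle i c \<in> coboundaries R G P d (Suc i) \<longleftrightarrow> c \<in> coboundaries R K Q e i"
proof -
  note cK = cocycle_K[OF c]
  note compact = connecting_compact(1)[OF cK]
  have cocycle_ext: "connecting_cocycle i c \<in> extensional (carrier (P (Suc i)))"
    by (simp add: connecting_cocycle_def)
  have connecting_iff: "connecting_cocycle i c \<in> coboundaries R G P d (Suc i) \<longleftrightarrow>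
      (\<exists>b\<in>module_hom RG (P i) G.V. \<forall>x\<in>carrier (P (Suc i)). extend (P (Suc i)) (connecting i c) x = b (d i x))"
    using G.coboundaries_iff[where P = P and d = d and i = "Suc i", OF P.P P.d cocycle_ext]
    by (simp add: connecting_cocycle_def)
  have cob_iff: "c \<in> coboundaries R K Q e i \<longleftrightarrow>
    (case i of 0 \<Rightarrow> \<forall>x\<in>carrier (Q 0). c x = \<zero>\<^bsub>V\<^esub>
     | Suc j \<Rightarrow> \<exists>b\<in>module_hom RK (Q j) V. \<forall>x\<in>carrier (Q i). c x = b (e j x))"
    using K.coboundaries_iff[where P = Q and d = e and i = i, OF Q.P Q.d K.cocyclesD(2)[OF c]]
    by (cases i) (simp_all add: K.V_simps)
  show ?thesis
  proof
    assume "connecting_cocycle i c \<in> coboundaries R G P d (Suc i)"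
    then obtain b where b: "b \<in> module_hom RG (P i) G.V"
      "\<And>x. x \<in> carrier (P (Suc i)) \<Longrightarrow> extend (P (Suc i)) (connecting i c) x = b (d i x)"
      using connecting_iff by blast
    have "core b (d i x) = connecting i c x" if x: "x \<in> carrier (P (Suc i))" for x
    proof
      fix g
      show "core b (d i x) g = connecting i c x g"
        using b(2)[OF x] extend_K[OF compact_cochain_hom[OF compact] x, of g]
          K.carrierD(2)[OF K.hom_V_closed[OF compact_cochain_hom[OF compact] x], of g]
        by (auto simp: core_def)
    qed
    from connecting_injective[OF FP i cK core_compact[OF P.P b(1)] this]
    show "c \<in> coboundaries R K Q e i" using cob_iff by blast
  next
    assume cB: "c \<in> coboundaries R K Q e i"
    obtain g where g: "compact_cochain (P i) g"
      "\<And>x. x \<in> carrier (P (Suc i)) \<Longrightarrow> g (d i x) = connecting i c x"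
    proof (cases i)
      case 0
      have "compact_cochain (P i) (\<lambda>x. \<zero>\<^bsub>V\<^esub>)"
        unfolding compact_cochain_def
        by (auto intro: module_hom_zero[OF V] simp: vanishes_up_def vanishes_down_def)
      moreover have "\<zero>\<^bsub>V\<^esub> = connecting i c x" if "x \<in> carrier (P (Suc i))" for x
        using cB cob_iff connecting_arg[OF that] by (simp add: 0 connecting_def)
      ultimately show thesis by (rule that)
    next
      case (Suc j)
      then obtain b where b: "b \<in> module_hom RK (Q j) V" "\<And>y. y \<in> carrier (Q (Suc j)) \<Longrightarrow> c y = b (e j y)"
        using cB cob_iff by auto
      from connecting_coboundary[OF b] show thesis using that unfolding Suc by blast
    qed
    have "extend (P (Suc i)) (connecting i c) x = extend (P i) g (d i x)" if x: "x \<in> carrier (P (Suc i))" for x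
      using extend_compose[OF P.P P.d x, of g "connecting i c"] g(2) by simp
    then show "connecting_cocycle i c \<in> coboundaries R G P d (Suc i)"
      using extend_hom[OF P.P g(1)] connecting_iff by blast
  qed
qed

lemma connecting_cocycle_surjective:
  assumes FP: "type_FP TYPE('f) R K n" and i: "Suc i \<le> n" and F: "F \<in> cocycles R G P d (Suc i)"
  shows "\<exists>c\<in>cocycles R K Q e i. \<exists>b\<in>coboundaries R G P d (Suc i).
    F = b \<oplus>\<^bsub>cocycle_module_G (Suc i)\<^esub> connecting_cocycle i c"
proof -
  note Fh = G.cocyclesD[OF F]
  note f = core_compact[OF P.P Fh(1)]
  have fd: "core F (d (Suc i) x) = \<zero>\<^bsub>V\<^esub>" if "x \<in> carrier (P (Suc (Suc i)))" for x
    using Fh(3)[OF that] by (simp add: core_def fun_eq_iff K.V_simps K.zero_apply G.zero_apply)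
  obtain c g where c: "c \<in> module_hom RK (Q i) V" "\<And>y. y \<in> carrier (Q (Suc i)) \<Longrightarrow> c (e i y) = \<zero>\<^bsub>V\<^esub>"
    and g: "compact_cochain (P i) g"
    "\<And>x. x \<in> carrier (P (Suc i)) \<Longrightarrow> core F x = connecting i c x \<oplus>\<^bsub>V\<^esub> g (d i x)"
    using connecting_surjective[OF FP i f fd] by blast
  let ?c = "restrict c (carrier (Q i))" and ?b = "\<lambda>x\<in>carrier (P (Suc i)). extend (P i) g (d i x)"
  have cZ: "?c \<in> cocycles R K Q e i"
    using c by (intro K.cocyclesI Q.P Q.d) (simp_all add: K.V_simps)
  have b: "?b \<in> coboundaries R G P d (Suc i)"
    using G.coboundaries_iff[where P = P and d = d and i = "Suc i" and f = ?b, OF P.P P.d] extend_hom[OF P.P g(1)]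
    by auto
  have "F x = extend (P i) g (d i x) \<oplus>\<^bsub>RG\<^esub> extend (P (Suc i)) (connecting i ?c) x"
    if x: "x \<in> carrier (P (Suc i))" for x
  proof -
    note gh = compact_cochain_hom[OF g(1)]
    have gd: "(\<lambda>y. g (d i y)) \<in> module_hom RK (P (Suc i)) V" by (rule module_hom_compose[OF PK.d gh])
    have "F x = extend (P (Suc i)) (core F) x" using extend_core[OF Fh(1) x] by simp
    also have "\<dots> = extend (P (Suc i)) (\<lambda>y. g (d i y)) x \<oplus>\<^bsub>RG\<^esub> extend (P (Suc i)) (connecting i ?c) x"
    proof (rule extend_add[OF P.P gd x])
      fix y assume y: "y \<in> carrier (P (Suc i))"
      have "connecting i ?c y = connecting i c y" using connecting_arg[OF y] by (simp add: connecting_def)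
      then show "core F y = g (d i y) \<oplus>\<^bsub>RK\<^esub> connecting i ?c y"
        using g(2)[OF y] module_homD(1)[OF gd y] module_homD(1)[OF c(1) connecting_arg[OF y]]
        by (simp add: K.V_simps K.A.a_comm connecting_def)
    qed
    also have "extend (P (Suc i)) (\<lambda>y. g (d i y)) x = extend (P i) g (d i x)"
      by (rule extend_compose[OF P.P P.d x refl, symmetric])
    finally show ?thesis .
  qed
  then have "F = ?b \<oplus>\<^bsub>cocycle_module_G (Suc i)\<^esub> connecting_cocycle i ?c"
    using Fh(2) by (intro extensionalityI[of F "carrier (P (Suc i))"])
      (simp_all add: G.cochains_simps connecting_cocycle_def)
  then show ?thesis using cZ b by blast
qed

text \<open>Exactness of \<open>C\<^sub>+\<close> and \<open>C\<^sub>-\<close> is available in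
  degree \<open>n\<close>, which identifies the kernel; the argument for surjectivity would call for
  degree \<open>n + 1\<close>.\<close>

lemma cohomology_embedding:
  assumes "type_FP TYPE('f) R K n"
  shows "\<exists>N. submodule N S (cohomology R G P d (Suc n)) \<and>
    module_isomorphic S (cohomology R K Q e n) ((cohomology R G P d (Suc n))\<lparr>carrier := N\<rparr>)"
  using quotient_embedding[OF quotient_data_K quotient_data_G connecting_cocycle_hom
      connecting_cocycle_kernel[OF assms order_refl]]
  unfolding cohomology_def by auto

lemma cohomology_isomorphic:
  assumes FP: "type_FP TYPE('f) R K n" and i: "i < n"
  shows "module_isomorphic S (cohomology R G P d (Suc i)) (cohomology R K Q e i)"
  unfolding cohomology_def
proof (rule quotient_isomorphism[OF quotient_data_K quotient_data_G connecting_cocycle_hom])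
  show "connecting_cocycle i c \<in> coboundaries R G P d (Suc i) \<longleftrightarrow> c \<in> coboundaries R K Q e i"
    if "c \<in> carrier (cocycle_module_K i)" for c
    using that by (intro connecting_cocycle_kernel[OF FP less_imp_le[OF i]]) simp
  show "\<exists>c\<in>carrier (cocycle_module_K i). \<exists>b\<in>coboundaries R G P d (Suc i).
      F = b \<oplus>\<^bsub>cocycle_module_G (Suc i)\<^esub> connecting_cocycle i c"
    if "F \<in> carrier (cocycle_module_G (Suc i))" for F
    using connecting_cocycle_surjective[OF FP Suc_leI[OF i], of F] that by simp
qed

end

theorem theorem4:
  fixes R :: "('r, 'u) ring_scheme" and G :: "('g, 'v) monoid_scheme"
    and K :: "('g, 'v) monoid_scheme" and \<phi> :: "'g \<Rightarrow> int" and n :: nat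
    and P :: "nat \<Rightarrow> ('g \<Rightarrow> 'r, 'p) module" and d :: "nat \<Rightarrow> 'p \<Rightarrow> 'p" and \<epsilon> :: "'p \<Rightarrow> 'r"
    and Q :: "nat \<Rightarrow> ('g \<Rightarrow> 'r, 'q) module" and e :: "nat \<Rightarrow> 'q \<Rightarrow> 'q" and \<eta> :: "'q \<Rightarrow> 'r"
  assumes "ring R" and "\<one>\<^bsub>R\<^esub> \<noteq> \<zero>\<^bsub>R\<^esub>"
    and "group G"
    and "\<phi> \<in> epi G integer_group"
    and "K = G\<lparr>carrier := kernel G integer_group \<phi>\<rparr>"
    and "type_FP TYPE('f) R K n"
    and "projective_resolution (group_ring R G) (trivial_module R G) P d \<epsilon>"
    and "projective_resolution (group_ring R K) (trivial_module R K) Q e \<eta>"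
  shows "(\<forall>i<n. module_isomorphic (group_ring (opposite_ring R) K)
                  (cohomology R G P d (i + 1)) (cohomology R K Q e i)) \<and>
         (\<exists>N. submodule N (group_ring (opposite_ring R) K) (cohomology R G P d (n + 1)) \<and>
              module_isomorphic (group_ring (opposite_ring R) K)
                (cohomology R K Q e n) ((cohomology R G P d (n + 1))\<lparr>carrier := N\<rparr>))"
proof -
  interpret G: group G by fact
  have hom: "\<phi> \<in> hom G integer_group" and onto: "\<phi> ` carrier G = UNIV"
    using assms(4) by (auto simp: epi_def)
  obtain t where t: "t \<in> carrier G" "\<phi> t = 1"
    using onto by (metis UNIV_I imageE)
  have phi: "group_hom G integer_group \<phi>"
    by (intro group_hom.intro group_hom_axioms.intro G.group_axioms group_integer_group hom)
  have K: "K = G\<lparr>carrier := {g \<in> carrier G. \<phi> g = 0}\<rparr>"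
    by (simp add: assms(5) kernel_def)
  have "group K"
    unfolding assms(5) by (rule G.subgroup_imp_group[OF group_hom.subgroup_kernel[OF phi]])
  have "ring (group_ring R G)" "ring (group_ring R K)"
    using projective_resolutionD(1)[OF assms(7)] projective_resolutionD(1)[OF assms(8)]
    by (auto dest: left_module.axioms(1))
  then interpret cyclic_quotient R G K \<phi> t
    by (intro cyclic_quotient.intro cyclic_quotient_axioms.intro group_algebra.intro assms(1,3) \<open>group K\<close> hom K t)
  obtain v u h k where comparison: "chain_map RK P d \<epsilon> Q e \<eta> v" "chain_map RK Q e \<eta> P d \<epsilon> u"
    "homotopy_to_id RK P d (\<lambda>i x. u i (v i x)) h" "homotopy_to_id RK Q e (\<lambda>i x. v i (u i x)) k"
    by (rule comparison_maps[OF assms(7,8)])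
  have "projective_module RG (P i)" for i
    by (rule assms(7)[unfolded projective_resolution_def, THEN conjunct1, THEN spec])
  \<comment> \<open>Pairing the two halves lets a single choice over all degrees keep them
    matched.\<close>
  then have "\<exists>pq. fst pq \<in> module_hom RK (P i) (P i) \<and> snd pq \<in> module_hom RK (P i) (P i) \<and>
      (\<forall>x\<in>carrier (P i). fst pq x \<oplus>\<^bsub>P i\<^esub> snd pq x = x) \<and>
      vanishes_up (P i) \<zero>\<^bsub>P i\<^esub> (fst pq) \<and> vanishes_down (P i) \<zero>\<^bsub>P i\<^esub> (snd pq)" for i
    using projective_halves[of "P i"] by (metis fst_conv snd_conv)
  then obtain pq where pq: "\<And>i. fst (pq i) \<in> module_hom RK (P i) (P i)"
    "\<And>i. snd (pq i) \<in> module_hom RK (P i) (P i)"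
    "\<And>i x. x \<in> carrier (P i) \<Longrightarrow> fst (pq i) x \<oplus>\<^bsub>P i\<^esub> snd (pq i) x = x"
    "\<And>i. vanishes_up (P i) \<zero>\<^bsub>P i\<^esub> (fst (pq i))" "\<And>i. vanishes_down (P i) \<zero>\<^bsub>P i\<^esub> (snd (pq i))"
    by metis
  interpret compared_resolutions R G K \<phi> t P d \<epsilon> Q e \<eta> v u h k "\<lambda>i. fst (pq i)" "\<lambda>i. snd (pq i)"
    by (intro compared_resolutions.intro compared_resolutions_axioms.intro cyclic_quotient_axioms assms(7,8)
        comparison pq)
  show ?thesis
    using cohomology_isomorphic[OF assms(6)] cohomology_embedding[OF assms(6)] by simp
qed

end
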